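(* Let $H,A,(S_t)_{t\ge0},W,\alpha,\sigma$ be as described in the context, and let $K\subset\mathcal{D}(A)$ be a finite dimensional subspace. Let $\epsilon>0$ be arbitrary. Assume $K\subset\mathcal{D}(A^2)$, $AK\subset\mathcal{D}(A^* )$, and $$d_K^{\mathcal{D}(A)}(Ah+\alpha(h))\le\epsilon,\quad h\in K,$$ $$\sigma^j(h)\in K,\quad h\in K,\quad\text{for all } j\in\mathbb{N}.$$ Then for all $x_0\in\mathcal{D}(A)$ and $\delta>0$ there exist a time horizon $S\in(0,T]$ and an open neighborhood $U(x_0,\delta)\subset\mathcal{D}(A)$ of $x_0$ in the Hilbert space $(\mathcal{D}(A),\|\cdot\|_{\mathcal{D}(A)})$ such that $$\mathbb{E}\big[\|X(t;x)-Y(t;x)\|^2\big]^{1/2}\le\delta,\quad (t,x)\in[0,S]\times(K\cap U(x_0,\delta)).$$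
   Context: $\mathbb{R}_+=[0,\infty)$. Fix $T>0$ and a filtered probability space $(\Omega,\mathcal{F},(\mathcal{F}_t)_{t\in[0,T]},\mathbb{P})$ satisfying the usual conditions. $H$ is a separable Hilbert space with norm $\|\cdot\|$ and $A$ generates a $C_0$-semigroup $(S_t)_{t\ge 0}$ on $H$ with $\|S_t\|\le e^{\beta t}$, $t\ge 0$, for some $\beta\in\mathbb{R}_+$. $U$ is a separable Hilbert space and $W$ is a $U$-valued $Q$-Wiener process, $Q\in L(U)$ nuclear, self-adjoint, positive definite, with orthonormal basis $\{e_j\}_{j\in\mathbb{N}}$ of $U$ and $\lambda_j>0$, $\sum_j\lambda_j<\infty$, $Qe_j=\lambda_je_j$. $U_0:=Q^{1/2}(U)$ has inner product $\langle u,v\rangle_{U_0}=\langle Q^{-1/2}u,Q^{-1/2}v\rangle_U$ and orthonormal basis $g_j:=\sqrt{\lambda_j}e_j$; for a Hilbert space $E$, $L_2^0(E)$ is the space of Hilbert-Schmidt operators from $U_0$ to $E$. The following conditions hold with $E=H$: $\alpha:E\to E$ and $\sigma:E\to L_2^0(E)$ are Lipschitz continuous; $\sigma^j:=\sigma(\cdot)g_j\in C_b^2(E)$ for each $j$ (twice continuously differentiable, bounded with bounded first and second derivatives); $\sum_jL_j<\infty$, where $L_j:=\frac12(\kappa_{j,2}^2+\kappa_{j,1}\kappa_{j,3})$ and $\kappa_{j,1},\kappa_{j,2},\kappa_{j,3}$ are the suprema over $E$ of the norms of $\sigma^j$, $D\sigma^j$, $D^2\sigma^j$; and $\lim_{r\to\infty}\frac12\sum_{j=1}^rD\sigma^j(h)\sigma^j(h)$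 exists in $E$ for each $h\in E$. Moreover $\alpha(\mathcal{D}(A))\subset\mathcal{D}(A)$, $\sigma(\mathcal{D}(A))\subset L_2^0(\mathcal{D}(A))$, and the restrictions of $\alpha,\sigma$ to $\mathcal{D}(A)$ satisfy the same conditions with $E=\mathcal{D}(A)$ equipped with the graph norm $\|h\|_{\mathcal{D}(A)}=\sqrt{\|h\|^2+\|Ah\|^2}$. $d_K^{\mathcal{D}(A)}(x):=\inf_{y\in K}\|x-y\|_{\mathcal{D}(A)}$ for $x\in\mathcal{D}(A)$. $\pi_K^{\mathcal{D}(A)}$ is the orthogonal projection of $(\mathcal{D}(A),\|\cdot\|_{\mathcal{D}(A)})$ onto $K$; since $AK\subset\mathcal{D}(A^* )$ it extends to a continuous linear operator $\pi_K^{\mathcal{D}(A)}\in L(H,K)$ on $(H,\|\cdot\|)$, denoted by the same symbol. $X(\cdot;x)$ is the mild solution of $dX(t)=(AX(t)+\alpha(X(t)))dt+\sigma(X(t))dW(t)$, $X(0)=x$, i.e. the continuous adapted process with $X(t)=S_tx+\int_0^tS_{t-s}\alpha(X(s))ds+\int_0^tS_{t-s}\sigma(X(s))dW(s)$, $t\in[0,T]$ (for $x\in\mathcal{D}(A)$ it is also a mild solution on the state space $(\mathcal{D}(A),\|\cdot\|_{\mathcal{D}(A)})$ and a strong solution on $H$). For $x\in K$, $Y(\cdot;x)$ is the $K$-valued strong solution of $dY(t)=\pi_K^{\mathcal{D}(A)}(AY(t)+\alpha(Y(t)))dt+\sigma(Y(t))dW(t)$, $Y(0)=x$. *)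

theory Defs
  imports "HOL-Probability.Probability"
begin

(* A separable real Hilbert space is a type of sort
   {real_inner, banach, second_countable_topology}. *)

section \<open>Semigroups, generators, graph norm\<close>

definition C0_semigroup :: "(real \<Rightarrow> 'h::{real_inner, banach} \<Rightarrow>\<^sub>L 'h) \<Rightarrow> bool" where
  "C0_semigroup S \<longleftrightarrow>
     S 0 = id_blinfun \<and>
     (\<forall>s\<ge>0. \<forall>t\<ge>0. S (s + t) = S s o\<^sub>L S t) \<and>
     (\<forall>h. ((\<lambda>t. S t h) \<longlongrightarrow> h) (at_right 0))"

definition gen_dom :: "(real \<Rightarrow> 'h::{real_inner, banach} \<Rightarrow>\<^sub>L 'h) \<Rightarrow> 'h set" where
  "gen_dom S = {h. \<exists>l. ((\<lambda>t. (S t h - h) /\<^sub>R t) \<longlongrightarrow> l) (at_right 0)}"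

(* Meaningful on gen_dom S only. *)
definition gen :: "(real \<Rightarrow> 'h::{real_inner, banach} \<Rightarrow>\<^sub>L 'h) \<Rightarrow> 'h \<Rightarrow> 'h" where
  "gen S h = Lim (at_right 0) (\<lambda>t. (S t h - h) /\<^sub>R t)"

definition gen_dom2 :: "(real \<Rightarrow> 'h::{real_inner, banach} \<Rightarrow>\<^sub>L 'h) \<Rightarrow> 'h set" where
  "gen_dom2 S = {h \<in> gen_dom S. gen S h \<in> gen_dom S}"

definition gen_adj_dom :: "(real \<Rightarrow> 'h::{real_inner, banach} \<Rightarrow>\<^sub>L 'h) \<Rightarrow> 'h set" where
  "gen_adj_dom S = {y. \<exists>z. \<forall>x\<in>gen_dom S. gen S x \<bullet> y = x \<bullet> z}"

definition graph_inner :: "(real \<Rightarrow> 'h::{real_inner, banach} \<Rightarrow>\<^sub>L 'h) \<Rightarrow> 'h \<Rightarrow> 'h \<Rightarrow> real" where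
  "graph_inner S x y = x \<bullet> y + gen S x \<bullet> gen S y"

definition graph_norm :: "(real \<Rightarrow> 'h::{real_inner, banach} \<Rightarrow>\<^sub>L 'h) \<Rightarrow> 'h \<Rightarrow> real" where
  "graph_norm S h = sqrt ((norm h)\<^sup>2 + (norm (gen S h))\<^sup>2)"

definition graph_topology :: "(real \<Rightarrow> 'h::{real_inner, banach} \<Rightarrow>\<^sub>L 'h) \<Rightarrow> 'h topology" where
  "graph_topology S = Metric_space.mtopology (gen_dom S) (\<lambda>x y. graph_norm S (x - y))"

definition graph_dist :: "(real \<Rightarrow> 'h::{real_inner, banach} \<Rightarrow>\<^sub>L 'h) \<Rightarrow> 'h set \<Rightarrow> 'h \<Rightarrow> real" where
  "graph_dist S K x = (INF y\<in>K. graph_norm S (x - y))"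

(* The continuous linear extension to the whole space of the orthogonal projection onto K
   with respect to the graph inner product; it is unique because gen_dom S is dense. *)
definition graph_proj ::
  "(real \<Rightarrow> 'h::{real_inner, banach} \<Rightarrow>\<^sub>L 'h) \<Rightarrow> 'h set \<Rightarrow> 'h \<Rightarrow>\<^sub>L 'h" where
  "graph_proj S K = (THE P. (\<forall>x. blinfun_apply P x \<in> K) \<and>
     (\<forall>x\<in>gen_dom S. \<forall>k\<in>K. graph_inner S (x - blinfun_apply P x) k = 0))"


section \<open>Calculus on a linear subspace carrying its own norm\<close>

(* A pair (V, N) of a linear subspace V and a norm N on V stands for the normed space E:
   (UNIV, norm) is H, and (gen_dom S, graph_norm S) is D(A). Functions are only looked at on V. *)

definition lin_on :: "'a::real_vector set \<Rightarrow> ('a \<Rightarrow> 'b::real_vector) \<Rightarrow> bool" where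
  "lin_on V f \<longleftrightarrow> (\<forall>x\<in>V. \<forall>y\<in>V. \<forall>a b. f (a *\<^sub>R x + b *\<^sub>R y) = a *\<^sub>R f x + b *\<^sub>R f y)"

definition bounded_lin_on :: "'h::real_vector set \<Rightarrow> ('h \<Rightarrow> real) \<Rightarrow> ('h \<Rightarrow> 'h) \<Rightarrow> bool" where
  "bounded_lin_on V N D \<longleftrightarrow> D ` V \<subseteq> V \<and> lin_on V D \<and> (\<exists>C. \<forall>v\<in>V. N (D v) \<le> C * N v)"

definition bounded_bilin_on ::
  "'h::real_vector set \<Rightarrow> ('h \<Rightarrow> real) \<Rightarrow> ('h \<Rightarrow> 'h \<Rightarrow> 'h) \<Rightarrow> bool" where
  "bounded_bilin_on V N B \<longleftrightarrow>
     (\<forall>u\<in>V. \<forall>v\<in>V. B u v \<in> V) \<and>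
     (\<forall>u\<in>V. lin_on V (B u)) \<and> (\<forall>v\<in>V. lin_on V (\<lambda>u. B u v)) \<and>
     (\<exists>C. \<forall>u\<in>V. \<forall>v\<in>V. N (B u v) \<le> C * N u * N v)"

definition has_frechet_on ::
  "'h::real_vector set \<Rightarrow> ('h \<Rightarrow> real) \<Rightarrow> ('h \<Rightarrow> 'h) \<Rightarrow> ('h \<Rightarrow> 'h) \<Rightarrow> 'h \<Rightarrow> bool" where
  "has_frechet_on V N f D x \<longleftrightarrow> bounded_lin_on V N D \<and>
     (\<forall>e>0. \<exists>d>0. \<forall>y\<in>V. N (y - x) < d \<longrightarrow> N (f y - f x - D (y - x)) \<le> e * N (y - x))"

(* The derivative is determined on V only. *)
definition frechet_on ::
  "'h::real_vector set \<Rightarrow> ('h \<Rightarrow> real) \<Rightarrow> ('h \<Rightarrow> 'h) \<Rightarrow> 'h \<Rightarrow> 'h \<Rightarrow> 'h" where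
  "frechet_on V N f x = (SOME D. has_frechet_on V N f D x)"

(* Derivative of the map x \<mapsto> Df(x) into the bounded linear operators on V with the operator
   norm; that norm is unfolded to a bound holding for all v. *)
definition has_frechet2_on ::
  "'h::real_vector set \<Rightarrow> ('h \<Rightarrow> real) \<Rightarrow> ('h \<Rightarrow> 'h) \<Rightarrow> ('h \<Rightarrow> 'h \<Rightarrow> 'h) \<Rightarrow> 'h \<Rightarrow> bool" where
  "has_frechet2_on V N f B x \<longleftrightarrow> bounded_bilin_on V N B \<and>
     (\<forall>e>0. \<exists>d>0. \<forall>y\<in>V. N (y - x) < d \<longrightarrow>
        (\<forall>v\<in>V. N (frechet_on V N f y v - frechet_on V N f x v - B (y - x) v)
                 \<le> e * N (y - x) * N v))"

definition frechet2_on ::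
  "'h::real_vector set \<Rightarrow> ('h \<Rightarrow> real) \<Rightarrow> ('h \<Rightarrow> 'h) \<Rightarrow> 'h \<Rightarrow> 'h \<Rightarrow> 'h \<Rightarrow> 'h" where
  "frechet2_on V N f x = (SOME B. has_frechet2_on V N f B x)"

definition C2b_on :: "'h::real_vector set \<Rightarrow> ('h \<Rightarrow> real) \<Rightarrow> ('h \<Rightarrow> 'h) \<Rightarrow> bool" where
  "C2b_on V N f \<longleftrightarrow> f ` V \<subseteq> V \<and>
     (\<forall>x\<in>V. \<exists>D. has_frechet_on V N f D x) \<and>
     (\<forall>x\<in>V. \<exists>B. has_frechet2_on V N f B x) \<and>
     (\<forall>x\<in>V. \<forall>e>0. \<exists>d>0. \<forall>y\<in>V. N (y - x) < d \<longrightarrow>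
        (\<forall>u\<in>V. \<forall>v\<in>V. N (frechet2_on V N f y u v - frechet2_on V N f x u v) \<le> e * N u * N v)) \<and>
     (\<exists>C. \<forall>x\<in>V. N (f x) \<le> C) \<and>
     (\<exists>C. \<forall>x\<in>V. \<forall>v\<in>V. N (frechet_on V N f x v) \<le> C * N v) \<and>
     (\<exists>C. \<forall>x\<in>V. \<forall>u\<in>V. \<forall>v\<in>V. N (frechet2_on V N f x u v) \<le> C * N u * N v)"

definition onorm_on :: "'h::real_vector set \<Rightarrow> ('h \<Rightarrow> real) \<Rightarrow> ('h \<Rightarrow> 'h) \<Rightarrow> real" where
  "onorm_on V N D = (SUP v\<in>V. N (D v) / N v)"

definition onorm2_on :: "'h::real_vector set \<Rightarrow> ('h \<Rightarrow> real) \<Rightarrow> ('h \<Rightarrow> 'h \<Rightarrow> 'h) \<Rightarrow> real" where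
  "onorm2_on V N B = (SUP (u, v)\<in>V \<times> V. N (B u v) / (N u * N v))"

definition kappa1 :: "'h::real_vector set \<Rightarrow> ('h \<Rightarrow> real) \<Rightarrow> ('h \<Rightarrow> 'h) \<Rightarrow> real" where
  "kappa1 V N f = (SUP x\<in>V. N (f x))"

definition kappa2 :: "'h::real_vector set \<Rightarrow> ('h \<Rightarrow> real) \<Rightarrow> ('h \<Rightarrow> 'h) \<Rightarrow> real" where
  "kappa2 V N f = (SUP x\<in>V. onorm_on V N (frechet_on V N f x))"

definition kappa3 :: "'h::real_vector set \<Rightarrow> ('h \<Rightarrow> real) \<Rightarrow> ('h \<Rightarrow> 'h) \<Rightarrow> real" where
  "kappa3 V N f = (SUP x\<in>V. onorm2_on V N (frechet2_on V N f x))"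

lemma has_frechet_on_UNIV_norm:
  "has_frechet_on UNIV norm f D x \<longleftrightarrow> (f has_derivative D) (at x)"
proof -
  have "bounded_lin_on UNIV norm D \<longleftrightarrow> bounded_linear D"
  proof
    assume D: "bounded_lin_on UNIV norm D"
    then have l: "D (a *\<^sub>R u + b *\<^sub>R v) = a *\<^sub>R D u + b *\<^sub>R D v" for a b u v
      by (simp add: bounded_lin_on_def lin_on_def)
    from D obtain C where "\<And>v. norm (D v) \<le> C * norm v"
      by (auto simp: bounded_lin_on_def)
    then show "bounded_linear D"
      using l[of 1 _ 1] l[of _ _ 0 0]
      by (intro bounded_linear_intro[where K = C]) (auto simp: mult.commute)
  next
    assume D: "bounded_linear D"
    then interpret bounded_linear D .
    show "bounded_lin_on UNIV norm D"
      using bounded by (auto simp: bounded_lin_on_def lin_on_def add scaleR mult.commute)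
  qed
  then show ?thesis
    by (simp add: has_frechet_on_def has_derivative_at_alt)
qed

lemma onorm_on_UNIV_norm: "onorm_on UNIV norm D = onorm D"
  by (simp add: onorm_on_def onorm_def)


section \<open>The covariance operator and Hilbert-Schmidt operators\<close>

definition nuclear_op :: "('u::{real_inner, banach} \<Rightarrow>\<^sub>L 'u) \<Rightarrow> bool" where
  "nuclear_op Q \<longleftrightarrow> (\<exists>a b. summable (\<lambda>n. norm (a n) * norm (b n)) \<and>
     (\<forall>x. (\<lambda>n. (x \<bullet> a n) *\<^sub>R b n) sums Q x))"

definition self_adjoint_op :: "('u::{real_inner, banach} \<Rightarrow>\<^sub>L 'u) \<Rightarrow> bool" where
  "self_adjoint_op Q \<longleftrightarrow> (\<forall>u v. Q u \<bullet> v = u \<bullet> Q v)"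

definition covariance_op ::
  "('u::{real_inner, banach} \<Rightarrow>\<^sub>L 'u) \<Rightarrow> (nat \<Rightarrow> 'u) \<Rightarrow> (nat \<Rightarrow> real) \<Rightarrow> bool" where
  "covariance_op Q e lam \<longleftrightarrow>
     nuclear_op Q \<and> self_adjoint_op Q \<and> (\<forall>u. u \<noteq> 0 \<longrightarrow> Q u \<bullet> u > 0) \<and>
     (\<forall>i j. e i \<bullet> e j = (if i = j then 1 else 0)) \<and> closure (span (range e)) = UNIV \<and>
     (\<forall>j. lam j > 0) \<and> summable lam \<and> (\<forall>j. Q (e j) = lam j *\<^sub>R e j)"

definition sqrt_op :: "('u::{real_inner, banach} \<Rightarrow>\<^sub>L 'u) \<Rightarrow> 'u \<Rightarrow>\<^sub>L 'u" where
  "sqrt_op Q = (THE R. self_adjoint_op R \<and> (\<forall>u. blinfun_apply R u \<bullet> u \<ge> 0) \<and> R o\<^sub>L R = Q)"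

definition U0 :: "('u::{real_inner, banach} \<Rightarrow>\<^sub>L 'u) \<Rightarrow> 'u set" where
  "U0 Q = range (blinfun_apply (sqrt_op Q))"

definition U0_norm :: "('u::{real_inner, banach} \<Rightarrow>\<^sub>L 'u) \<Rightarrow> 'u \<Rightarrow> real" where
  "U0_norm Q u = norm (inv (blinfun_apply (sqrt_op Q)) u)"

definition U0_basis :: "(nat \<Rightarrow> 'u::real_vector) \<Rightarrow> (nat \<Rightarrow> real) \<Rightarrow> nat \<Rightarrow> 'u" where
  "U0_basis e lam j = sqrt (lam j) *\<^sub>R e j"

(* Hilbert-Schmidt operators from U0 to E = (V, N), represented by functions on all of 'u
   whose values outside U0 are irrelevant. *)
definition L20 ::
  "('u::{real_inner, banach} \<Rightarrow>\<^sub>L 'u) \<Rightarrow> (nat \<Rightarrow> 'u) \<Rightarrow> 'h::real_vector set \<Rightarrow> ('h \<Rightarrow> real)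
     \<Rightarrow> ('u \<Rightarrow> 'h) set" where
  "L20 Q g V N = {\<phi>. \<phi> ` U0 Q \<subseteq> V \<and> lin_on (U0 Q) \<phi> \<and>
     (\<exists>C. \<forall>u\<in>U0 Q. N (\<phi> u) \<le> C * U0_norm Q u) \<and> summable (\<lambda>j. (N (\<phi> (g j)))\<^sup>2)}"

definition hs_norm :: "(nat \<Rightarrow> 'u) \<Rightarrow> ('h \<Rightarrow> real) \<Rightarrow> ('u \<Rightarrow> 'h) \<Rightarrow> real" where
  "hs_norm g N \<phi> = sqrt (\<Sum>j. (N (\<phi> (g j)))\<^sup>2)"


section \<open>Conditions on the coefficients\<close>

definition coefficient_conditions ::
  "('u::{real_inner, banach} \<Rightarrow>\<^sub>L 'u) \<Rightarrow> (nat \<Rightarrow> 'u) \<Rightarrow> 'h::real_vector set \<Rightarrow> ('h \<Rightarrow> real)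
     \<Rightarrow> ('h \<Rightarrow> 'h) \<Rightarrow> ('h \<Rightarrow> 'u \<Rightarrow> 'h) \<Rightarrow> bool" where
  "coefficient_conditions Q g V N \<alpha> \<sigma> \<longleftrightarrow>
     \<alpha> ` V \<subseteq> V \<and> \<sigma> ` V \<subseteq> L20 Q g V N \<and>
     (\<exists>L. \<forall>h\<in>V. \<forall>k\<in>V. N (\<alpha> h - \<alpha> k) \<le> L * N (h - k)) \<and>
     (\<exists>L. \<forall>h\<in>V. \<forall>k\<in>V. hs_norm g N (\<lambda>u. \<sigma> h u - \<sigma> k u) \<le> L * N (h - k)) \<and>
     (\<forall>j. C2b_on V N (\<lambda>h. \<sigma> h (g j))) \<and>
     summable (\<lambda>j. 1 / 2 * ((kappa2 V N (\<lambda>h. \<sigma> h (g j)))\<^sup>2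
                 + kappa1 V N (\<lambda>h. \<sigma> h (g j)) * kappa3 V N (\<lambda>h. \<sigma> h (g j)))) \<and>
     (\<forall>h\<in>V. \<exists>l\<in>V. (\<lambda>r. N ((1 / 2) *\<^sub>R
         (\<Sum>j<r. frechet_on V N (\<lambda>h. \<sigma> h (g j)) h (\<sigma> h (g j))) - l)) \<longlonglongrightarrow> 0)"


section \<open>Filtrations, Wiener processes, stochastic integrals\<close>

definition usual_filtration :: "'w measure \<Rightarrow> (real \<Rightarrow> 'w measure) \<Rightarrow> real \<Rightarrow> bool" where
  "usual_filtration M F T \<longleftrightarrow> prob_space M \<and>
     (\<forall>t\<in>{0..T}. subalgebra M (F t)) \<and>
     (\<forall>s t. 0 \<le> s \<and> s \<le> t \<and> t \<le> T \<longrightarrow> sets (F s) \<subseteq> sets (F t)) \<and>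
     (\<forall>t\<in>{0..<T}. sets (F t) = (\<Inter>s\<in>{t<..T}. sets (F s))) \<and>
     (\<forall>Z\<in>null_sets M. \<forall>B. B \<subseteq> Z \<longrightarrow> B \<in> sets (F 0))"

definition cont_adapted ::
  "'w measure \<Rightarrow> (real \<Rightarrow> 'w measure) \<Rightarrow> real \<Rightarrow> (real \<Rightarrow> 'w \<Rightarrow> 'a::real_normed_vector) \<Rightarrow> bool" where
  "cont_adapted M F T X \<longleftrightarrow>
     (\<forall>t\<in>{0..T}. X t \<in> borel_measurable (F t)) \<and>
     (\<forall>\<omega>\<in>space M. continuous_on {0..T} (\<lambda>t. X t \<omega>))"

(* That the increment over (s, t] is centred Gaussian with covariance operator (t - s) Q is
   expressed by its one-dimensional projections; Q is positive definite, so these have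
   densities. *)
definition Q_wiener ::
  "'w measure \<Rightarrow> (real \<Rightarrow> 'w measure) \<Rightarrow> real \<Rightarrow> ('u::{real_inner, banach} \<Rightarrow>\<^sub>L 'u)
     \<Rightarrow> (real \<Rightarrow> 'w \<Rightarrow> 'u) \<Rightarrow> bool" where
  "Q_wiener M F T Q W \<longleftrightarrow> cont_adapted M F T W \<and> (AE \<omega> in M. W 0 \<omega> = 0) \<and>
     (\<forall>s t. 0 \<le> s \<and> s < t \<and> t \<le> T \<longrightarrow>
        prob_space.indep_set M (sets (F s))
          {(\<lambda>\<omega>. W t \<omega> - W s \<omega>) -` B \<inter> space M | B. B \<in> sets borel} \<and>
        (\<forall>u. u \<noteq> 0 \<longrightarrow> distributed M lborel (\<lambda>\<omega>. (W t \<omega> - W s \<omega>) \<bullet> u)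
               (\<lambda>x. ennreal (normal_density 0 (sqrt ((t - s) * (Q u \<bullet> u))) x))))"

definition predictable_sigma :: "'w measure \<Rightarrow> (real \<Rightarrow> 'w measure) \<Rightarrow> real \<Rightarrow> (real \<times> 'w) measure" where
  "predictable_sigma M F t = sigma ({0..t} \<times> space M)
     ({{0} \<times> A | A. A \<in> sets (F 0)} \<union>
      {{a<..b} \<times> A | a b A. 0 \<le> a \<and> a < b \<and> b \<le> t \<and> A \<in> sets (F a)})"

(* Elementary L(U,H)-valued processes on [0, t]: on (p i, p (i + 1)] the value is \<Phi> i, a
   random operator that is F (p i)-measurable and takes finitely many values. *)
definition elementary ::
  "(real \<Rightarrow> 'w measure) \<Rightarrow> real \<Rightarrow> nat \<Rightarrow> (nat \<Rightarrow> real)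
     \<Rightarrow> (nat \<Rightarrow> 'w \<Rightarrow> 'u::real_normed_vector \<Rightarrow>\<^sub>L 'h::real_normed_vector) \<Rightarrow> bool" where
  "elementary F t m p \<Phi> \<longleftrightarrow> 0 \<le> p 0 \<and> p m \<le> t \<and> (\<forall>i<m. p i < p (Suc i)) \<and>
     (\<forall>i<m. simple_function (F (p i)) (\<Phi> i))"

definition elementary_value ::
  "nat \<Rightarrow> (nat \<Rightarrow> real) \<Rightarrow> (nat \<Rightarrow> 'w \<Rightarrow> 'u::real_normed_vector \<Rightarrow>\<^sub>L 'h::real_normed_vector)
     \<Rightarrow> real \<Rightarrow> 'w \<Rightarrow> 'u \<Rightarrow> 'h" where
  "elementary_value m p \<Phi> s \<omega> u =
     (\<Sum>i<m. indicator {p i<..p (Suc i)} s *\<^sub>R blinfun_apply (\<Phi> i \<omega>) u)"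

definition elementary_integral ::
  "(real \<Rightarrow> 'w \<Rightarrow> 'u) \<Rightarrow> nat \<Rightarrow> (nat \<Rightarrow> real)
     \<Rightarrow> (nat \<Rightarrow> 'w \<Rightarrow> 'u::real_normed_vector \<Rightarrow>\<^sub>L 'h::real_normed_vector) \<Rightarrow> 'w \<Rightarrow> 'h" where
  "elementary_integral W m p \<Phi> \<omega> =
     (\<Sum>i<m. blinfun_apply (\<Phi> i \<omega>) (W (p (Suc i)) \<omega> - W (p i) \<omega>))"

(* The random variable I is (a version of) the Ito integral over [0, t] of the predictable
   L20-valued process \<phi>: along some sequence of elementary processes, the squared
   Hilbert-Schmidt distance to \<phi> integrated over [0, t], and the distance of the elementary
   integrals to I, both tend to 0 in probability. This is the integral for all \<phi> whose squared
   Hilbert-Schmidt norm is almost surely integrable over [0, t]; no moments are required.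
   The Borel sigma-algebra of L20 is generated by the maps \<phi> \<mapsto> \<phi> (g j). *)
definition has_stoch_integral ::
  "'w measure \<Rightarrow> (real \<Rightarrow> 'w measure) \<Rightarrow> ('u::{real_inner, banach} \<Rightarrow>\<^sub>L 'u) \<Rightarrow> (nat \<Rightarrow> 'u)
     \<Rightarrow> (real \<Rightarrow> 'w \<Rightarrow> 'u) \<Rightarrow> (real \<Rightarrow> 'w \<Rightarrow> 'u \<Rightarrow> 'h::{real_inner, banach, second_countable_topology})
     \<Rightarrow> real \<Rightarrow> ('w \<Rightarrow> 'h) \<Rightarrow> bool" where
  "has_stoch_integral M F Q g W \<phi> t I \<longleftrightarrow>
     (\<forall>s\<in>{0..t}. \<forall>\<omega>\<in>space M. \<phi> s \<omega> \<in> L20 Q g UNIV norm) \<and>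
     (\<forall>j. (\<lambda>(s, \<omega>). \<phi> s \<omega> (g j)) \<in> borel_measurable (predictable_sigma M F t)) \<and>
     I \<in> borel_measurable M \<and>
     (\<exists>m p \<Phi>. (\<forall>n. elementary F t (m n) (p n) (\<Phi> n)) \<and>
        (\<forall>e>0. (\<lambda>n. measure M {\<omega> \<in> space M.
             (\<integral>\<^sup>+s\<in>{0..t}. ennreal ((hs_norm g norm
                (\<lambda>u. elementary_value (m n) (p n) (\<Phi> n) s \<omega> u - \<phi> s \<omega> u))\<^sup>2) \<partial>lborel)
             > ennreal e}) \<longlonglongrightarrow> 0) \<and>
        (\<forall>e>0. (\<lambda>n. measure M {\<omega> \<in> space M.
             norm (elementary_integral W (m n) (p n) (\<Phi> n) \<omega> - I \<omega>) > e}) \<longlonglongrightarrow> 0))"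


section \<open>Solutions\<close>

definition mild_solution ::
  "'w measure \<Rightarrow> (real \<Rightarrow> 'w measure) \<Rightarrow> real \<Rightarrow> ('u::{real_inner, banach} \<Rightarrow>\<^sub>L 'u) \<Rightarrow> (nat \<Rightarrow> 'u)
     \<Rightarrow> (real \<Rightarrow> 'w \<Rightarrow> 'u) \<Rightarrow> (real \<Rightarrow> 'h \<Rightarrow>\<^sub>L 'h) \<Rightarrow> ('h \<Rightarrow> 'h) \<Rightarrow> ('h \<Rightarrow> 'u \<Rightarrow> 'h)
     \<Rightarrow> 'h::{real_inner, banach, second_countable_topology} \<Rightarrow> (real \<Rightarrow> 'w \<Rightarrow> 'h) \<Rightarrow> bool" where
  "mild_solution M F T Q g W S \<alpha> \<sigma> x X \<longleftrightarrow> cont_adapted M F T X \<and>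
     (\<forall>t\<in>{0..T}. \<exists>I. has_stoch_integral M F Q g W (\<lambda>s \<omega> u. S (t - s) (\<sigma> (X s \<omega>) u)) t I \<and>
        (AE \<omega> in M. X t \<omega> = S t x + (LINT s:{0..t}|lborel. S (t - s) (\<alpha> (X s \<omega>))) + I \<omega>))"

definition strong_solution_in ::
  "'h set \<Rightarrow> 'w measure \<Rightarrow> (real \<Rightarrow> 'w measure) \<Rightarrow> real \<Rightarrow> ('u::{real_inner, banach} \<Rightarrow>\<^sub>L 'u)
     \<Rightarrow> (nat \<Rightarrow> 'u) \<Rightarrow> (real \<Rightarrow> 'w \<Rightarrow> 'u) \<Rightarrow> ('h \<Rightarrow> 'h) \<Rightarrow> ('h \<Rightarrow> 'u \<Rightarrow> 'h)
     \<Rightarrow> 'h::{real_inner, banach, second_countable_topology} \<Rightarrow> (real \<Rightarrow> 'w \<Rightarrow> 'h) \<Rightarrow> bool" where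
  "strong_solution_in K M F T Q g W b \<sigma> x Y \<longleftrightarrow> cont_adapted M F T Y \<and>
     (\<forall>t\<in>{0..T}. \<forall>\<omega>\<in>space M. Y t \<omega> \<in> K) \<and>
     (\<forall>t\<in>{0..T}. \<exists>I. has_stoch_integral M F Q g W (\<lambda>s \<omega>. \<sigma> (Y s \<omega>)) t I \<and>
        (AE \<omega> in M. set_integrable lborel {0..t} (\<lambda>s. b (Y s \<omega>)) \<and>
           Y t \<omega> = x + (LINT s:{0..t}|lborel. b (Y s \<omega>)) + I \<omega>))"

end

theory Submission
  imports Defs
begin

text \<open>
  The time horizon may depend on \<open>\<delta>\<close> and \<open>x0\<close>, so it is enough that \<open>X(t;x)\<close> and \<open>Y(t;x)\<close> both stay
  close to \<open>x\<close> in \<open>L\<^sup>2\<close> for small \<open>t\<close>, uniformly for \<open>x\<close> near \<open>x0\<close>. The only deterministic terms are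
  \<open>S\<^sub>t x - x\<close>, which is small by strong continuity at \<open>x0\<close> and equicontinuity of the semigroup, and
  drifts of linear growth (the generator is bounded on the finite dimensional space \<open>K\<close>).

  The stochastic integral is given by approximation in probability, without moments. Stopping an
  elementary integrand when its energy exceeds a level \<open>c\<close> and passing to the limit bounds
  \<open>E[1{V < c} |I|\<^sup>2]\<close> by a multiple of \<open>E[min V c]\<close>, where \<open>V\<close> is the energy of the integrand. For a
  solution \<open>P\<close> the energy at time \<open>t\<close> is dominated by \<open>Z\<^sub>t\<close>, the integral of \<open>z\<^sub>s = 1 + |P\<^sub>s - x|\<^sup>2\<close> over
  \<open>[0,t]\<close>, and \<open>min Z\<^sub>t c\<close> is the integral of \<open>1{Z\<^sub>s \<le> c} z\<^sub>s\<close>. Hence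
  \<open>f(t) = E[1{Z\<^sub>t \<le> c} |P\<^sub>t - x|\<^sup>2]\<close> is finite and bounded by a multiple of the integral of \<open>1 + f\<close>, which
  yields a bound for small \<open>t\<close> that does not depend on \<open>c\<close>. No stopping times are needed.
\<close>

section \<open>The Ito isometry for elementary processes\<close>

text \<open>For the mild solution the integrand
  \<open>S (t - s) (\<sigma> (X x s \<omega>) u)\<close> changes with the terminal time
  \<open>t\<close>, so its stochastic integrals do not form a martingale in \<open>t\<close>, and
  \<open>has_stoch_integral\<close> speaks of one fixed \<open>t\<close> only. Every estimate is
  therefore made at a single \<open>t\<close>. What ties different times together is the majorant
  \<open>Z\<close>, which depends on the path alone and not on the integrand. The event
  \<open>V < c\<close> involves the whole interval, so multiplying the integrand by its indicator
  would destroy adaptedness. The cutoff is built into the elementary integrands instead, step by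
  step: on the event it is invisible, off the event it keeps the energy below the level. The price
  is a constant larger than the 1 of the isometry, because the approximating energies are compared
  with \<open>V\<close> through \<open>|a|^2 \<le> 2 |b|^2 + 2 |a - b|^2\<close>.\<close>

locale wiener_setting =
  fixes M :: "'w measure" and F :: "real \<Rightarrow> 'w measure" and T :: real
    and Q :: "'u::{real_inner, banach, second_countable_topology} \<Rightarrow>\<^sub>L 'u"
    and e :: "nat \<Rightarrow> 'u" and lam :: "nat \<Rightarrow> real" and g :: "nat \<Rightarrow> 'u"
    and W :: "real \<Rightarrow> 'w \<Rightarrow> 'u"
  assumes filtration: "usual_filtration M F T"
    and covariance: "covariance_op Q e lam"
    and g_eq: "g = U0_basis e lam"
    and wiener: "Q_wiener M F T Q W"
begin

sublocale prob_space M
  using filtration by (simp add: usual_filtration_def)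

lemma subalg: "t \<in> {0..T} \<Longrightarrow> subalgebra M (F t)"
  using filtration by (simp add: usual_filtration_def)

lemma space_F: "t \<in> {0..T} \<Longrightarrow> space (F t) = space M"
  using subalg by (auto simp: subalgebra_def)

lemma subalg_mono: "0 \<le> s \<Longrightarrow> s \<le> t \<Longrightarrow> t \<le> T \<Longrightarrow> subalgebra (F t) (F s)"
  using filtration space_F[of s] space_F[of t]
  by (auto simp: usual_filtration_def subalgebra_def)

lemma W_adapted: "t \<in> {0..T} \<Longrightarrow> W t \<in> borel_measurable (F t)"
  using wiener by (auto simp: Q_wiener_def cont_adapted_def)

lemma W_measurable: "t \<in> {0..T} \<Longrightarrow> W t \<in> borel_measurable M"
  using W_adapted subalg by (blast intro: measurable_from_subalg)

lemma e_inner: "e i \<bullet> e j = (if i = j then 1 else 0)"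
  using covariance by (auto simp: covariance_op_def)

lemma norm_e [simp]: "norm (e i) = 1"
  by (simp add: norm_eq_sqrt_inner e_inner)

lemma lam_pos: "lam j > 0"
  using covariance by (auto simp: covariance_op_def)

lemma summable_lam: "summable lam"
  using covariance by (auto simp: covariance_op_def)

lemma Q_e: "Q (e j) = lam j *\<^sub>R e j"
  using covariance by (auto simp: covariance_op_def)

lemma norm_apply_g: "(norm (blinfun_apply f (g j)))\<^sup>2 = lam j * (norm (f (e j)))\<^sup>2"
  using lam_pos[of j] by (simp add: g_eq U0_basis_def blinfun.scaleR_right power_mult_distrib)

context
  fixes s r :: real
  assumes sr: "0 \<le> s" "s < r" "r \<le> T"
begin

lemma incr_distributed:
  "u \<noteq> 0 \<Longrightarrow> distributed M lborel (\<lambda>\<omega>. (W r \<omega> - W s \<omega>) \<bullet> u)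
               (\<lambda>x. ennreal (normal_density 0 (sqrt ((r - s) * (Q u \<bullet> u))) x))"
  using wiener sr by (auto simp: Q_wiener_def)

lemma incr_moments:
  assumes "u \<noteq> 0"
  shows "integrable M (\<lambda>\<omega>. (W r \<omega> - W s \<omega>) \<bullet> u)"
    and "expectation (\<lambda>\<omega>. (W r \<omega> - W s \<omega>) \<bullet> u) = 0"
    and "integrable M (\<lambda>\<omega>. ((W r \<omega> - W s \<omega>) \<bullet> u)\<^sup>2)"
    and "expectation (\<lambda>\<omega>. ((W r \<omega> - W s \<omega>) \<bullet> u)\<^sup>2) = (r - s) * (Q u \<bullet> u)"
proof -
  have "Q u \<bullet> u > 0"
    using covariance assms by (auto simp: covariance_op_def)
  then have pos: "sqrt ((r - s) * (Q u \<bullet> u)) > 0"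
    using sr by simp
  note D = incr_distributed[OF assms]
  show "integrable M (\<lambda>\<omega>. (W r \<omega> - W s \<omega>) \<bullet> u)"
    using integrable_normal_moment_nz_1[OF pos, of 0] distributed_integrable[OF D, of "\<lambda>x. x"]
    by simp
  show E: "expectation (\<lambda>\<omega>. (W r \<omega> - W s \<omega>) \<bullet> u) = 0"
    using normal_distributed_expectation[OF pos D] by simp
  show "integrable M (\<lambda>\<omega>. ((W r \<omega> - W s \<omega>) \<bullet> u)\<^sup>2)"
    using integrable_normal_moment[OF pos, of 0 2] distributed_integrable[OF D, of "\<lambda>x. x\<^sup>2"]
    by simp
  show "expectation (\<lambda>\<omega>. ((W r \<omega> - W s \<omega>) \<bullet> u)\<^sup>2) = (r - s) * (Q u \<bullet> u)"
    using normal_distributed_variance[OF pos D] E pos by simp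
qed

text \<open>\<open>Q_wiener\<close> prescribes the laws of one-dimensional projections only, so the
  mixed moments come by polarisation from the variances along \<open>e i\<close>, \<open>e j\<close>
  and \<open>e i + e j\<close>. Each of these vectors must be nonzero to have a Gaussian density;
  the inner product of the sum with \<open>e i\<close> is 1 or 2.\<close>

lemma incr_covariance:
  shows "integrable M (\<lambda>\<omega>. ((W r \<omega> - W s \<omega>) \<bullet> e i) * ((W r \<omega> - W s \<omega>) \<bullet> e j))"
    and "expectation (\<lambda>\<omega>. ((W r \<omega> - W s \<omega>) \<bullet> e i) * ((W r \<omega> - W s \<omega>) \<bullet> e j))
           = (if i = j then (r - s) * lam i else 0)"
proof -
  have nz: "e i + e j \<noteq> 0" "e k \<noteq> 0" for k
  proof -
    have "(e i + e j) \<bullet> e i \<ge> 1"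
      by (simp add: inner_add_left e_inner)
    then show "e i + e j \<noteq> 0" by force
    show "e k \<noteq> 0" using norm_e[of k] by force
  qed
  have eq: "((W r \<omega> - W s \<omega>) \<bullet> e i) * ((W r \<omega> - W s \<omega>) \<bullet> e j) =
      (((W r \<omega> - W s \<omega>) \<bullet> (e i + e j))\<^sup>2 - ((W r \<omega> - W s \<omega>) \<bullet> e i)\<^sup>2
        - ((W r \<omega> - W s \<omega>) \<bullet> e j)\<^sup>2) / 2" for \<omega>
    by (simp add: inner_add_right power2_eq_square algebra_simps)
  note m = incr_moments(3,4)[OF nz(1)] incr_moments(3,4)[OF nz(2)]
  show "integrable M (\<lambda>\<omega>. ((W r \<omega> - W s \<omega>) \<bullet> e i) * ((W r \<omega> - W s \<omega>) \<bullet> e j))"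
    unfolding eq by (intro integrable_divide_zero Bochner_Integration.integrable_diff m)
  show "expectation (\<lambda>\<omega>. ((W r \<omega> - W s \<omega>) \<bullet> e i) * ((W r \<omega> - W s \<omega>) \<bullet> e j))
           = (if i = j then (r - s) * lam i else 0)"
    unfolding eq
    by (simp only: integral_divide_zero Bochner_Integration.integral_diff
        Bochner_Integration.integrable_diff m)
       (simp add: blinfun.add_right Q_e inner_add_left inner_add_right e_inner algebra_simps)
qed

text \<open>Independence passes to smaller families: the events of \<open>\<xi>\<close> lie in
  \<open>F s\<close>, and those of \<open>f\<close> of the increment are events of the increment.
  The product formula for independent real variables then applies.\<close>

lemma incr_indep:
  assumes \<xi>: "\<xi> \<in> borel_measurable (F s)" "integrable M (\<xi> :: 'w \<Rightarrow> real)"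
    and f: "f \<in> borel_measurable borel" "integrable M (\<lambda>\<omega>. f (W r \<omega> - W s \<omega>))"
  shows "integrable M (\<lambda>\<omega>. \<xi> \<omega> * f (W r \<omega> - W s \<omega>))"
    and "expectation (\<lambda>\<omega>. \<xi> \<omega> * f (W r \<omega> - W s \<omega>))
           = expectation \<xi> * expectation (\<lambda>\<omega>. f (W r \<omega> - W s \<omega>))"
proof -
  let ?D = "\<lambda>\<omega>. W r \<omega> - W s \<omega>"
  have s: "s \<in> {0..T}" using sr by auto
  have "indep_set (sets (F s)) {?D -` B \<inter> space M | B. B \<in> sets borel}"
    using wiener sr by (auto simp: Q_wiener_def)
  then have "indep_set {\<xi> -` A \<inter> space M | A. A \<in> sets borel}
      {(\<lambda>\<omega>. f (?D \<omega>)) -` A \<inter> space M | A. A \<in> sets borel}"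
    unfolding indep_set_def
  proof (rule indep_sets_mono_sets)
    fix b :: bool assume "b \<in> UNIV"
    have 1: "{\<xi> -` A \<inter> space M | A. A \<in> sets borel} \<subseteq> sets (F s)"
      using measurable_sets[OF \<xi>(1)] by (auto simp: space_F[OF s])
    have 2: "{(\<lambda>\<omega>. f (?D \<omega>)) -` A \<inter> space M | A. A \<in> sets borel}
        \<subseteq> {?D -` B \<inter> space M | B. B \<in> sets borel}"
    proof safe
      fix A :: "real set" assume "A \<in> sets borel"
      then have "f -` A \<in> sets borel"
        using measurable_sets[OF f(1), of A] by simp
      then show "\<exists>B. (\<lambda>\<omega>. f (?D \<omega>)) -` A \<inter> space M = ?D -` B \<inter> space M \<and> B \<in> sets borel"
        by (intro exI[of _ "f -` A"]) auto
    qed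
    show "case_bool {\<xi> -` A \<inter> space M | A. A \<in> sets borel}
        {(\<lambda>\<omega>. f (?D \<omega>)) -` A \<inter> space M | A. A \<in> sets borel} b
       \<subseteq> case_bool (sets (F s)) {?D -` B \<inter> space M | B. B \<in> sets borel} b"
      using 1 2 by (auto split: bool.split)
  qed
  moreover have "Int_stable {h -` A \<inter> space M | A. A \<in> sets borel}" for h :: "'w \<Rightarrow> real"
    unfolding Int_stable_def
  proof safe
    fix A B :: "real set" assume "A \<in> sets borel" "B \<in> sets borel"
    then show "\<exists>C. h -` A \<inter> space M \<inter> (h -` B \<inter> space M) = h -` C \<inter> space M \<and> C \<in> sets borel"
      by (intro exI[of _ "A \<inter> B"]) auto
  qed
  ultimately have "indep_var borel \<xi> borel (\<lambda>\<omega>. f (?D \<omega>))"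
    using \<xi> f by (auto simp: indep_var_eq intro!: indep_set_sigma_sets)
  from indep_var_lebesgue_integral[OF this \<xi>(2) f(2)] indep_var_integrable[OF this \<xi>(2) f(2)]
  show "integrable M (\<lambda>\<omega>. \<xi> \<omega> * f (W r \<omega> - W s \<omega>))"
    "expectation (\<lambda>\<omega>. \<xi> \<omega> * f (W r \<omega> - W s \<omega>))
           = expectation \<xi> * expectation (\<lambda>\<omega>. f (W r \<omega> - W s \<omega>))"
    by auto
qed

end

section \<open>Expansion along the orthonormal basis of \<open>U\<close>\<close>

definition proj_sum :: "nat \<Rightarrow> 'u \<Rightarrow> 'u" where
  "proj_sum n x = (\<Sum>j<n. (x \<bullet> e j) *\<^sub>R e j)"

lemma proj_sum_lin:
  "proj_sum n (x + y) = proj_sum n x + proj_sum n y" "proj_sum n (x - y) = proj_sum n x - proj_sum n y"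
  "proj_sum n (c *\<^sub>R x) = c *\<^sub>R proj_sum n x"
  by (simp_all add: proj_sum_def inner_add_left inner_diff_left scaleR_add_left scaleR_diff_left
      sum.distrib sum_subtractf scaleR_sum_right)

text \<open>The partial sum is an orthogonal projection, so its squared norm is its inner product
  with \<open>x\<close>, and Cauchy-Schwarz cancels one factor.\<close>

lemma norm_proj_sum: "norm (proj_sum n x) \<le> norm x"
proof -
  have "proj_sum n x \<bullet> e k = (if k < n then x \<bullet> e k else 0)" for k
    by (simp add: proj_sum_def inner_sum_left e_inner if_distrib sum.delta cong: if_cong)
  then have "(norm (proj_sum n x))\<^sup>2 = x \<bullet> proj_sum n x"
    by (simp add: power2_norm_eq_inner)
       (simp add: proj_sum_def inner_sum_right)
  also have "\<dots> \<le> norm x * norm (proj_sum n x)"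
    by (rule norm_cauchy_schwarz)
  finally show ?thesis
    by (cases "proj_sum n x = 0") (auto simp: power2_eq_square)
qed

text \<open>On the span of the basis the partial sums are eventually exact; being contractions for
  every \<open>n\<close>, they inherit convergence on the closure, which is the whole space.\<close>

lemma proj_sum_tendsto: "(\<lambda>n. proj_sum n x) \<longlonglongrightarrow> x"
proof (rule metric_LIMSEQ_I)
  fix \<eta> :: real assume \<eta>: "\<eta> > 0"
  have "x \<in> closure (span (range e))"
    using covariance by (auto simp: covariance_op_def)
  then obtain y where y: "y \<in> span (range e)" "dist y x < \<eta> / 2"
    using half_gt_zero[OF \<eta>] unfolding closure_approachable by blast
  have "eventually (\<lambda>n. proj_sum n y = y) sequentially"
    using y(1)
  proof (induction rule: span_induct)
    case base
    have "proj_sum n 0 = 0" for n by (simp add: proj_sum_def)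
    then show ?case
      by (auto simp: subspace_def proj_sum_lin elim: eventually_elim2 eventually_mono)
  next
    case (step z)
    then obtain k where k: "z = e k" by auto
    have "proj_sum n z = z" if "n \<ge> Suc k" for n
      using that by (simp add: proj_sum_def k e_inner if_distrib[of "\<lambda>c. c *\<^sub>R _"] cong: if_cong)
    then show ?case by (auto simp: eventually_sequentially)
  qed
  then obtain N where N: "\<And>n. n \<ge> N \<Longrightarrow> proj_sum n y = y"
    by (auto simp: eventually_sequentially)
  have "dist (proj_sum n x) x < \<eta>" if "n \<ge> N" for n
  proof -
    have eq: "proj_sum n x - x = proj_sum n (x - y) - (x - y)"
      using N[OF that] by (simp add: proj_sum_lin)
    have "norm (proj_sum n x - x) \<le> norm (x - y) + norm (x - y)"
      unfolding eq using norm_triangle_ineq4[of "proj_sum n (x - y)" "x - y"] norm_proj_sum[of n "x - y"] by linarith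
    then show ?thesis
      using y(2) by (simp add: dist_norm norm_minus_commute)
  qed
  then show "\<exists>no. \<forall>n\<ge>no. dist (proj_sum n x) x < \<eta>" by blast
qed

lemma blinfun_proj_sum_tendsto:
  "(\<lambda>n. \<Sum>j<n. (x \<bullet> e j) *\<^sub>R blinfun_apply f (e j)) \<longlonglongrightarrow> blinfun_apply f x"
  using blinfun.tendsto[OF tendsto_const proj_sum_tendsto, of f x]
  by (simp add: proj_sum_def blinfun.sum_right blinfun.scaleR_right)

lemma integrable_simple: "t \<in> {0..T} \<Longrightarrow> simple_function (F t) f \<Longrightarrow> integrable M (f :: 'w \<Rightarrow> real)"
  using simple_function_subalgebra[of "F t" f M] subalg[of t] finite_measure
  by (intro integrable_simple_function) (auto simp: subalgebra_def simple_function_def)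

end

section \<open>Second moments over one time step\<close>

lemma simple_function_blinfun_apply:
  "simple_function N \<Phi> \<Longrightarrow> simple_function N (\<lambda>\<omega>. blinfun_apply (\<Phi> \<omega>) u)"
  by (rule simple_function_compose1)

text \<open>Expanding the square leaves the part of \<open>G\<close> alone, terms linear in one
  coordinate of the increment and terms quadratic in two. All other factors are known at time
  \<open>s\<close>, so independence splits each expectation: the linear terms vanish, and of the
  quadratic ones only the diagonal survives, where \<open>lam j\<close> turns \<open>e j\<close>
  into \<open>g j\<close>.\<close>

lemma (in wiener_setting) isometry_step:
  fixes G :: "'w \<Rightarrow> 'h::{real_inner, banach, second_countable_topology}" and N :: nat
  assumes sr: "0 \<le> s" "s < r" "r \<le> T"
    and G: "G \<in> borel_measurable (F s)" "integrable M (\<lambda>\<omega>. (norm (G \<omega>))\<^sup>2)"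
    and \<Phi>: "simple_function (F s) \<Phi>"
  defines "D \<equiv> \<lambda>\<omega>. \<Sum>j<N. ((W r \<omega> - W s \<omega>) \<bullet> e j) *\<^sub>R blinfun_apply (\<Phi> \<omega>) (e j)"
  shows "integrable M (\<lambda>\<omega>. (norm (G \<omega> + D \<omega>))\<^sup>2)"
    and "expectation (\<lambda>\<omega>. (norm (G \<omega> + D \<omega>))\<^sup>2) = expectation (\<lambda>\<omega>. (norm (G \<omega>))\<^sup>2)
           + expectation (\<lambda>\<omega>. (r - s) * (\<Sum>j<N. (norm (blinfun_apply (\<Phi> \<omega>) (g j)))\<^sup>2))"
proof -
  let ?b = "\<lambda>j \<omega>. (W r \<omega> - W s \<omega>) \<bullet> e j"
  let ?f = "\<lambda>j \<omega>. blinfun_apply (\<Phi> \<omega>) (e j)"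
  have s: "s \<in> {0..T}" using sr by auto
  have nz: "e j \<noteq> 0" for j using norm_e[of j] by force
  have f_simple: "simple_function (F s) (?f j)" for j
    using \<Phi> by (rule simple_function_blinfun_apply)
  have f_meas: "?f j \<in> borel_measurable (F s)" for j
    using f_simple by (rule borel_measurable_simple_function)
  have ff_simple: "simple_function (F s) (\<lambda>\<omega>. ?f j \<omega> \<bullet> ?f l \<omega>)" for j l
    using f_simple f_simple by (rule simple_function_compose2)
  have ff_int: "integrable M (\<lambda>\<omega>. ?f j \<omega> \<bullet> ?f l \<omega>)" for j l
    using s ff_simple by (rule integrable_simple)
  have ff_int2: "integrable M (\<lambda>\<omega>. (norm (?f j \<omega>))\<^sup>2)" for j
    using ff_int[of j j] by (simp add: power2_norm_eq_inner)
  have Gf_meas: "(\<lambda>\<omega>. 2 * (G \<omega> \<bullet> ?f j \<omega>)) \<in> borel_measurable (F s)" for j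
    using G(1) f_meas by simp
  \<comment> \<open>Both factors are square integrable, and twice the product of their norms is at
    most the sum of the squares.\<close>
  have Gf_int: "integrable M (\<lambda>\<omega>. 2 * (G \<omega> \<bullet> ?f j \<omega>))" for j
  proof (rule Bochner_Integration.integrable_bound)
    show "integrable M (\<lambda>\<omega>. (norm (G \<omega>))\<^sup>2 + ?f j \<omega> \<bullet> ?f j \<omega>)"
      using G(2) ff_int by simp
    show "(\<lambda>\<omega>. 2 * (G \<omega> \<bullet> ?f j \<omega>)) \<in> borel_measurable M"
      using subalg[OF s] Gf_meas by (rule measurable_from_subalg)
    show "AE \<omega> in M. norm (2 * (G \<omega> \<bullet> ?f j \<omega>)) \<le> norm ((norm (G \<omega>))\<^sup>2 + ?f j \<omega> \<bullet> ?f j \<omega>)"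
    proof (rule AE_I2)
      fix \<omega>
      have "2 * \<bar>G \<omega> \<bullet> ?f j \<omega>\<bar> \<le> 2 * (norm (G \<omega>) * norm (?f j \<omega>))"
        using Cauchy_Schwarz_ineq2 by auto
      also have "\<dots> \<le> (norm (G \<omega>))\<^sup>2 + (norm (?f j \<omega>))\<^sup>2"
        using sum_squares_bound[of "norm (G \<omega>)" "norm (?f j \<omega>)"] by simp
      finally show "norm (2 * (G \<omega> \<bullet> ?f j \<omega>)) \<le> norm ((norm (G \<omega>))\<^sup>2 + ?f j \<omega> \<bullet> ?f j \<omega>)"
        by (simp add: power2_norm_eq_inner)
    qed
  qed
  have A: "integrable M (\<lambda>\<omega>. 2 * (G \<omega> \<bullet> ?f j \<omega>) * ?b j \<omega>)"
      "expectation (\<lambda>\<omega>. 2 * (G \<omega> \<bullet> ?f j \<omega>) * ?b j \<omega>) = 0" for j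
    using incr_indep[OF sr Gf_meas Gf_int, of "\<lambda>x. x \<bullet> e j"] incr_moments(1,2)[OF sr nz]
    by simp_all
  have B: "integrable M (\<lambda>\<omega>. (?f j \<omega> \<bullet> ?f l \<omega>) * (?b j \<omega> * ?b l \<omega>))"
      "expectation (\<lambda>\<omega>. (?f j \<omega> \<bullet> ?f l \<omega>) * (?b j \<omega> * ?b l \<omega>)) =
         (if j = l then (r - s) * lam j * expectation (\<lambda>\<omega>. ?f j \<omega> \<bullet> ?f j \<omega>) else 0)" for j l
    using incr_indep[OF sr borel_measurable_simple_function[OF ff_simple] ff_int, of "\<lambda>x. (x \<bullet> e j) * (x \<bullet> e l)"]
      incr_covariance[OF sr, of j l]
    by simp_all
  have eq: "(norm (G \<omega> + D \<omega>))\<^sup>2 = (norm (G \<omega>))\<^sup>2 + ((\<Sum>j<N. 2 * (G \<omega> \<bullet> ?f j \<omega>) * ?b j \<omega>)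
      + (\<Sum>j<N. \<Sum>l<N. (?f j \<omega> \<bullet> ?f l \<omega>) * (?b j \<omega> * ?b l \<omega>)))" for \<omega>
  proof -
    have "G \<omega> \<bullet> D \<omega> = (\<Sum>j<N. (G \<omega> \<bullet> ?f j \<omega>) * ?b j \<omega>)"
      by (simp add: D_def inner_sum_right mult.commute)
    moreover have "D \<omega> \<bullet> D \<omega> = (\<Sum>j<N. \<Sum>l<N. (?f j \<omega> \<bullet> ?f l \<omega>) * (?b j \<omega> * ?b l \<omega>))"
      unfolding D_def inner_sum_left inner_sum_right
      by (simp add: sum_distrib_left sum_distrib_right mult_ac inner_commute)
    ultimately show ?thesis
      by (simp add: power2_norm_eq_inner inner_add_left inner_add_right inner_commute[of "D \<omega>" "G \<omega>"]
          sum_distrib_left mult.assoc flip: sum_distrib_left)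
  qed
  have I: "integrable M (\<lambda>\<omega>. (\<Sum>j<N. 2 * (G \<omega> \<bullet> ?f j \<omega>) * ?b j \<omega>))"
    "integrable M (\<lambda>\<omega>. (\<Sum>j<N. \<Sum>l<N. (?f j \<omega> \<bullet> ?f l \<omega>) * (?b j \<omega> * ?b l \<omega>)))"
    using A B by (auto intro!: Bochner_Integration.integrable_sum)
  show "integrable M (\<lambda>\<omega>. (norm (G \<omega> + D \<omega>))\<^sup>2)"
    unfolding eq using G(2) I by simp
  have "expectation (\<lambda>\<omega>. (norm (G \<omega> + D \<omega>))\<^sup>2) = expectation (\<lambda>\<omega>. (norm (G \<omega>))\<^sup>2) +
      (\<Sum>j<N. \<Sum>l<N. if j = l then (r - s) * lam j * expectation (\<lambda>\<omega>. ?f j \<omega> \<bullet> ?f j \<omega>) else 0)"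
    unfolding eq using G(2) I A B by (simp add: Bochner_Integration.integral_sum)
  also have "\<dots> = expectation (\<lambda>\<omega>. (norm (G \<omega>))\<^sup>2)
           + expectation (\<lambda>\<omega>. (r - s) * (\<Sum>j<N. (norm (blinfun_apply (\<Phi> \<omega>) (g j)))\<^sup>2))"
    by (simp add: norm_apply_g sum_distrib_left mult.assoc ff_int2 flip: power2_norm_eq_inner)
  finally show "expectation (\<lambda>\<omega>. (norm (G \<omega> + D \<omega>))\<^sup>2) = expectation (\<lambda>\<omega>. (norm (G \<omega>))\<^sup>2)
           + expectation (\<lambda>\<omega>. (r - s) * (\<Sum>j<N. (norm (blinfun_apply (\<Phi> \<omega>) (g j)))\<^sup>2))" .
qed

text \<open>The squared Hilbert-Schmidt norm in \<open>ennreal\<close>, which unlike \<open>hs_norm\<close> has no junk value when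
  the series diverges.\<close>

definition hs2 :: "(nat \<Rightarrow> 'u) \<Rightarrow> ('u \<Rightarrow> 'h::real_normed_vector) \<Rightarrow> ennreal" where
  "hs2 g \<phi> = (\<Sum>j. ennreal ((norm (\<phi> (g j)))\<^sup>2))"

lemma hs2_eq_hs_norm:
  "summable (\<lambda>j. (norm (\<phi> (g j)))\<^sup>2) \<Longrightarrow> ennreal ((hs_norm g norm \<phi>)\<^sup>2) = hs2 g \<phi>"
  by (simp add: hs2_def hs_norm_def suminf_nonneg suminf_ennreal2)

lemma norm_power2_le_diff: "(norm a)\<^sup>2 \<le> 2 * (norm b)\<^sup>2 + 2 * (norm (a - b :: 'h::real_normed_vector))\<^sup>2"
proof -
  have "(norm a)\<^sup>2 \<le> (norm b + norm (a - b))\<^sup>2"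
    using norm_triangle_ineq[of b "a - b"] by (intro power_mono) auto
  also have "\<dots> \<le> 2 * (norm b)\<^sup>2 + 2 * (norm (a - b))\<^sup>2"
    using sum_squares_bound[of "norm b" "norm (a - b)"] by (simp add: power2_sum)
  finally show ?thesis .
qed

lemma hs2_le_diff: "hs2 g a \<le> 2 * hs2 g b + 2 * hs2 g (\<lambda>u. a u - b u)"
proof -
  have "hs2 g a \<le> (\<Sum>j. 2 * ennreal ((norm (b (g j)))\<^sup>2) + 2 * ennreal ((norm (a (g j) - b (g j)))\<^sup>2))"
    unfolding hs2_def
  proof (intro suminf_le allI)
    fix j
    show "ennreal ((norm (a (g j)))\<^sup>2)
        \<le> 2 * ennreal ((norm (b (g j)))\<^sup>2) + 2 * ennreal ((norm (a (g j) - b (g j)))\<^sup>2)"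
      using norm_power2_le_diff[of "a (g j)" "b (g j)"]
      by (simp add: ennreal_mult'[symmetric] ennreal_plus[symmetric] ennreal_leI flip: ennreal_numeral
          del: ennreal_plus)
  qed auto
  also have "\<dots> = 2 * hs2 g b + 2 * hs2 g (\<lambda>u. a u - b u)"
    by (simp add: hs2_def flip: suminf_add ennreal_suminf_cmult)
  finally show ?thesis .
qed

lemma hs2_measurable:
  assumes "\<And>j. (\<lambda>x. \<phi> x (g j)) \<in> borel_measurable N"
  shows "(\<lambda>x. hs2 g (\<phi> x)) \<in> borel_measurable N"
  unfolding hs2_def using assms by measurable

section \<open>Elementary integrands and their energy\<close>

lemma elementary_mono:
  assumes "elementary F t m p \<Phi>" "i \<le> k" "k \<le> m"
  shows "p i \<le> p k"
  using assms(2,3)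
proof (induction k rule: dec_induct)
  case (step n)
  then have "p i \<le> p n" "p n < p (Suc n)"
    using assms(1) by (auto simp: elementary_def)
  then show ?case by simp
qed simp

lemma elementary_range:
  assumes "elementary F t m p \<Phi>" "i \<le> m"
  shows "0 \<le> p i" "p i \<le> t"
  using elementary_mono[OF assms(1), of 0 i] elementary_mono[OF assms(1), of i m] assms
  by (auto simp: elementary_def)

lemma indicator_sum_disjoint:
  assumes "\<And>i. i < m \<Longrightarrow> i \<noteq> k \<Longrightarrow> s \<notin> A i" "k < (m::nat)" "s \<in> A k"
  shows "(\<Sum>i<m. indicator (A i) s *\<^sub>R x i) = (x k :: 'h::real_vector)"
    and "(\<Sum>i<m. indicator (A i) s * y i) = (y k :: ennreal)"
proof -
  have *: "(\<Sum>i<m. f i) = f k" if "\<And>i. i < m \<Longrightarrow> i \<noteq> k \<Longrightarrow> f i = 0" for f :: "nat \<Rightarrow> 'c::comm_monoid_add"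
    using assms(2) that by (subst sum.remove[of _ k]) auto
  show "(\<Sum>i<m. indicator (A i) s *\<^sub>R x i) = x k" "(\<Sum>i<m. indicator (A i) s * y i) = y k"
    using assms by (subst *; simp add: indicator_def)+
qed

text \<open>At any time at most one of the intervals is active, so squaring the sum produces no
  cross terms; outside all of them both sides are 0.\<close>

lemma hs2_elementary_value:
  assumes "elementary F t m p \<Phi>"
  shows "hs2 g (elementary_value m p \<Phi> s \<omega>)
    = (\<Sum>i<m. indicator {p i<..p (Suc i)} s * hs2 g (blinfun_apply (\<Phi> i \<omega>)))"
proof (cases "\<exists>k<m. s \<in> {p k<..p (Suc k)}")
  case True
  then obtain k where k: "k < m" "s \<in> {p k<..p (Suc k)}" by blast
  have disj: "s \<notin> {p i<..p (Suc i)}" if "i < m" "i \<noteq> k" for i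
    using elementary_mono[OF assms, of "Suc i" k] elementary_mono[OF assms, of "Suc k" i] that k
    by (cases "i < k") auto
  have "elementary_value m p \<Phi> s \<omega> = blinfun_apply (\<Phi> k \<omega>)"
    unfolding elementary_value_def by (intro ext indicator_sum_disjoint(1) disj k)
  moreover have "(\<Sum>i<m. indicator {p i<..p (Suc i)} s * hs2 g (blinfun_apply (\<Phi> i \<omega>)))
      = hs2 g (blinfun_apply (\<Phi> k \<omega>))"
    by (intro indicator_sum_disjoint(2) disj k)
  ultimately show ?thesis by simp
next
  case False
  then have notin: "s \<notin> {p i<..p (Suc i)}" if "i < m" for i
    using that by auto
  then have "elementary_value m p \<Phi> s \<omega> = (\<lambda>u. 0)"
    unfolding elementary_value_def by (intro ext sum.neutral ballI) (metis indicator_simps(2) lessThan_iff scaleR_zero_left)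
  moreover have "(\<Sum>i<m. indicator {p i<..p (Suc i)} s * hs2 g (blinfun_apply (\<Phi> i \<omega>))) = 0"
    using notin by (intro sum.neutral ballI) (metis indicator_simps(2) lessThan_iff mult_zero_left)
  ultimately show ?thesis
    by (simp only:) (simp add: hs2_def)
qed

context wiener_setting
begin

text \<open>Because the eigenvalues are summable, every bounded operator is Hilbert-Schmidt on
  \<open>U0\<close>: its squared norm at \<open>g j\<close> is at most \<open>lam j\<close> times
  the squared operator norm.\<close>

lemma summable_blinfun_g: "summable (\<lambda>j. (norm (blinfun_apply f (g j)))\<^sup>2)"
proof (rule summable_comparison_test')
  show "summable (\<lambda>j. (norm f)\<^sup>2 * lam j)"
    using summable_lam by (rule summable_mult)
  show "norm ((norm (blinfun_apply f (g n)))\<^sup>2) \<le> (norm f)\<^sup>2 * lam n" for n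
    using norm_blinfun[of f "e n"] lam_pos[of n]
    by (simp add: norm_apply_g mult.commute mult_left_mono power_mono)
qed

text \<open>The number of steps is an argument so that the partial energies which decide about
  stopping are values of the same function.\<close>

definition energy :: "nat \<Rightarrow> (nat \<Rightarrow> real) \<Rightarrow> (nat \<Rightarrow> 'w \<Rightarrow> 'u \<Rightarrow>\<^sub>L 'h::real_normed_vector) \<Rightarrow> 'w \<Rightarrow> ennreal"
  where "energy m p \<Phi> \<omega> = (\<Sum>i<m. ennreal (p (Suc i) - p i) * hs2 g (blinfun_apply (\<Phi> i \<omega>)))"

lemma energy_eq:
  assumes "elementary F t m p \<Phi>"
  shows "(\<integral>\<^sup>+s\<in>{0..t}. hs2 g (elementary_value m p \<Phi> s \<omega>) \<partial>lborel) = energy m p \<Phi> \<omega>"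
proof -
  have "(\<integral>\<^sup>+s\<in>{0..t}. hs2 g (elementary_value m p \<Phi> s \<omega>) \<partial>lborel)
      = (\<integral>\<^sup>+s. (\<Sum>i<m. hs2 g (blinfun_apply (\<Phi> i \<omega>)) * indicator {p i<..p (Suc i)} s) \<partial>lborel)"
  proof (rule nn_integral_cong)
    fix s
    have "indicator {p i<..p (Suc i)} s * indicator {0..t} s = (indicator {p i<..p (Suc i)} s :: ennreal)"
      if "i < m" for i
      using elementary_range[OF assms, of i] elementary_range[OF assms, of "Suc i"] that
      by (auto simp: indicator_def)
    then show "hs2 g (elementary_value m p \<Phi> s \<omega>) * indicator {0..t} s
        = (\<Sum>i<m. hs2 g (blinfun_apply (\<Phi> i \<omega>)) * indicator {p i<..p (Suc i)} s)"
      unfolding hs2_elementary_value[OF assms] sum_distrib_right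
      by (intro sum.cong refl) (metis lessThan_iff mult.assoc mult.commute)
  qed
  also have "\<dots> = (\<Sum>i<m. hs2 g (blinfun_apply (\<Phi> i \<omega>)) * emeasure lborel {p i<..p (Suc i)})"
    by (subst nn_integral_sum) (auto simp: nn_integral_cmult_indicator)
  also have "\<dots> = energy m p \<Phi> \<omega>"
    using assms by (auto simp: energy_def elementary_def mult.commute intro!: sum.cong less_imp_le)
  finally show ?thesis .
qed

lemma energy_measurable:
  fixes \<Phi> :: "nat \<Rightarrow> 'w \<Rightarrow> 'u \<Rightarrow>\<^sub>L 'h::{real_inner, banach, second_countable_topology}"
  assumes el: "elementary F t m p \<Phi>" "t \<le> T" and k: "k \<le> Suc i" "i < m"
  shows "energy k p \<Phi> \<in> borel_measurable (F (p i))"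
proof -
  have "(\<lambda>\<omega>. blinfun_apply (\<Phi> l \<omega>) (g j)) \<in> borel_measurable (F (p i))" if "l < k" for l j
  proof -
    have "simple_function (F (p l)) (\<Phi> l)"
      using el k that by (auto simp: elementary_def)
    then have "(\<lambda>\<omega>. blinfun_apply (\<Phi> l \<omega>) (g j)) \<in> borel_measurable (F (p l))"
      by (intro borel_measurable_simple_function simple_function_blinfun_apply)
    moreover have "subalgebra (F (p i)) (F (p l))"
      using elementary_mono[OF el(1), of l i] elementary_range[OF el(1), of i]
        elementary_range[OF el(1), of l] that k el
      by (intro subalg_mono) auto
    ultimately show ?thesis by (rule measurable_from_subalg[rotated])
  qed
  then show ?thesis
    unfolding energy_def by (intro borel_measurable_sum borel_measurable_times_ennreal hs2_measurable) auto
qed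

text \<open>The increments are projected to the span of the first \<open>N\<close> basis vectors so that only finite sums
  of products of real Gaussian variables occur; Fatou's lemma then suffices for \<open>N \<rightarrow> \<infinity>\<close>.\<close>

lemma elementary_proj_isometry:
  fixes \<Phi> :: "nat \<Rightarrow> 'w \<Rightarrow> 'u \<Rightarrow>\<^sub>L 'h::{real_inner, banach, second_countable_topology}"
    and N :: nat
  assumes el: "elementary F t m p \<Phi>" "t \<le> T"
  defines "J \<equiv> \<lambda>k \<omega>. \<Sum>i<k. \<Sum>j<N. ((W (p (Suc i)) \<omega> - W (p i) \<omega>) \<bullet> e j) *\<^sub>R blinfun_apply (\<Phi> i \<omega>) (e j)"
  assumes "k \<le> m"
  shows "J k \<in> borel_measurable (F (p k)) \<and> integrable M (\<lambda>\<omega>. (norm (J k \<omega>))\<^sup>2) \<and>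
    expectation (\<lambda>\<omega>. (norm (J k \<omega>))\<^sup>2) = (\<Sum>i<k. expectation (\<lambda>\<omega>.
       (p (Suc i) - p i) * (\<Sum>j<N. (norm (blinfun_apply (\<Phi> i \<omega>) (g j)))\<^sup>2)))"
  using \<open>k \<le> m\<close>
proof (induction k)
  case 0
  then show ?case by (simp add: J_def)
next
  case (Suc k)
  let ?s = "p k" and ?r = "p (Suc k)"
  have sr: "0 \<le> ?s" "?s < ?r" "?r \<le> T"
    using el Suc.prems elementary_range[OF el(1), of "Suc k"] elementary_range[OF el(1), of k]
    by (auto simp: elementary_def)
  have \<Phi>: "simple_function (F ?s) (\<Phi> k)"
    using el Suc.prems by (auto simp: elementary_def)
  have IH: "J k \<in> borel_measurable (F ?s)" "integrable M (\<lambda>\<omega>. (norm (J k \<omega>))\<^sup>2)"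
    using Suc by auto
  have J_Suc: "J (Suc k) = (\<lambda>\<omega>. J k \<omega>
      + (\<Sum>j<N. ((W ?r \<omega> - W ?s \<omega>) \<bullet> e j) *\<^sub>R blinfun_apply (\<Phi> k \<omega>) (e j)))"
    by (simp add: J_def)
  have sub: "subalgebra (F ?r) (F ?s)"
    using sr by (intro subalg_mono) auto
  have 1: "J k \<in> borel_measurable (F ?r)" "W ?s \<in> borel_measurable (F ?r)"
    "(\<lambda>\<omega>. blinfun_apply (\<Phi> k \<omega>) (e j)) \<in> borel_measurable (F ?r)" for j
    using IH(1) W_adapted[of ?s] sr \<Phi>
    by (auto intro!: measurable_from_subalg[OF sub] borel_measurable_simple_function[of "F ?s" "\<lambda>\<omega>. blinfun_apply (\<Phi> k \<omega>) (e j)"]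
        simple_function_blinfun_apply)
  have 2: "W ?r \<in> borel_measurable (F ?r)"
    using W_adapted[of ?r] sr by auto
  have "J (Suc k) \<in> borel_measurable (F ?r)"
    unfolding J_Suc using 1 2 by (intro borel_measurable_add borel_measurable_sum) auto
  then show ?case
    using isometry_step[OF sr IH \<Phi>, of N] Suc unfolding J_Suc by simp
qed

text \<open>One half of the isometry is enough: the second moment of each projected integral is the
  mean of a partial sum of the Hilbert-Schmidt series, hence at most the mean energy, uniformly in
  \<open>N\<close>.\<close>

lemma elementary_integral_bound:
  fixes \<Phi> :: "nat \<Rightarrow> 'w \<Rightarrow> 'u \<Rightarrow>\<^sub>L 'h::{real_inner, banach, second_countable_topology}"
  assumes el: "elementary F t m p \<Phi>" "t \<le> T"
  shows "(\<integral>\<^sup>+\<omega>. ennreal ((norm (elementary_integral W m p \<Phi> \<omega>))\<^sup>2) \<partial>M) \<le> (\<integral>\<^sup>+\<omega>. energy m p \<Phi> \<omega> \<partial>M)"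
proof -
  define J where "J = (\<lambda>N \<omega>. \<Sum>i<m. \<Sum>j<N. ((W (p (Suc i)) \<omega> - W (p i) \<omega>) \<bullet> e j)
      *\<^sub>R blinfun_apply (\<Phi> i \<omega>) (e j))"
  have pm: "p m \<in> {0..T}"
    using elementary_range[OF el(1), of m] el(2) by auto
  note iso = elementary_proj_isometry[OF el order.refl, folded J_def]
  have J_meas: "J N \<in> borel_measurable M" for N
    using iso[of N] subalg[OF pm] by (auto simp: J_def intro: measurable_from_subalg)
  have "(\<integral>\<^sup>+\<omega>. ennreal ((norm (J N \<omega>))\<^sup>2) \<partial>M) \<le> (\<integral>\<^sup>+\<omega>. energy m p \<Phi> \<omega> \<partial>M)" for N
  proof -
    have int: "integrable M (\<lambda>\<omega>. (p (Suc i) - p i) * (\<Sum>j<N. (norm (blinfun_apply (\<Phi> i \<omega>) (g j)))\<^sup>2))"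
      if "i < m" for i
    proof (rule integrable_simple)
      show "p i \<in> {0..T}" using elementary_range[OF el(1), of i] that el(2) by auto
      have "simple_function (F (p i)) (\<Phi> i)"
        using el that by (auto simp: elementary_def)
      then show "simple_function (F (p i)) (\<lambda>\<omega>. (p (Suc i) - p i) * (\<Sum>j<N. (norm (blinfun_apply (\<Phi> i \<omega>) (g j)))\<^sup>2))"
        by (rule simple_function_compose1)
    qed
    have nonneg: "0 \<le> (\<Sum>i<m. (p (Suc i) - p i) * (\<Sum>j<N. (norm (blinfun_apply (\<Phi> i \<omega>) (g j)))\<^sup>2))" for \<omega>
      using el by (intro sum_nonneg mult_nonneg_nonneg) (auto simp: elementary_def intro: less_imp_le)
    have "(\<integral>\<^sup>+\<omega>. ennreal ((norm (J N \<omega>))\<^sup>2) \<partial>M) = ennreal (expectation (\<lambda>\<omega>. (norm (J N \<omega>))\<^sup>2))"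
      using iso[of N] by (intro nn_integral_eq_integral) (auto simp: J_def)
    also have "expectation (\<lambda>\<omega>. (norm (J N \<omega>))\<^sup>2) = expectation (\<lambda>\<omega>. \<Sum>i<m.
        (p (Suc i) - p i) * (\<Sum>j<N. (norm (blinfun_apply (\<Phi> i \<omega>) (g j)))\<^sup>2))"
      using iso[of N] int by (subst Bochner_Integration.integral_sum) (auto simp: J_def)
    also have "ennreal \<dots> = (\<integral>\<^sup>+\<omega>. ennreal (\<Sum>i<m.
        (p (Suc i) - p i) * (\<Sum>j<N. (norm (blinfun_apply (\<Phi> i \<omega>) (g j)))\<^sup>2)) \<partial>M)"
      using int nonneg by (intro nn_integral_eq_integral[symmetric] Bochner_Integration.integrable_sum) auto
    also have "\<dots> \<le> (\<integral>\<^sup>+\<omega>. energy m p \<Phi> \<omega> \<partial>M)"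
    proof (rule nn_integral_mono)
      fix \<omega>
      have "ennreal (\<Sum>i<m. (p (Suc i) - p i) * (\<Sum>j<N. (norm (blinfun_apply (\<Phi> i \<omega>) (g j)))\<^sup>2))
         = (\<Sum>i<m. ennreal (p (Suc i) - p i) * (\<Sum>j<N. ennreal ((norm (blinfun_apply (\<Phi> i \<omega>) (g j)))\<^sup>2)))"
        using el by (subst sum_ennreal[symmetric])
          (auto simp: elementary_def ennreal_mult sum_nonneg less_imp_le intro!: mult_nonneg_nonneg sum.cong)
      also have "\<dots> \<le> energy m p \<Phi> \<omega>"
        unfolding energy_def hs2_def by (intro sum_mono mult_left_mono sum_le_suminf) auto
      finally show "ennreal (\<Sum>i<m. (p (Suc i) - p i) * (\<Sum>j<N. (norm (blinfun_apply (\<Phi> i \<omega>) (g j)))\<^sup>2))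
          \<le> energy m p \<Phi> \<omega>" .
    qed
    finally show ?thesis .
  qed
  note bound = this
  have lim: "(\<lambda>N. J N \<omega>) \<longlonglongrightarrow> elementary_integral W m p \<Phi> \<omega>" for \<omega>
    unfolding J_def elementary_integral_def by (intro tendsto_sum blinfun_proj_sum_tendsto)
  have "(\<integral>\<^sup>+\<omega>. ennreal ((norm (elementary_integral W m p \<Phi> \<omega>))\<^sup>2) \<partial>M)
      = (\<integral>\<^sup>+\<omega>. liminf (\<lambda>N. ennreal ((norm (J N \<omega>))\<^sup>2)) \<partial>M)"
    by (intro nn_integral_cong lim_imp_Liminf[symmetric] tendsto_ennrealI tendsto_power tendsto_norm lim) simp
  also have "\<dots> \<le> liminf (\<lambda>N. \<integral>\<^sup>+\<omega>. ennreal ((norm (J N \<omega>))\<^sup>2) \<partial>M)"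
    using J_meas by (intro nn_integral_liminf) auto
  also have "\<dots> \<le> (\<integral>\<^sup>+\<omega>. energy m p \<Phi> \<omega> \<partial>M)"
    using bound by (intro Liminf_le) auto
  finally show ?thesis .
qed

text \<open>The stopped integrand \<open>\<Psi>\<close> is again elementary because the energy up to \<open>p (Suc i)\<close> involves only
  \<open>\<Phi> 0, \<dots>, \<Phi> i\<close> and is therefore known at time \<open>p i\<close>.\<close>

lemma elementary_integral_truncated:
  fixes \<Phi> :: "nat \<Rightarrow> 'w \<Rightarrow> 'u \<Rightarrow>\<^sub>L 'h::{real_inner, banach, second_countable_topology}"
  assumes el: "elementary F t m p \<Phi>" "t \<le> T"
  shows "(\<integral>\<^sup>+\<omega>. indicator {\<omega>. energy m p \<Phi> \<omega> \<le> c} \<omega> * ennreal ((norm (elementary_integral W m p \<Phi> \<omega>))\<^sup>2) \<partial>M)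
    \<le> (\<integral>\<^sup>+\<omega>. min (energy m p \<Phi> \<omega>) c \<partial>M)"
proof -
  \<comment> \<open>The test counts the contribution of step \<open>i\<close> before admitting it,
    so the level \<open>c\<close> is never overshot, however large a single step may be.\<close>
  define \<Psi> where "\<Psi> i \<omega> = (if energy (Suc i) p \<Phi> \<omega> \<le> c then \<Phi> i \<omega> else 0)" for i \<omega>
  have el': "elementary F t m p \<Psi>"
    unfolding elementary_def
  proof (intro conjI allI impI)
    fix i assume i: "i < m"
    have "{\<omega> \<in> space (F (p i)). energy (Suc i) p \<Phi> \<omega> \<le> c} \<in> sets (F (p i))"
      using energy_measurable[OF el order.refl i] by measurable
    then show "simple_function (F (p i)) (\<Psi> i)"
      using el i unfolding \<Psi>_def by (intro simple_function_If) (auto simp: elementary_def)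
  qed (use el in \<open>auto simp: elementary_def\<close>)
  have energy_Suc: "energy (Suc k) p \<Xi> \<omega>
      = energy k p \<Xi> \<omega> + ennreal (p (Suc k) - p k) * hs2 g (blinfun_apply (\<Xi> k \<omega>))"
    for k \<omega> and \<Xi> :: "nat \<Rightarrow> 'w \<Rightarrow> 'u \<Rightarrow>\<^sub>L 'h"
    by (simp add: energy_def)
  have hs0: "hs2 g (blinfun_apply (0 :: 'u \<Rightarrow>\<^sub>L 'h)) = 0"
    by (simp add: hs2_def)
  have le1: "energy k p \<Psi> \<omega> \<le> energy k p \<Phi> \<omega>" for k \<omega>
    unfolding energy_def by (intro sum_mono mult_left_mono) (auto simp: \<Psi>_def hs0)
  \<comment> \<open>If step \<open>k\<close> passes the test, the comparison with
    \<open>\<Phi>\<close> gives the bound; if it is rejected, it adds nothing to the previous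
    total.\<close>
  have le2: "energy k p \<Psi> \<omega> \<le> c" for k \<omega>
  proof (induction k)
    case 0
    then show ?case by (simp add: energy_def)
  next
    case (Suc k)
    show ?case
    proof (cases "energy (Suc k) p \<Phi> \<omega> \<le> c")
      case True
      then show ?thesis using le1 order.trans by blast
    next
      case False
      then show ?thesis using Suc by (simp add: energy_Suc \<Psi>_def hs0)
    qed
  qed
  have mono: "energy (Suc i) p \<Phi> \<omega> \<le> energy m p \<Phi> \<omega>" if "i < m" for i \<omega>
    unfolding energy_def using that by (intro sum_mono2) auto
  have "(\<integral>\<^sup>+\<omega>. indicator {\<omega>. energy m p \<Phi> \<omega> \<le> c} \<omega> * ennreal ((norm (elementary_integral W m p \<Phi> \<omega>))\<^sup>2) \<partial>M)
      \<le> (\<integral>\<^sup>+\<omega>. ennreal ((norm (elementary_integral W m p \<Psi> \<omega>))\<^sup>2) \<partial>M)"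
  proof (rule nn_integral_mono)
    fix \<omega>
    show "indicator {\<omega>. energy m p \<Phi> \<omega> \<le> c} \<omega> * ennreal ((norm (elementary_integral W m p \<Phi> \<omega>))\<^sup>2)
        \<le> ennreal ((norm (elementary_integral W m p \<Psi> \<omega>))\<^sup>2)"
    proof (cases "energy m p \<Phi> \<omega> \<le> c")
      case True
      \<comment> \<open>Partial energies increase with the number of steps, so if the total stays
        below the level no step is rejected.\<close>
      then have "\<Psi> i \<omega> = \<Phi> i \<omega>" if "i < m" for i
        using mono[OF that, of \<omega>] by (auto simp: \<Psi>_def)
      then show ?thesis by (simp add: elementary_integral_def indicator_def)
    qed (simp add: indicator_def)
  qed
  also have "\<dots> \<le> (\<integral>\<^sup>+\<omega>. energy m p \<Psi> \<omega> \<partial>M)"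
    using el' el(2) by (rule elementary_integral_bound)
  also have "\<dots> \<le> (\<integral>\<^sup>+\<omega>. min (energy m p \<Phi> \<omega>) c \<partial>M)"
    using le1 le2 by (intro nn_integral_mono) auto
  finally show ?thesis .
qed

end

section \<open>The stochastic integral\<close>

text \<open>The cutoff at 1 turns convergence in probability into convergence in mean without any
  moments; values in \<open>ennreal\<close> admit infinite energies.\<close>

lemma (in prob_space) tendsto_truncated_expectation:
  fixes X :: "nat \<Rightarrow> 'a \<Rightarrow> ennreal"
  assumes [measurable]: "\<And>n. X n \<in> borel_measurable M"
    and lim: "\<And>\<eta>. \<eta> > 0 \<Longrightarrow> (\<lambda>n. prob {\<omega> \<in> space M. X n \<omega> > ennreal \<eta>}) \<longlonglongrightarrow> 0"
  shows "(\<lambda>n. expectation (\<lambda>\<omega>. enn2real (min 1 (X n \<omega>)))) \<longlonglongrightarrow> 0"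
proof (rule tendstoI)
  fix \<eta> :: real assume \<eta>: "\<eta> > 0"
  let ?A = "\<lambda>n. {\<omega> \<in> space M. X n \<omega> > ennreal (\<eta> / 2)}"
  have le1: "enn2real (min 1 x) \<le> 1" for x
    by (metis enn2real_1 enn2real_mono ennreal_one_less_top min.cobounded1)
  have int: "integrable M (\<lambda>\<omega>. enn2real (min 1 (X n \<omega>)))" for n
    using le1 by (intro integrable_const_bound[of _ 1]) auto
  have bound: "expectation (\<lambda>\<omega>. enn2real (min 1 (X n \<omega>))) \<le> \<eta> / 2 + prob (?A n)" for n
  proof -
    have "expectation (\<lambda>\<omega>. enn2real (min 1 (X n \<omega>))) \<le> expectation (\<lambda>\<omega>. \<eta> / 2 + indicator (?A n) \<omega>)"
    proof (rule integral_mono[OF int])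
      fix \<omega> assume "\<omega> \<in> space M"
      show "enn2real (min 1 (X n \<omega>)) \<le> \<eta> / 2 + indicator (?A n) \<omega>"
      proof (cases "X n \<omega> > ennreal (\<eta> / 2)")
        case True
        then show ?thesis using le1[of "X n \<omega>"] \<open>\<omega> \<in> space M\<close> \<eta> by simp
      next
        case False
        then have "enn2real (min 1 (X n \<omega>)) \<le> enn2real (ennreal (\<eta> / 2))"
          by (intro enn2real_mono) (auto simp: min.coboundedI2)
        then show ?thesis using \<eta> False by simp
      qed
    qed (auto intro!: Bochner_Integration.integrable_add integrable_real_indicator simp: emeasure_eq_measure)
    also have "\<dots> = \<eta> / 2 + prob (?A n)"
      by (subst Bochner_Integration.integral_add)
        (auto intro!: integrable_real_indicator simp: emeasure_eq_measure prob_space)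
    finally show ?thesis .
  qed
  have "eventually (\<lambda>n. prob (?A n) < \<eta> / 2) sequentially"
    using lim[of "\<eta> / 2"] \<eta> by (intro order_tendstoD(2)[of _ 0]) auto
  then show "eventually (\<lambda>n. dist (expectation (\<lambda>\<omega>. enn2real (min 1 (X n \<omega>)))) 0 < \<eta>) sequentially"
  proof eventually_elim
    case (elim n)
    have "0 \<le> expectation (\<lambda>\<omega>. enn2real (min 1 (X n \<omega>)))" by simp
    then show ?case using elim bound[of n] by (simp add: dist_real_def)
  qed
qed

lemma tendsto_0_of_truncated:
  fixes x :: "nat \<Rightarrow> ennreal"
  assumes "(\<lambda>n. enn2real (min 1 (x n))) \<longlonglongrightarrow> 0"
  shows "x \<longlonglongrightarrow> 0"
proof (rule order_tendstoI)
  fix a :: ennreal assume "a > 0"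
  have "(\<lambda>n. ennreal (enn2real (min 1 (x n)))) \<longlonglongrightarrow> ennreal 0"
    using assms by (intro tendsto_ennrealI)
  moreover have "ennreal (enn2real (min 1 (x n))) = min 1 (x n)" for n
    by (intro ennreal_enn2real) (simp add: min_less_iff_disj)
  ultimately have "(\<lambda>n. min 1 (x n)) \<longlonglongrightarrow> 0" by simp
  then have "eventually (\<lambda>n. min 1 (x n) < min 1 a) sequentially"
    using \<open>a > 0\<close> by (intro order_tendstoD(2)) (auto simp: min_def)
  then show "eventually (\<lambda>n. x n < a) sequentially"
    by eventually_elim (auto simp: min_def split: if_splits)
qed (simp add: not_less)

text \<open>The sum of the two truncated variables tends to 0 in mean. An almost surely convergent
  subsequence of the sum serves both, because the summands are nonnegative.\<close>

lemma (in prob_space) tendsto_in_prob_AE_subseq: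
  fixes X Y :: "nat \<Rightarrow> 'a \<Rightarrow> ennreal"
  assumes X[measurable]: "\<And>n. X n \<in> borel_measurable M" and Y[measurable]: "\<And>n. Y n \<in> borel_measurable M"
    and limX: "\<And>\<eta>. \<eta> > 0 \<Longrightarrow> (\<lambda>n. prob {\<omega> \<in> space M. X n \<omega> > ennreal \<eta>}) \<longlonglongrightarrow> 0"
    and limY: "\<And>\<eta>. \<eta> > 0 \<Longrightarrow> (\<lambda>n. prob {\<omega> \<in> space M. Y n \<omega> > ennreal \<eta>}) \<longlonglongrightarrow> 0"
  obtains r :: "nat \<Rightarrow> nat" where "strict_mono r"
    "AE \<omega> in M. (\<lambda>n. X (r n) \<omega>) \<longlonglongrightarrow> 0 \<and> (\<lambda>n. Y (r n) \<omega>) \<longlonglongrightarrow> 0"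
proof -
  let ?x = "\<lambda>n \<omega>. enn2real (min 1 (X n \<omega>))" and ?y = "\<lambda>n \<omega>. enn2real (min 1 (Y n \<omega>))"
  have le1: "enn2real (min 1 x) \<le> 1" for x
    by (metis enn2real_1 enn2real_mono ennreal_one_less_top min.cobounded1)
  have int: "integrable M (?x n)" "integrable M (?y n)" for n
    using le1 by (auto intro!: integrable_const_bound[of _ 1])
  have "(\<lambda>n. expectation (?x n) + expectation (?y n)) \<longlonglongrightarrow> 0 + 0"
    by (intro tendsto_add tendsto_truncated_expectation limX limY) auto
  then have "(\<lambda>n. expectation (\<lambda>\<omega>. norm (?x n \<omega> + ?y n \<omega>))) \<longlonglongrightarrow> 0"
    using int by simp
  then have "\<exists>r::nat \<Rightarrow> nat. strict_mono r \<and> (AE \<omega> in M. (\<lambda>n. ?x (r n) \<omega> + ?y (r n) \<omega>) \<longlonglongrightarrow> 0)"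
    using int by (intro tendsto_L1_AE_subseq) auto
  then obtain r :: "nat \<Rightarrow> nat" where r: "strict_mono r"
    and lim: "AE \<omega> in M. (\<lambda>n. ?x (r n) \<omega> + ?y (r n) \<omega>) \<longlonglongrightarrow> 0"
    by blast
  have "AE \<omega> in M. (\<lambda>n. X (r n) \<omega>) \<longlonglongrightarrow> 0 \<and> (\<lambda>n. Y (r n) \<omega>) \<longlonglongrightarrow> 0"
    using lim
  proof eventually_elim
    case (elim \<omega>)
    have "(\<lambda>n. ?x (r n) \<omega>) \<longlonglongrightarrow> 0" "(\<lambda>n. ?y (r n) \<omega>) \<longlonglongrightarrow> 0"
      by (rule tendsto_sandwich[OF _ _ tendsto_const elim]; simp)+
    then show ?case by (auto intro: tendsto_0_of_truncated)
  qed
  with r that show thesis by blast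
qed

section \<open>Joint measurability in time and chance\<close>

context wiener_setting
begin

text \<open>Predictable sets live on the strip \<open>{0..t} \<times> space M\<close>, while
  Tonelli's theorem is applied on the full product; restricting the product to the strip connects
  the two.\<close>

definition rect :: "real \<Rightarrow> (real \<times> 'w) measure" where
  "rect t = restrict_space (lborel \<Otimes>\<^sub>M M) ({0..t} \<times> space M)"

lemma space_rect: "space (rect t) = {0..t} \<times> space M"
  by (auto simp: rect_def space_restrict_space space_pair_measure)

text \<open>Each generator is a Borel set of times multiplied by an event, hence a measurable
  rectangle. For negative \<open>t\<close> the space is empty and every function on it is
  measurable.\<close>

lemma predictable_measurable_rect:
  assumes "t \<le> T" "f \<in> borel_measurable (predictable_sigma M F t)"
  shows "f \<in> borel_measurable (rect t)"
proof -
  let ?G = "{{0} \<times> A | A. A \<in> sets (F 0)} \<union>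
      {{a<..b} \<times> A | a b A. 0 \<le> a \<and> a < b \<and> b \<le> t \<and> A \<in> sets (F a)}"
  show ?thesis
  proof (cases "0 \<le> t")
    case True
    have sub: "A \<in> sets M" "A \<subseteq> space M" if "A \<in> sets (F a)" "0 \<le> a" "a \<le> t" for a A
      using subalg[of a] sets.sets_into_space[of A M] that assms(1) by (auto simp: subalgebra_def)
    have box: "B \<times> A \<in> sets (lborel \<Otimes>\<^sub>M M) \<and> B \<times> A \<subseteq> {0..t} \<times> space M"
      if "B \<in> sets lborel" "B \<subseteq> {0..t}" "A \<in> sets (F a)" "0 \<le> a" "a \<le> t" for A B a
      using sub[OF that(3-5)] that(1,2) by auto
    have G1: "A \<in> sets (lborel \<Otimes>\<^sub>M M) \<and> A \<subseteq> {0..t} \<times> space M" if A: "A \<in> ?G" for A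
      using A
    proof (elim UnE CollectE exE conjE)
      fix A' assume "A = {0} \<times> A'" "A' \<in> sets (F 0)"
      then show ?thesis using box[of "{0}" A' 0] True by simp
    next
      fix a b A' assume "A = {a<..b} \<times> A'" "0 \<le> a" "a < b" "b \<le> t" "A' \<in> sets (F a)"
      then show ?thesis using box[of "{a<..b}" A' a] by force
    qed
    then have G: "?G \<subseteq> Pow ({0..t} \<times> space M)" by blast
    have G2: "?G \<subseteq> sets (rect t)"
    proof
      fix A assume "A \<in> ?G"
      from G1[OF this] show "A \<in> sets (rect t)"
        unfolding rect_def sets_restrict_space by (intro image_eqI[of _ _ A]) auto
    qed
    have "sets (predictable_sigma M F t) \<subseteq> sets (rect t)"
      unfolding predictable_sigma_def sets_measure_of[OF G]
      by (fact sets.sigma_sets_subset[OF G2, unfolded space_rect])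
    moreover have "space (predictable_sigma M F t) = space (rect t)"
      using G by (simp add: predictable_sigma_def space_rect)
    ultimately show ?thesis
      using assms(2) by (intro measurable_from_subalg[of "rect t" "predictable_sigma M F t"]) (auto simp: subalgebra_def)
  next
    case False
    then have "space (rect t) = {}" by (simp add: space_rect)
    then show ?thesis by (simp add: measurable_def)
  qed
qed

lemma rect_indicator:
  fixes f :: "real \<times> 'w \<Rightarrow> ennreal"
  assumes "f \<in> borel_measurable (rect t)"
  shows "(\<lambda>(s, \<omega>). f (s, \<omega>) * indicator {0..t} s) \<in> borel_measurable (lborel \<Otimes>\<^sub>M M)"
proof -
  have "(\<lambda>x. f x * indicator ({0..t} \<times> space M) x) \<in> borel_measurable (lborel \<Otimes>\<^sub>M M)"
    using assms unfolding rect_def by (subst (asm) borel_measurable_restrict_space_iff_ennreal) auto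
  then show ?thesis
    by (rule measurable_cong[THEN iffD1, rotated])
      (auto simp: space_pair_measure indicator_def)
qed

lemma rect_nn_integral:
  fixes f :: "real \<Rightarrow> 'w \<Rightarrow> ennreal"
  assumes "(\<lambda>(s, \<omega>). f s \<omega>) \<in> borel_measurable (rect t)"
  shows "(\<lambda>\<omega>. \<integral>\<^sup>+s\<in>{0..t}. f s \<omega> \<partial>lborel) \<in> borel_measurable M"
    and "\<omega> \<in> space M \<Longrightarrow> (\<lambda>s. f s \<omega> * indicator {0..t} s) \<in> borel_measurable lborel"
proof -
  have m: "(\<lambda>(s, \<omega>). f s \<omega> * indicator {0..t} s) \<in> borel_measurable (lborel \<Otimes>\<^sub>M M)"
    using rect_indicator[OF assms] by simp
  then have "(\<lambda>(\<omega>, s). f s \<omega> * indicator {0..t} s) \<in> borel_measurable (M \<Otimes>\<^sub>M lborel)"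
    by (subst measurable_pair_swap_iff) (simp add: split_beta')
  then show "(\<lambda>\<omega>. \<integral>\<^sup>+s\<in>{0..t}. f s \<omega> \<partial>lborel) \<in> borel_measurable M"
    by (rule lborel.borel_measurable_nn_integral)
  show "(\<lambda>s. f s \<omega> * indicator {0..t} s) \<in> borel_measurable lborel" if "\<omega> \<in> space M"
    using measurable_Pair1[OF m that] by simp
qed

lemma elementary_value_measurable:
  fixes \<Phi> :: "nat \<Rightarrow> 'w \<Rightarrow> 'u \<Rightarrow>\<^sub>L 'h::{real_inner, banach, second_countable_topology}"
  assumes el: "elementary F t m p \<Phi>" "t \<le> T"
  shows "(\<lambda>(s, \<omega>). elementary_value m p \<Phi> s \<omega> u) \<in> borel_measurable (rect t)"
proof -
  have "(\<lambda>\<omega>. blinfun_apply (\<Phi> i \<omega>) u) \<in> borel_measurable M" if "i < m" for i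
  proof -
    have "p i \<in> {0..T}" using elementary_range[OF el(1), of i] that el(2) by auto
    then show ?thesis
      using el that by (intro measurable_from_subalg[OF subalg] borel_measurable_simple_function
          simple_function_blinfun_apply) (auto simp: elementary_def)
  qed
  note [measurable] = this
  have "(\<lambda>x. elementary_value m p \<Phi> (fst x) (snd x) u) \<in> borel_measurable (lborel \<Otimes>\<^sub>M M)"
    unfolding elementary_value_def
    by (intro borel_measurable_sum borel_measurable_scaleR) auto
  then show ?thesis
    unfolding rect_def split_beta' by (rule measurable_restrict_space1)
qed

text \<open>A random operator is applied to a random vector; expanding the increment along the basis
  makes each summand a real variable times a vector-valued one.\<close>

lemma elementary_integral_measurable:
  fixes \<Phi> :: "nat \<Rightarrow> 'w \<Rightarrow> 'u \<Rightarrow>\<^sub>L 'h::{real_inner, banach, second_countable_topology}"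
  assumes el: "elementary F t m p \<Phi>" "t \<le> T"
  shows "elementary_integral W m p \<Phi> \<in> borel_measurable M"
proof -
  have "(\<lambda>\<omega>. blinfun_apply (\<Phi> i \<omega>) (W (p (Suc i)) \<omega> - W (p i) \<omega>)) \<in> borel_measurable M"
    if i: "i < m" for i
  proof (rule borel_measurable_LIMSEQ_metric)
    have p: "p i \<in> {0..T}" "p (Suc i) \<in> {0..T}"
      using elementary_range[OF el(1), of i] elementary_range[OF el(1), of "Suc i"] that el(2) by auto
    have "(\<lambda>\<omega>. blinfun_apply (\<Phi> i \<omega>) u) \<in> borel_measurable M" for u
      using el that p by (intro measurable_from_subalg[OF subalg] borel_measurable_simple_function
          simple_function_blinfun_apply) (auto simp: elementary_def)
    then show "(\<lambda>\<omega>. \<Sum>j<n. ((W (p (Suc i)) \<omega> - W (p i) \<omega>) \<bullet> e j) *\<^sub>R blinfun_apply (\<Phi> i \<omega>) (e j))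
        \<in> borel_measurable M" for n
      using W_measurable[OF p(1)] W_measurable[OF p(2)]
      by (intro borel_measurable_sum borel_measurable_scaleR) auto
  qed (rule blinfun_proj_sum_tendsto)
  then show ?thesis
    unfolding elementary_integral_def by (intro borel_measurable_sum) auto
qed

text \<open>Along a subsequence the elementary integrals converge to \<open>I\<close> and the energy
  distances \<open>D\<close> tend to 0, almost surely. Where \<open>V < c\<close>, the approximating
  energies are eventually at most \<open>4 * c\<close>, so the integrals truncated at that level
  still converge to \<open>I\<close>, and Fatou's lemma applies. The factor is 8 = 2 * 4: 2 for
  comparing \<open>En\<close> with \<open>V\<close>, 4 for lowering the cutoff from
  \<open>4 * c\<close> to \<open>c\<close>.\<close>

lemma ito_inequality:
  fixes I :: "'w \<Rightarrow> 'h::{real_inner, banach, second_countable_topology}" and c :: ennreal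
  assumes I: "has_stoch_integral M F Q g W \<phi> t I" and t: "0 \<le> t" "t \<le> T" and c: "0 < c" "c < \<infinity>"
  defines "V \<equiv> \<lambda>\<omega>. \<integral>\<^sup>+s\<in>{0..t}. hs2 g (\<phi> s \<omega>) \<partial>lborel"
  shows "(\<integral>\<^sup>+\<omega>. indicator {\<omega>. V \<omega> < c} \<omega> * ennreal ((norm (I \<omega>))\<^sup>2) \<partial>M) \<le> 8 * (\<integral>\<^sup>+\<omega>. min (V \<omega>) c \<partial>M)"
proof -
  from I obtain m p \<Phi> where el: "\<And>n. elementary F t (m n) (p n) (\<Phi> n)"
    and lim1: "\<And>\<eta>. \<eta> > 0 \<Longrightarrow> (\<lambda>n. measure M {\<omega> \<in> space M.
             (\<integral>\<^sup>+s\<in>{0..t}. ennreal ((hs_norm g norm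
                (\<lambda>u. elementary_value (m n) (p n) (\<Phi> n) s \<omega> u - \<phi> s \<omega> u))\<^sup>2) \<partial>lborel)
             > ennreal \<eta>}) \<longlonglongrightarrow> 0"
    and lim2: "\<And>\<eta>. \<eta> > 0 \<Longrightarrow> (\<lambda>n. measure M {\<omega> \<in> space M.
             norm (elementary_integral W (m n) (p n) (\<Phi> n) \<omega> - I \<omega>) > \<eta>}) \<longlonglongrightarrow> 0"
    unfolding has_stoch_integral_def by (elim conjE exE) blast
  have I_meas[measurable]: "I \<in> borel_measurable M"
    using I by (simp add: has_stoch_integral_def)
  let ?v = "\<lambda>n. elementary_value (m n) (p n) (\<Phi> n)"
  define J where "J n = elementary_integral W (m n) (p n) (\<Phi> n)" for n
  define En where "En n = energy (m n) (p n) (\<Phi> n)" for n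
  define D where "D n \<omega> = (\<integral>\<^sup>+s\<in>{0..t}. hs2 g (\<lambda>u. ?v n s \<omega> u - \<phi> s \<omega> u) \<partial>lborel)" for n \<omega>
  have J_meas[measurable]: "J n \<in> borel_measurable M" for n
    unfolding J_def using el t(2) by (rule elementary_integral_measurable)
  have \<phi>_meas: "(\<lambda>(s, \<omega>). \<phi> s \<omega> (g j)) \<in> borel_measurable (rect t)" for j
    using I t(2) by (intro predictable_measurable_rect) (auto simp: has_stoch_integral_def)
  have v_meas: "(\<lambda>(s, \<omega>). ?v n s \<omega> (g j)) \<in> borel_measurable (rect t)" for n j
    using el t(2) by (rule elementary_value_measurable)
  have hs_\<phi>: "(\<lambda>(s, \<omega>). hs2 g (\<phi> s \<omega>)) \<in> borel_measurable (rect t)"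
    using hs2_measurable[of "\<lambda>x. \<phi> (fst x) (snd x)" g "rect t"] \<phi>_meas by (simp add: split_beta')
  have hs_v: "(\<lambda>(s, \<omega>). hs2 g (?v n s \<omega>)) \<in> borel_measurable (rect t)" for n
    using hs2_measurable[of "\<lambda>x. ?v n (fst x) (snd x)" g "rect t"] v_meas by (simp add: split_beta')
  have hs_diff: "(\<lambda>(s, \<omega>). hs2 g (\<lambda>u. ?v n s \<omega> u - \<phi> s \<omega> u)) \<in> borel_measurable (rect t)" for n
    using hs2_measurable[of "\<lambda>x u. ?v n (fst x) (snd x) u - \<phi> (fst x) (snd x) u" g "rect t"]
      v_meas \<phi>_meas by (simp add: split_beta')
  have V_meas[measurable]: "V \<in> borel_measurable M"
    unfolding V_def by (rule rect_nn_integral(1)[OF hs_\<phi>])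
  have D_meas[measurable]: "D n \<in> borel_measurable M" for n
    unfolding D_def by (rule rect_nn_integral(1)[OF hs_diff])
  have En_eq: "En n \<omega> = (\<integral>\<^sup>+s\<in>{0..t}. hs2 g (?v n s \<omega>) \<partial>lborel)" for n \<omega>
    unfolding En_def by (rule energy_eq[OF el, symmetric])
  have En_meas[measurable]: "En n \<in> borel_measurable M" for n
    using rect_nn_integral(1)[OF hs_v] by (simp add: En_eq[abs_def])
  have En_le: "En n \<omega> \<le> 2 * V \<omega> + 2 * D n \<omega>" if \<omega>: "\<omega> \<in> space M" for n \<omega>
  proof -
    have "En n \<omega> \<le> (\<integral>\<^sup>+s. 2 * (hs2 g (\<phi> s \<omega>) * indicator {0..t} s)
         + 2 * (hs2 g (\<lambda>u. ?v n s \<omega> u - \<phi> s \<omega> u) * indicator {0..t} s) \<partial>lborel)"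
      unfolding En_eq
      by (intro nn_integral_mono) (auto simp: indicator_def hs2_le_diff)
    also have "\<dots> = 2 * V \<omega> + 2 * D n \<omega>"
      unfolding V_def D_def using rect_nn_integral(2)[OF hs_\<phi> \<omega>] rect_nn_integral(2)[OF hs_diff \<omega>]
      by (simp add: nn_integral_add nn_integral_cmult)
    finally show ?thesis .
  qed
  \<comment> \<open>The real series in \<open>hs_norm\<close> agrees with \<open>hs2\<close> once it
    is known to converge. This holds for \<open>\<phi>\<close> by membership in \<open>L20\<close>,
    and for \<open>?v\<close> because its value at each time is a bounded operator.\<close>
  have D_eq: "(\<integral>\<^sup>+s\<in>{0..t}. ennreal ((hs_norm g norm (\<lambda>u. ?v n s \<omega> u - \<phi> s \<omega> u))\<^sup>2) \<partial>lborel) = D n \<omega>"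
    if "\<omega> \<in> space M" for n \<omega>
    unfolding D_def
  proof (rule nn_integral_cong)
    fix s
    show "ennreal ((hs_norm g norm (\<lambda>u. ?v n s \<omega> u - \<phi> s \<omega> u))\<^sup>2) * indicator {0..t} s
        = hs2 g (\<lambda>u. ?v n s \<omega> u - \<phi> s \<omega> u) * indicator {0..t} s"
    proof (cases "s \<in> {0..t}")
      case True
      then have 1: "summable (\<lambda>j. (norm (\<phi> s \<omega> (g j)))\<^sup>2)"
        using I that by (auto simp: has_stoch_integral_def L20_def)
      have "?v n s \<omega> = blinfun_apply (\<Sum>i<m n. indicator {p n i<..p n (Suc i)} s *\<^sub>R \<Phi> n i \<omega>)"
        by (simp add: elementary_value_def blinfun.sum_left blinfun.scaleR_left fun_eq_iff)
      then have 2: "summable (\<lambda>j. (norm (?v n s \<omega> (g j)))\<^sup>2)"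
        using summable_blinfun_g by simp
      have "summable (\<lambda>j. (norm (?v n s \<omega> (g j) - \<phi> s \<omega> (g j)))\<^sup>2)"
      proof (rule summable_comparison_test')
        show "summable (\<lambda>j. 2 * (norm (?v n s \<omega> (g j)))\<^sup>2 + 2 * (norm (\<phi> s \<omega> (g j)))\<^sup>2)"
          using 1 2 by (intro summable_add summable_mult)
        show "norm ((norm (?v n s \<omega> (g j) - \<phi> s \<omega> (g j)))\<^sup>2)
            \<le> 2 * (norm (?v n s \<omega> (g j)))\<^sup>2 + 2 * (norm (\<phi> s \<omega> (g j)))\<^sup>2" for j
          using norm_power2_le_diff[of "?v n s \<omega> (g j) - \<phi> s \<omega> (g j)" "?v n s \<omega> (g j)"] by simp
      qed
      then show ?thesis by (simp add: hs2_eq_hs_norm)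
    qed simp
  qed
  obtain r :: "nat \<Rightarrow> nat" where r: "strict_mono r" and
    AE_lim: "AE \<omega> in M. (\<lambda>n. D (r n) \<omega>) \<longlonglongrightarrow> 0 \<and> (\<lambda>n. ennreal (norm (J (r n) \<omega> - I \<omega>))) \<longlonglongrightarrow> 0"
  proof (rule tendsto_in_prob_AE_subseq[of D "\<lambda>n \<omega>. ennreal (norm (J n \<omega> - I \<omega>))"])
    show "(\<lambda>n. prob {\<omega> \<in> space M. ennreal \<eta> < D n \<omega>}) \<longlonglongrightarrow> 0" if "\<eta> > 0" for \<eta> :: real
      using lim1[OF that] by (simp add: D_eq cong: conj_cong)
    show "(\<lambda>n. prob {\<omega> \<in> space M. ennreal \<eta> < ennreal (norm (J n \<omega> - I \<omega>))}) \<longlonglongrightarrow> 0" if "\<eta> > 0" for \<eta> :: real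
      using lim2[OF that] that by (simp add: J_def ennreal_less_iff)
  qed auto
  \<comment> \<open>The mean of \<open>D\<close> itself may be infinite; the cutoff supplies a
    constant majorant.\<close>
  have D_lim: "(\<lambda>n. \<integral>\<^sup>+\<omega>. min (D (r n) \<omega>) (4 * c) \<partial>M) \<longlonglongrightarrow> (\<integral>\<^sup>+\<omega>. 0 \<partial>M)"
  proof (rule nn_integral_dominated_convergence[where w = "\<lambda>_. 4 * c"])
    show "AE \<omega> in M. (\<lambda>n. min (D (r n) \<omega>) (4 * c)) \<longlonglongrightarrow> 0"
      using AE_lim
    proof eventually_elim
      case (elim \<omega>)
      then show ?case
        using tendsto_sandwich[of "\<lambda>_. 0" "\<lambda>n. min (D (r n) \<omega>) (4 * c)" sequentially "\<lambda>n. D (r n) \<omega>" 0]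
        by simp
    qed
    show "(\<integral>\<^sup>+\<omega>. 4 * c \<partial>M) < \<infinity>"
      using c by (simp add: emeasure_space_1 ennreal_mult_less_top)
  qed auto
  define H where "H n \<omega> = indicator {\<omega>. En n \<omega> \<le> 4 * c} \<omega> * ennreal ((norm (J n \<omega>))\<^sup>2)" for n \<omega>
  have H_meas: "H n \<in> borel_measurable M" for n
  proof -
    have "H n = (\<lambda>\<omega>. if En n \<omega> \<le> 4 * c then ennreal ((norm (J n \<omega>))\<^sup>2) else 0)"
      by (auto simp: H_def indicator_def)
    then show ?thesis by simp
  qed
  have "(\<integral>\<^sup>+\<omega>. indicator {\<omega>. V \<omega> < c} \<omega> * ennreal ((norm (I \<omega>))\<^sup>2) \<partial>M)
      \<le> (\<integral>\<^sup>+\<omega>. liminf (\<lambda>n. H (r n) \<omega>) \<partial>M)"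
  proof (rule nn_integral_mono_AE)
    show "AE \<omega> in M. indicator {\<omega>. V \<omega> < c} \<omega> * ennreal ((norm (I \<omega>))\<^sup>2) \<le> liminf (\<lambda>n. H (r n) \<omega>)"
      using AE_lim AE_space
    proof eventually_elim
      case (elim \<omega>)
      show ?case
      proof (cases "V \<omega> < c")
        case True
        have "(\<lambda>n. norm (J (r n) \<omega> - I \<omega>)) \<longlonglongrightarrow> 0"
          using elim(1) by (subst (asm) ennreal_0[symmetric], subst (asm) tendsto_ennreal_iff) auto
        then have "(\<lambda>n. J (r n) \<omega>) \<longlonglongrightarrow> I \<omega>"
          by (simp add: LIM_zero_iff tendsto_norm_zero_iff)
        then have lim: "(\<lambda>n. ennreal ((norm (J (r n) \<omega>))\<^sup>2)) \<longlonglongrightarrow> ennreal ((norm (I \<omega>))\<^sup>2)"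
          by (intro tendsto_ennrealI tendsto_power tendsto_norm)
        \<comment> \<open>With \<open>V\<close> and \<open>D\<close> both below \<open>c\<close>,
          the bound \<open>2 * V + 2 * D\<close> does not exceed the truncation level, so the
          indicator in \<open>H\<close> is 1.\<close>
        have "eventually (\<lambda>n. D (r n) \<omega> < c) sequentially"
          using elim(1) c by (intro order_tendstoD(2)[of _ 0]) auto
        then have "eventually (\<lambda>n. ennreal ((norm (J (r n) \<omega>))\<^sup>2) = H (r n) \<omega>) sequentially"
        proof eventually_elim
          case (elim n)
          have "En (r n) \<omega> \<le> 2 * V \<omega> + 2 * D (r n) \<omega>"
            using \<open>\<omega> \<in> space M\<close> by (rule En_le)
          also have "\<dots> \<le> 2 * c + 2 * c"
            using True elim by (intro add_mono mult_left_mono) auto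
          also have "\<dots> = 4 * c"
            by (simp flip: distrib_right)
          finally show ?case by (simp add: H_def)
        qed
        then have "(\<lambda>n. H (r n) \<omega>) \<longlonglongrightarrow> ennreal ((norm (I \<omega>))\<^sup>2)"
          by (rule Lim_transform_eventually[OF lim])
        then have "liminf (\<lambda>n. H (r n) \<omega>) = ennreal ((norm (I \<omega>))\<^sup>2)"
          by (intro lim_imp_Liminf) auto
        then show ?thesis using True by simp
      qed simp
    qed
  qed
  also have "\<dots> \<le> liminf (\<lambda>n. \<integral>\<^sup>+\<omega>. H (r n) \<omega> \<partial>M)"
    by (intro nn_integral_liminf H_meas)
  also have "\<dots> \<le> liminf (\<lambda>n. 2 * (\<integral>\<^sup>+\<omega>. min (V \<omega>) (4 * c) \<partial>M) + 2 * (\<integral>\<^sup>+\<omega>. min (D (r n) \<omega>) (4 * c) \<partial>M))"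
  proof (intro Liminf_mono always_eventually allI)
    fix n
    have "(\<integral>\<^sup>+\<omega>. H (r n) \<omega> \<partial>M) \<le> (\<integral>\<^sup>+\<omega>. min (En (r n) \<omega>) (4 * c) \<partial>M)"
      unfolding H_def En_def J_def using el t(2) by (rule elementary_integral_truncated)
    also have "\<dots> \<le> (\<integral>\<^sup>+\<omega>. 2 * min (V \<omega>) (4 * c) + 2 * min (D (r n) \<omega>) (4 * c) \<partial>M)"
    proof (rule nn_integral_mono)
      fix \<omega> assume "\<omega> \<in> space M"
      then have "En (r n) \<omega> \<le> 2 * V \<omega> + 2 * D (r n) \<omega>" by (rule En_le)
      \<comment> \<open>If \<open>V\<close> or \<open>D\<close> reaches the cutoff, its term alone
        is \<open>2 * (4 * c)\<close> and already dominates the left side.\<close>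
      moreover have "4 * c \<le> 2 * (4 * c)"
        using mult_right_mono[of "1 :: ennreal" 2 "4 * c"] by simp
      ultimately show "min (En (r n) \<omega>) (4 * c) \<le> 2 * min (V \<omega>) (4 * c) + 2 * min (D (r n) \<omega>) (4 * c)"
        by (auto simp: min_def intro: order.trans add_increasing add_increasing2)
    qed
    also have "\<dots> = 2 * (\<integral>\<^sup>+\<omega>. min (V \<omega>) (4 * c) \<partial>M) + 2 * (\<integral>\<^sup>+\<omega>. min (D (r n) \<omega>) (4 * c) \<partial>M)"
      by (simp add: nn_integral_add nn_integral_cmult)
    finally show "(\<integral>\<^sup>+\<omega>. H (r n) \<omega> \<partial>M)
        \<le> 2 * (\<integral>\<^sup>+\<omega>. min (V \<omega>) (4 * c) \<partial>M) + 2 * (\<integral>\<^sup>+\<omega>. min (D (r n) \<omega>) (4 * c) \<partial>M)" .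
  qed
  also have "\<dots> = 2 * (\<integral>\<^sup>+\<omega>. min (V \<omega>) (4 * c) \<partial>M) + 2 * 0"
    using D_lim by (intro lim_imp_Liminf tendsto_add tendsto_const ennreal_tendsto_cmult) auto
  also have "\<dots> \<le> 2 * (\<integral>\<^sup>+\<omega>. 4 * min (V \<omega>) c \<partial>M)"
  proof (simp, intro mult_left_mono nn_integral_mono)
    fix \<omega>
    show "min (V \<omega>) (4 * c) \<le> 4 * min (V \<omega>) c"
      using mult_right_mono[of "1 :: ennreal" 4 "V \<omega>"] by (auto simp: min_def)
  qed auto
  also have "\<dots> = 8 * (\<integral>\<^sup>+\<omega>. min (V \<omega>) c \<partial>M)"
    by (simp add: nn_integral_cmult mult.assoc[symmetric])
  finally show ?thesis .
qed

end

section \<open>Short-time second moments\<close>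

lemma nn_integral_Icc_continuous:
  fixes z :: "real \<Rightarrow> real"
  assumes "continuous_on {0..T} z" "\<And>s. s \<in> {0..T} \<Longrightarrow> 0 \<le> z s" "s \<in> {0..T}"
  shows "(\<integral>\<^sup>+r\<in>{0..s}. ennreal (z r) \<partial>lborel) = ennreal (integral {0..s} z)"
proof (rule nn_integral_has_integral_lebesgue')
  show "(z has_integral integral {0..s} z) {0..s}"
    using assms by (intro integrable_integral integrable_continuous_real continuous_on_subset[OF assms(1)]) auto
qed (use assms in auto)

text \<open>This takes the place of a stopping time. If the level is exceeded, the intermediate
  value theorem gives some \<open>r\<close> with \<open>Z r\<close> equal to \<open>c\<close>;
  otherwise \<open>r = t\<close> serves. Up to \<open>r\<close> the indicator is 1 by monotonicity.
  The choice is made for one path, so no measurable selection of \<open>r\<close> enters.\<close>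

lemma min_nn_integral_le_stopped:
  fixes z :: "real \<Rightarrow> real" and c :: real
  assumes z: "continuous_on {0..T} z" "\<And>s. s \<in> {0..T} \<Longrightarrow> 0 \<le> z s" and t: "t \<in> {0..T}" and c: "0 \<le> c"
  defines "Z \<equiv> \<lambda>s. \<integral>\<^sup>+r\<in>{0..s}. ennreal (z r) \<partial>lborel"
  shows "min (Z t) (ennreal c) \<le> (\<integral>\<^sup>+s\<in>{0..t}. (indicator {s. Z s \<le> ennreal c} s * ennreal (z s)) \<partial>lborel)"
proof -
  define G where "G = (\<lambda>s. integral {0..s} z)"
  have Z_eq: "Z s = ennreal (G s)" if "s \<in> {0..T}" for s
    unfolding Z_def G_def using z that by (rule nn_integral_Icc_continuous)
  have Z_mono: "Z s \<le> Z r" if "s \<le> r" for s r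
    unfolding Z_def using that by (intro nn_integral_mono) (auto simp: indicator_def)
  have "\<exists>r\<in>{0..t}. Z r \<le> ennreal c \<and> min (Z t) (ennreal c) \<le> Z r"
  proof (cases "Z t \<le> ennreal c")
    case True
    then show ?thesis using t by (intro bexI[of _ t]) auto
  next
    case False
    then have "\<not> G t \<le> c"
      using Z_eq[OF t] ennreal_leI by metis
    then have "c \<le> G t" by simp
    moreover have "continuous_on {0..t} G"
      unfolding G_def using t
      by (intro indefinite_integral_continuous_1 integrable_continuous_real continuous_on_subset[OF z(1)]) auto
    ultimately obtain r where "0 \<le> r" "r \<le> t" "G r = c"
      using IVT'[of G 0 c t] t c by (auto simp: G_def)
    then show ?thesis using t by (intro bexI[of _ r]) (auto simp: Z_eq)
  qed
  then obtain r where r: "r \<in> {0..t}" "Z r \<le> ennreal c" "min (Z t) (ennreal c) \<le> Z r" by blast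
  have Zr: "Z r = (\<integral>\<^sup>+s\<in>{0..r}. ennreal (z s) \<partial>lborel)"
    by (simp add: Z_def)
  note r(3)
  also have "Z r \<le> (\<integral>\<^sup>+s\<in>{0..t}. (indicator {s. Z s \<le> ennreal c} s * ennreal (z s)) \<partial>lborel)"
    unfolding Zr
  proof (rule nn_integral_mono)
    fix s
    show "ennreal (z s) * indicator {0..r} s \<le> indicator {s. Z s \<le> ennreal c} s * ennreal (z s) * indicator {0..t} s"
      using r(1,2) Z_mono[of s r] by (auto simp: indicator_def)
  qed
  finally show ?thesis .
qed

lemma set_integral_norm_power2_le:
  fixes v :: "real \<Rightarrow> 'h::{banach, second_countable_topology}"
  assumes "0 \<le> t"
  shows "ennreal ((norm (LINT s:{0..t}|lborel. v s))\<^sup>2) \<le> ennreal t * (\<integral>\<^sup>+s\<in>{0..t}. ennreal ((norm (v s))\<^sup>2) \<partial>lborel)"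
proof (cases "set_integrable lborel {0..t} v")
  case True
  then have int: "integrable lborel (\<lambda>s. indicator {0..t} s *\<^sub>R v s)"
    by (simp add: set_integrable_def)
  then have [measurable]: "(\<lambda>s. indicator {0..t} s *\<^sub>R v s) \<in> borel_measurable lborel" by auto
  let ?n = "\<lambda>s. ennreal (norm (indicator {0..t} s *\<^sub>R v s))"
  have "ennreal (norm (LINT s:{0..t}|lborel. v s)) \<le> (\<integral>\<^sup>+s. ?n s \<partial>lborel)"
    unfolding set_lebesgue_integral_def using int by (rule integral_norm_bound_ennreal)
  also have "\<dots> = (\<integral>\<^sup>+s. ?n s * indicator {0..t} s \<partial>lborel)"
    by (intro nn_integral_cong) (auto simp: indicator_def)
  finally have "(ennreal (norm (LINT s:{0..t}|lborel. v s)))\<^sup>2 \<le> (\<integral>\<^sup>+s. ?n s * indicator {0..t} s \<partial>lborel)\<^sup>2"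
    by (rule power_mono) simp
  also have "\<dots> \<le> (\<integral>\<^sup>+s. (?n s)\<^sup>2 \<partial>lborel) * (\<integral>\<^sup>+s. (indicator {0..t} s)\<^sup>2 \<partial>lborel)"
    by (rule Cauchy_Schwarz_nn_integral) measurable
  also have "(\<integral>\<^sup>+s. (indicator {0..t} s)\<^sup>2 \<partial>lborel) = (\<integral>\<^sup>+s. indicator {0..t} s \<partial>lborel)"
    by (intro nn_integral_cong) (auto simp: indicator_def)
  also have "\<dots> = ennreal t"
    using assms by simp
  also have "(\<integral>\<^sup>+s. (?n s)\<^sup>2 \<partial>lborel) = (\<integral>\<^sup>+s\<in>{0..t}. ennreal ((norm (v s))\<^sup>2) \<partial>lborel)"
    by (intro nn_integral_cong) (auto simp: indicator_def ennreal_power)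
  finally show ?thesis by (simp add: ennreal_power mult.commute)
next
  case False
  \<comment> \<open>The Bochner integral of a non-integrable function is 0 by convention, so the
    bound is trivial here. This case matters because \<open>mild_solution\<close> does not assert
    integrability of its drift.\<close>
  then have "(LINT s:{0..t}|lborel. v s) = 0"
    by (simp add: set_integrable_def set_lebesgue_integral_def not_integrable_integral_eq)
  then show ?thesis by simp
qed

context wiener_setting
begin

text \<open>Time is rounded down to a grid of mesh \<open>1 / Suc n\<close>. The rounded process is
  patched together from countably many measurable variables, and by continuity it converges
  pointwise.\<close>

lemma continuous_measurable_rect:
  fixes X :: "real \<Rightarrow> 'w \<Rightarrow> 'h::{real_normed_vector, second_countable_topology}"
  assumes X: "\<And>s. s \<in> {0..t} \<Longrightarrow> X s \<in> borel_measurable M"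
    and cont: "\<And>\<omega>. \<omega> \<in> space M \<Longrightarrow> continuous_on {0..t} (\<lambda>s. X s \<omega>)"
  shows "(\<lambda>(s, \<omega>). X s \<omega>) \<in> borel_measurable (rect t)"
proof (cases "0 \<le> t")
  case t: True
  \<comment> \<open>The minimum with \<open>t\<close> keeps every grid point in
    \<open>{0..t}\<close>, also for those \<open>k\<close> that no time of the strip
    attains.\<close>
  let ?q = "\<lambda>n k. min t (real k / real (Suc n))"
  let ?k = "\<lambda>n s. nat \<lfloor>s * real (Suc n)\<rfloor>"
  show ?thesis
  proof (rule borel_measurable_LIMSEQ_metric)
    fix n
    show "(\<lambda>x. X (?q n (?k n (fst x))) (snd x)) \<in> borel_measurable (rect t)"
    proof (rule measurable_compose_countable[where f = "\<lambda>k x. X (?q n k) (snd x)"])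
      show "(\<lambda>x. X (?q n k) (snd x)) \<in> borel_measurable (rect t)" for k
      proof -
        have [measurable]: "X (?q n k) \<in> borel_measurable M" using t by (intro X) auto
        show ?thesis unfolding rect_def by (rule measurable_restrict_space1) measurable
      qed
      show "(\<lambda>x. ?k n (fst x)) \<in> rect t \<rightarrow>\<^sub>M count_space UNIV"
        unfolding rect_def by (rule measurable_restrict_space1) measurable
    qed
  next
    fix x assume "x \<in> space (rect t)"
    then obtain s \<omega> where x: "x = (s, \<omega>)" and s: "s \<in> {0..t}" and \<omega>: "\<omega> \<in> space M"
      by (auto simp: space_rect)
    have bound: "\<bar>?q n (?k n s) - s\<bar> \<le> 1 / real (Suc n)" for n
    proof -
      have fl: "real (?k n s) \<le> s * real (Suc n)" "s * real (Suc n) \<le> real (?k n s) + 1"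
        using s by (simp_all add: of_nat_nat floor_le_iff)
      then have "real (?k n s) / real (Suc n) \<le> s" "s \<le> real (?k n s) / real (Suc n) + 1 / real (Suc n)"
        by (simp_all only: pos_divide_le_eq of_nat_0_less_iff zero_less_Suc pos_le_divide_eq flip: add_divide_distrib)
      then show ?thesis using s by auto
    qed
    have "(\<lambda>n. ?q n (?k n s) - s) \<longlonglongrightarrow> 0"
      by (rule tendsto_rabs_zero_cancel, rule tendsto_sandwich[OF _ _ tendsto_const LIMSEQ_Suc[OF lim_1_over_n]])
        (use bound in auto)
    then have "(\<lambda>n. ?q n (?k n s)) \<longlonglongrightarrow> s" by (simp add: LIM_zero_iff)
    then have "(\<lambda>n. X (?q n (?k n s)) \<omega>) \<longlonglongrightarrow> X s \<omega>"
      using t s by (intro continuous_on_tendsto_compose[OF cont[OF \<omega>]]) auto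
    then show "(\<lambda>n. X (?q n (?k n (fst x))) (snd x)) \<longlonglongrightarrow> (case x of (s, \<omega>) \<Rightarrow> X s \<omega>)"
      by (simp add: x)
  qed
next
  case False
  then have "space (rect t) = {}" by (simp add: space_rect)
  then show ?thesis by (simp add: measurable_def)
qed

text \<open>Both solutions fit \<open>eq\<close>: the mild one with remainder
  \<open>S t x - x\<close> and an integrand that changes with \<open>t\<close>, the strong one with
  remainder 0. This is why \<open>\<phi>\<close>, \<open>I\<close>, \<open>r\<close> and
  \<open>v\<close> are chosen after \<open>t\<close>, and only the growth bound in terms of the path
  is common to all times. On an interval this short half of the supremum can be absorbed, so no
  exponential Gronwall factor arises.\<close>

lemma moment_bound:
  fixes P :: "real \<Rightarrow> 'w \<Rightarrow> 'h::{real_inner, banach, second_countable_topology}"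
  assumes P: "cont_adapted M F T P" and \<tau>: "0 \<le> \<tau>" "\<tau> \<le> T"
    and C: "1 \<le> C" "102 * C * \<tau> \<le> 1" and a: "0 \<le> a"
    and eq: "\<And>t. t \<in> {0..\<tau>} \<Longrightarrow> \<exists>\<phi> I r v. has_stoch_integral M F Q g W \<phi> t I \<and> (norm r)\<^sup>2 \<le> a \<and>
      (\<forall>s\<in>{0..t}. \<forall>\<omega>\<in>space M. (norm (v s \<omega>))\<^sup>2 \<le> C * (1 + (norm (P s \<omega> - x))\<^sup>2) \<and>
         hs2 g (\<phi> s \<omega>) \<le> ennreal (C * (1 + (norm (P s \<omega> - x))\<^sup>2))) \<and>
      (AE \<omega> in M. P t \<omega> = x + r + (LINT s:{0..t}|lborel. v s \<omega>) + I \<omega>)"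
    and t: "t \<in> {0..\<tau>}"
  shows "(\<integral>\<^sup>+\<omega>. ennreal ((norm (P t \<omega> - x))\<^sup>2) \<partial>M) \<le> ennreal (6 * a + 102 * C * \<tau>)"
proof -
  define z where "z \<omega> s = 1 + (norm (P s \<omega> - x))\<^sup>2" for \<omega> s
  define Z where "Z s \<omega> = (\<integral>\<^sup>+r\<in>{0..s}. ennreal (z \<omega> r) \<partial>lborel)" for s \<omega>
  define f where "f c s = (\<integral>\<^sup>+\<omega>. indicator {\<omega>. Z s \<omega> \<le> ennreal c} \<omega> * ennreal ((norm (P s \<omega> - x))\<^sup>2) \<partial>M)" for c s
  \<comment> \<open>This allows the factor \<open>t\<close> of the Cauchy-Schwarz inequality for the
    drift to be dropped.\<close>
  have \<tau>1: "\<tau> \<le> 1"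
    using mult_right_mono[of 1 "102 * C" \<tau>] C \<tau> by simp
  have P_meas: "P s \<in> borel_measurable M" if "s \<in> {0..T}" for s
    using P that subalg[OF that] by (auto simp: cont_adapted_def intro: measurable_from_subalg)
  have P_cont: "continuous_on {0..T} (\<lambda>s. P s \<omega>)" if "\<omega> \<in> space M" for \<omega>
    using P that by (auto simp: cont_adapted_def)
  have z_cont: "continuous_on {0..T} (z \<omega>)" if "\<omega> \<in> space M" for \<omega>
    unfolding z_def[abs_def] by (intro continuous_intros P_cont that)
  have z_nonneg: "0 \<le> z \<omega> s" for \<omega> s by (simp add: z_def)
  have z_rect: "(\<lambda>(s, \<omega>). ennreal (z \<omega> s)) \<in> borel_measurable (rect t)" if "t \<le> T" for t
  proof -
    have "(\<lambda>(s, \<omega>). P s \<omega>) \<in> borel_measurable (rect t)"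
      using that by (intro continuous_measurable_rect P_meas continuous_on_subset[OF P_cont]) auto
    then show ?thesis
      unfolding z_def[abs_def] by (simp add: split_beta')
  qed
  have Z_meas: "Z s \<in> borel_measurable M" if "s \<in> {0..T}" for s
    unfolding Z_def[abs_def] using that by (intro rect_nn_integral(1) z_rect) auto
  have Z_eq: "Z s \<omega> = ennreal (integral {0..s} (z \<omega>))" if "\<omega> \<in> space M" "s \<in> {0..T}" for s \<omega>
    unfolding Z_def using z_nonneg by (intro nn_integral_Icc_continuous[where T = T] z_cont that) auto
  have Z_rect: "(\<lambda>(s, \<omega>). Z s \<omega>) \<in> borel_measurable (rect t)" if "t \<le> T" for t
  proof -
    \<comment> \<open>\<open>continuous_measurable_rect\<close> concerns normed spaces, so the
      values of \<open>Z\<close>, which are finite, are treated as reals first.\<close>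
    have "(\<lambda>(s, \<omega>). enn2real (Z s \<omega>)) \<in> borel_measurable (rect t)"
    proof (rule continuous_measurable_rect)
      fix s assume "s \<in> {0..t}"
      then show "(\<lambda>\<omega>. enn2real (Z s \<omega>)) \<in> borel_measurable M"
        using Z_meas[of s] that by auto
    next
      fix \<omega> assume \<omega>: "\<omega> \<in> space M"
      have "continuous_on {0..t} (\<lambda>s. integral {0..s} (z \<omega>))"
        using that by (intro indefinite_integral_continuous_1 integrable_continuous_real
            continuous_on_subset[OF z_cont[OF \<omega>]]) auto
      moreover have "enn2real (Z s \<omega>) = integral {0..s} (z \<omega>)" if "s \<in> {0..t}" for s
        using that \<open>t \<le> T\<close> z_nonneg
        by (auto simp: Z_eq[OF \<omega>] intro!: enn2real_ennreal integral_nonneg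
            integrable_continuous_real continuous_on_subset[OF z_cont[OF \<omega>]])
      ultimately show "continuous_on {0..t} (\<lambda>s. enn2real (Z s \<omega>))"
        using continuous_on_eq[of "{0..t}" "\<lambda>s. integral {0..s} (z \<omega>)" "\<lambda>s. enn2real (Z s \<omega>)"] by simp
    qed
    then have "(\<lambda>x. ennreal (enn2real (Z (fst x) (snd x)))) \<in> borel_measurable (rect t)"
      by (simp add: split_beta')
    then show ?thesis
      by (rule measurable_cong[THEN iffD1, rotated]) (use that in \<open>auto simp: space_rect Z_eq\<close>)
  qed
  have step: "f c t \<le> ennreal (3 * a) + ennreal (51 * C) * (\<integral>\<^sup>+\<omega>. min (Z t \<omega>) (ennreal c) \<partial>M)"
    if c: "0 < c" and t: "t \<in> {0..\<tau>}" for c t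
  proof -
    obtain \<phi> I r v where I: "has_stoch_integral M F Q g W \<phi> t I" and r: "(norm r)\<^sup>2 \<le> a"
      and v: "\<And>s \<omega>. s \<in> {0..t} \<Longrightarrow> \<omega> \<in> space M \<Longrightarrow> (norm (v s \<omega>))\<^sup>2 \<le> C * z \<omega> s"
      and \<phi>: "\<And>s \<omega>. s \<in> {0..t} \<Longrightarrow> \<omega> \<in> space M \<Longrightarrow> hs2 g (\<phi> s \<omega>) \<le> ennreal (C * z \<omega> s)"
      and ae: "AE \<omega> in M. P t \<omega> = x + r + (LINT s:{0..t}|lborel. v s \<omega>) + I \<omega>"
      using eq[OF t] unfolding z_def by blast
    have tT: "0 \<le> t" "t \<le> T" "t \<in> {0..T}" using t \<tau> by auto
    have [measurable]: "Z t \<in> borel_measurable M" "P t \<in> borel_measurable M" "I \<in> borel_measurable M"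
      using Z_meas[OF tT(3)] P_meas[OF tT(3)] I by (auto simp: has_stoch_integral_def)
    define V where "V \<omega> = (\<integral>\<^sup>+s\<in>{0..t}. hs2 g (\<phi> s \<omega>) \<partial>lborel)" for \<omega>
    have CZ: "(\<integral>\<^sup>+s\<in>{0..t}. ennreal (C * z \<omega> s) \<partial>lborel) = ennreal C * Z t \<omega>" if "\<omega> \<in> space M" for \<omega>
      unfolding Z_def using C rect_nn_integral(2)[OF z_rect[OF tT(2)] that]
      by (subst nn_integral_cmult[symmetric])
        (auto simp: ennreal_mult'' mult.assoc z_nonneg intro!: nn_integral_cong)
    have V_le: "V \<omega> \<le> ennreal C * Z t \<omega>" if "\<omega> \<in> space M" for \<omega>
      unfolding V_def CZ[OF that, symmetric] using \<phi> that
      by (intro nn_integral_mono) (auto simp: indicator_def)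
    have v_le: "ennreal ((norm (LINT s:{0..t}|lborel. v s \<omega>))\<^sup>2) \<le> ennreal C * Z t \<omega>" if "\<omega> \<in> space M" for \<omega>
    proof -
      have "ennreal ((norm (LINT s:{0..t}|lborel. v s \<omega>))\<^sup>2)
          \<le> ennreal t * (\<integral>\<^sup>+s\<in>{0..t}. ennreal ((norm (v s \<omega>))\<^sup>2) \<partial>lborel)"
        using tT(1) by (rule set_integral_norm_power2_le)
      also have "\<dots> \<le> 1 * (\<integral>\<^sup>+s\<in>{0..t}. ennreal (C * z \<omega> s) \<partial>lborel)"
      proof (rule mult_mono)
        show "ennreal t \<le> 1" using t \<tau>1 by simp
        show "(\<integral>\<^sup>+s\<in>{0..t}. ennreal ((norm (v s \<omega>))\<^sup>2) \<partial>lborel) \<le> (\<integral>\<^sup>+s\<in>{0..t}. ennreal (C * z \<omega> s) \<partial>lborel)"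
          using v that by (intro nn_integral_mono) (auto simp: indicator_def intro!: ennreal_leI)
      qed auto
      finally show ?thesis by (simp add: CZ that)
    qed
    have V_meas[measurable]: "V \<in> borel_measurable M"
    proof -
      have "(\<lambda>(s, \<omega>). \<phi> s \<omega> (g j)) \<in> borel_measurable (rect t)" for j
        using I tT(2) by (intro predictable_measurable_rect) (auto simp: has_stoch_integral_def)
      then have "(\<lambda>(s, \<omega>). hs2 g (\<phi> s \<omega>)) \<in> borel_measurable (rect t)"
        using hs2_measurable[of "\<lambda>x. \<phi> (fst x) (snd x)" g "rect t"] by (simp add: split_beta')
      then show ?thesis unfolding V_def by (rule rect_nn_integral(1))
    qed
    \<comment> \<open>Where \<open>Z t\<close> is at most \<open>c\<close>, \<open>V\<close> is at
      most \<open>C * c\<close>; the factor 2 yields the strict inequality in the event of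
      \<open>ito_inequality\<close>.\<close>
    let ?K = "ennreal (2 * C * c)"
    have K: "0 < ?K" "?K < \<infinity>" using C c by auto
    let ?i = "\<lambda>\<omega>. indicator {\<omega>. Z t \<omega> \<le> ennreal c} \<omega> :: ennreal"
    let ?w = "\<lambda>\<omega>. indicator {\<omega>. V \<omega> < ?K} \<omega> * ennreal ((norm (I \<omega>))\<^sup>2)"
    have w_meas: "?w \<in> borel_measurable M"
    proof -
      have "?w = (\<lambda>\<omega>. if V \<omega> < ?K then ennreal ((norm (I \<omega>))\<^sup>2) else 0)"
        by (auto simp: indicator_def)
      then show ?thesis by simp
    qed
    have "f c t \<le> (\<integral>\<^sup>+\<omega>. (ennreal (3 * a) + ennreal (3 * C) * min (Z t \<omega>) (ennreal c)) + 3 * ?w \<omega> \<partial>M)"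
      unfolding f_def
    proof (rule nn_integral_mono_AE)
      show "AE \<omega> in M. ?i \<omega> * ennreal ((norm (P t \<omega> - x))\<^sup>2)
          \<le> (ennreal (3 * a) + ennreal (3 * C) * min (Z t \<omega>) (ennreal c)) + 3 * ?w \<omega>"
        using ae AE_space
      proof eventually_elim
        case (elim \<omega>)
        show ?case
        proof (cases "Z t \<omega> \<le> ennreal c")
          case True
          let ?L = "LINT s:{0..t}|lborel. v s \<omega>"
          have "ennreal C * Z t \<omega> \<le> ennreal (C * c)"
            using mult_left_mono[OF True, of "ennreal C"] C c by (simp add: ennreal_mult)
          also have "\<dots> < ?K" using C c by (simp add: ennreal_less_iff)
          finally have VK: "V \<omega> < ?K" using V_le[OF elim(2)] by (rule order.strict_trans1[rotated])
          have tri: "(norm (r + ?L + I \<omega>))\<^sup>2 \<le> 3 * (norm r)\<^sup>2 + 3 * (norm ?L)\<^sup>2 + 3 * (norm (I \<omega>))\<^sup>2"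
          proof -
            have "norm (r + ?L + I \<omega>) \<le> norm r + norm ?L + norm (I \<omega>)"
              using norm_triangle_ineq[of "r + ?L" "I \<omega>"] norm_triangle_ineq[of r ?L] by simp
            then have "(norm (r + ?L + I \<omega>))\<^sup>2 \<le> (norm r + norm ?L + norm (I \<omega>))\<^sup>2"
              by (intro power_mono) auto
            also have "\<dots> \<le> 3 * (norm r)\<^sup>2 + 3 * (norm ?L)\<^sup>2 + 3 * (norm (I \<omega>))\<^sup>2"
              using sum_squares_bound[of "norm r" "norm ?L"] sum_squares_bound[of "norm r" "norm (I \<omega>)"]
                sum_squares_bound[of "norm ?L" "norm (I \<omega>)"]
              by (simp add: power2_eq_square algebra_simps)
            finally show ?thesis .
          qed
          have "P t \<omega> - x = r + ?L + I \<omega>" using elim(1) by simp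
          then have "ennreal ((norm (P t \<omega> - x))\<^sup>2)
              \<le> ennreal (3 * (norm r)\<^sup>2 + 3 * (norm ?L)\<^sup>2 + 3 * (norm (I \<omega>))\<^sup>2)"
            using tri by (simp only:) (rule ennreal_leI)
          also have "\<dots> = 3 * ennreal ((norm r)\<^sup>2) + 3 * ennreal ((norm ?L)\<^sup>2) + 3 * ennreal ((norm (I \<omega>))\<^sup>2)"
            by (simp add: ennreal_mult)
          also have "\<dots> \<le> 3 * ennreal a + 3 * (ennreal C * Z t \<omega>) + 3 * ennreal ((norm (I \<omega>))\<^sup>2)"
            using r v_le[OF elim(2)] by (intro add_mono mult_left_mono ennreal_leI) auto
          finally show ?thesis
            using True VK C a by (simp add: ennreal_mult mult.assoc min_absorb1)
        qed simp
      qed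
    qed
    also have "\<dots> = ennreal (3 * a) + ennreal (3 * C) * (\<integral>\<^sup>+\<omega>. min (Z t \<omega>) (ennreal c) \<partial>M) + 3 * (\<integral>\<^sup>+\<omega>. ?w \<omega> \<partial>M)"
      using w_meas by (simp add: nn_integral_add nn_integral_cmult emeasure_space_1)
    also have "\<dots> \<le> ennreal (3 * a) + ennreal (3 * C) * (\<integral>\<^sup>+\<omega>. min (Z t \<omega>) (ennreal c) \<partial>M)
        + 3 * (8 * (\<integral>\<^sup>+\<omega>. ennreal (2 * C) * min (Z t \<omega>) (ennreal c) \<partial>M))"
    proof (intro add_left_mono mult_left_mono)
      have "(\<integral>\<^sup>+\<omega>. ?w \<omega> \<partial>M) \<le> 8 * (\<integral>\<^sup>+\<omega>. min (V \<omega>) ?K \<partial>M)"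
        using ito_inequality[OF I tT(1,2) K] unfolding V_def .
      also have "\<dots> \<le> 8 * (\<integral>\<^sup>+\<omega>. ennreal (2 * C) * min (Z t \<omega>) (ennreal c) \<partial>M)"
      proof (intro mult_left_mono nn_integral_mono)
        fix \<omega> assume "\<omega> \<in> space M"
        have "V \<omega> \<le> ennreal (2 * C) * Z t \<omega>"
          by (rule order.trans[OF V_le[OF \<open>\<omega> \<in> space M\<close>]])
            (use C in \<open>auto intro!: mult_right_mono ennreal_leI\<close>)
        moreover have "?K = ennreal (2 * C) * ennreal c"
          using C c by (simp add: ennreal_mult)
        ultimately show "min (V \<omega>) ?K \<le> ennreal (2 * C) * min (Z t \<omega>) (ennreal c)"
          by (auto simp: min_def)
      qed auto
      finally show "(\<integral>\<^sup>+\<omega>. ?w \<omega> \<partial>M) \<le> 8 * (\<integral>\<^sup>+\<omega>. ennreal (2 * C) * min (Z t \<omega>) (ennreal c) \<partial>M)" .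
    qed auto
    also have "\<dots> = ennreal (3 * a) + (ennreal (3 * C) + 3 * (8 * ennreal (2 * C))) * (\<integral>\<^sup>+\<omega>. min (Z t \<omega>) (ennreal c) \<partial>M)"
      by (simp add: nn_integral_cmult distrib_right mult.assoc add.assoc)
    \<comment> \<open>51 = 3 + 3 * 8 * 2: the drift carries the 3 of the squared triple sum, the
      stochastic term carries this 3, the 8 of \<open>ito_inequality\<close> and the 2 in
      \<open>?K\<close>.\<close>
    also have "ennreal (3 * C) + 3 * (8 * ennreal (2 * C)) = ennreal (51 * C)"
      using C by (simp add: ennreal_mult flip: distrib_right mult.assoc)
    finally show ?thesis .
  qed
  \<comment> \<open>Exchanging expectation and time integral turns the cut-off energy into truncated
    second moments at earlier times, each cut by the value of \<open>Z\<close> at its own time. This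
    makes the estimate in \<open>step\<close> an inequality for \<open>f c\<close> alone.\<close>
  have min_le: "(\<integral>\<^sup>+\<omega>. min (Z t \<omega>) (ennreal c) \<partial>M) \<le> (\<integral>\<^sup>+s\<in>{0..t}. (1 + f c s) \<partial>lborel)"
    if c: "0 < c" and t: "t \<in> {0..\<tau>}" for c t
  proof -
    have tT: "0 \<le> t" "t \<le> T" "t \<in> {0..T}" using t \<tau> by auto
    let ?h = "\<lambda>s \<omega>. indicator {s. Z s \<omega> \<le> ennreal c} s * ennreal (z \<omega> s)"
    have "(\<lambda>(s, \<omega>). ?h s \<omega>) \<in> borel_measurable (rect t)"
    proof -
      have "(\<lambda>(s, \<omega>). ?h s \<omega>) = (\<lambda>x. if Z (fst x) (snd x) \<le> ennreal c then ennreal (z (snd x) (fst x)) else 0)"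
        by (auto simp: indicator_def)
      then show ?thesis
        using Z_rect[OF tT(2)] z_rect[OF tT(2)] by (simp add: split_beta')
    qed
    then have h_meas: "(\<lambda>(s, \<omega>). ?h s \<omega> * indicator {0..t} s) \<in> borel_measurable (lborel \<Otimes>\<^sub>M M)"
      using rect_indicator[of "\<lambda>(s, \<omega>). ?h s \<omega>" t] by simp
    interpret ps: pair_sigma_finite lborel M ..
    have "(\<integral>\<^sup>+\<omega>. min (Z t \<omega>) (ennreal c) \<partial>M) \<le> (\<integral>\<^sup>+\<omega>. (\<integral>\<^sup>+s\<in>{0..t}. ?h s \<omega> \<partial>lborel) \<partial>M)"
      unfolding Z_def using z_cont z_nonneg tT c
      by (intro nn_integral_mono min_nn_integral_le_stopped[where T = T]) auto
    also have "\<dots> = (\<integral>\<^sup>+s. (\<integral>\<^sup>+\<omega>. ?h s \<omega> * indicator {0..t} s \<partial>M) \<partial>lborel)"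
      using h_meas by (rule ps.Fubini')
    also have "\<dots> \<le> (\<integral>\<^sup>+s\<in>{0..t}. (1 + f c s) \<partial>lborel)"
    proof (rule nn_integral_mono)
      fix s
      show "(\<integral>\<^sup>+\<omega>. ?h s \<omega> * indicator {0..t} s \<partial>M) \<le> (1 + f c s) * indicator {0..t} s"
      proof (cases "s \<in> {0..t}")
        case True
        then have s: "s \<in> {0..T}" using tT by auto
        have "(\<lambda>\<omega>. indicator {\<omega>. Z s \<omega> \<le> ennreal c} \<omega> * ennreal ((norm (P s \<omega> - x))\<^sup>2))
            = (\<lambda>\<omega>. if Z s \<omega> \<le> ennreal c then ennreal ((norm (P s \<omega> - x))\<^sup>2) else 0)"
          by (auto simp: indicator_def)
        then have m: "(\<lambda>\<omega>. indicator {\<omega>. Z s \<omega> \<le> ennreal c} \<omega> * ennreal ((norm (P s \<omega> - x))\<^sup>2)) \<in> borel_measurable M"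
          using Z_meas[OF s] P_meas[OF s] by simp
        have "(\<integral>\<^sup>+\<omega>. ?h s \<omega> \<partial>M) \<le> (\<integral>\<^sup>+\<omega>. 1 + indicator {\<omega>. Z s \<omega> \<le> ennreal c} \<omega> * ennreal ((norm (P s \<omega> - x))\<^sup>2) \<partial>M)"
          by (intro nn_integral_mono) (auto simp: indicator_def z_def)
        also have "\<dots> = 1 + f c s"
          using m by (simp add: nn_integral_add f_def emeasure_space_1)
        finally show ?thesis using True by simp
      qed simp
    qed
    finally show ?thesis .
  qed
  have f_bound: "f c t \<le> ennreal (6 * a + 102 * C * \<tau>)" if c: "0 < c" and t: "t \<in> {0..\<tau>}" for c t
  proof -
    define S where "S = (SUP s\<in>{0..\<tau>}. f c s)"
    have f_le_S: "f c s \<le> S" if "s \<in> {0..\<tau>}" for s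
      unfolding S_def using that by (rule SUP_upper)
    \<comment> \<open>A priori finiteness, with a bound that depends on \<open>c\<close>: an
      infinite supremum could not be subtracted from both sides later.\<close>
    have "S \<le> ennreal (3 * a) + ennreal (51 * C) * ennreal c"
      unfolding S_def
    proof (rule SUP_least)
      fix s assume s: "s \<in> {0..\<tau>}"
      have "(\<integral>\<^sup>+\<omega>. min (Z s \<omega>) (ennreal c) \<partial>M) \<le> (\<integral>\<^sup>+\<omega>. ennreal c \<partial>M)"
        by (intro nn_integral_mono) simp
      then have "(\<integral>\<^sup>+\<omega>. min (Z s \<omega>) (ennreal c) \<partial>M) \<le> ennreal c"
        by (simp add: emeasure_space_1)
      then show "f c s \<le> ennreal (3 * a) + ennreal (51 * C) * ennreal c"
        by (intro order.trans[OF step[OF c s]] add_left_mono mult_left_mono) auto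
    qed
    also have "\<dots> < \<infinity>" by (simp add: ennreal_mult_less_top)
    finally obtain y where y: "S = ennreal y" "0 \<le> y" by (cases S) auto
    have "S \<le> ennreal (3 * a) + ennreal (51 * C) * ((1 + S) * ennreal \<tau>)"
      unfolding S_def
    proof (rule SUP_least, fold S_def)
      fix s assume s: "s \<in> {0..\<tau>}"
      have "(\<integral>\<^sup>+\<omega>. min (Z s \<omega>) (ennreal c) \<partial>M) \<le> (\<integral>\<^sup>+r\<in>{0..s}. (1 + f c r) \<partial>lborel)"
        using c s by (rule min_le)
      also have "\<dots> \<le> (\<integral>\<^sup>+r. (1 + S) * indicator {0..\<tau>} r \<partial>lborel)"
        using s f_le_S by (intro nn_integral_mono) (auto simp: indicator_def)
      also have "\<dots> = (1 + S) * ennreal \<tau>"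
        using \<tau> by (simp add: nn_integral_cmult_indicator)
      finally show "f c s \<le> ennreal (3 * a) + ennreal (51 * C) * ((1 + S) * ennreal \<tau>)"
        by (intro order.trans[OF step[OF c s]] add_left_mono mult_left_mono) auto
    qed
    also have "\<dots> = ennreal (3 * a + 51 * C * ((1 + y) * \<tau>))"
      using y a C \<tau> by (simp add: ennreal_mult ennreal_plus)
    finally have "ennreal y \<le> ennreal (3 * a + 51 * C * ((1 + y) * \<tau>))"
      unfolding y(1) .
    then have "y \<le> 3 * a + 51 * C * ((1 + y) * \<tau>)"
      by (rule ennreal_le_iff[THEN iffD1, rotated]) (use y a C \<tau> in auto)
    \<comment> \<open>Since \<open>102 * C * \<tau> \<le> 1\<close>, at most half of
      \<open>y\<close> stands on the right; moving it over doubles the rest and leaves a bound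
      without \<open>c\<close>.\<close>
    also have "\<dots> = 3 * a + 51 * C * \<tau> + (102 * C * \<tau>) * (y / 2)"
      by (simp add: algebra_simps)
    also have "\<dots> \<le> 3 * a + 51 * C * \<tau> + 1 * (y / 2)"
      using C y by (intro add_left_mono mult_right_mono) auto
    finally have "y \<le> 6 * a + 102 * C * \<tau>" by simp
    then show ?thesis
      unfolding y(1)[symmetric] using f_le_S[OF t] y(1) ennreal_leI order.trans by metis
  qed
  have tT: "t \<in> {0..T}" using t \<tau> by auto
  have "(\<integral>\<^sup>+\<omega>. ennreal ((norm (P t \<omega> - x))\<^sup>2) \<partial>M)
      \<le> (\<integral>\<^sup>+\<omega>. liminf (\<lambda>n. indicator {\<omega>. Z t \<omega> \<le> ennreal (real (Suc n))} \<omega> * ennreal ((norm (P t \<omega> - x))\<^sup>2)) \<partial>M)"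
  proof (rule nn_integral_mono)
    fix \<omega> assume \<omega>: "\<omega> \<in> space M"
    \<comment> \<open>The path is continuous, so \<open>Z t \<omega>\<close> is finite and the
      indicator is 1 for all large cutoffs; Fatou's lemma then removes the cutoff.\<close>
    obtain N where N: "integral {0..t} (z \<omega>) \<le> real N"
      using real_arch_simple by blast
    have "eventually (\<lambda>n. ennreal ((norm (P t \<omega> - x))\<^sup>2)
       \<le> indicator {\<omega>. Z t \<omega> \<le> ennreal (real (Suc n))} \<omega> * ennreal ((norm (P t \<omega> - x))\<^sup>2)) sequentially"
      using eventually_ge_at_top[of N]
    proof eventually_elim
      case (elim n)
      then have "Z t \<omega> \<le> ennreal (real (Suc n))"
        unfolding Z_eq[OF \<omega> tT] using N by (intro ennreal_leI) linarith
      then show ?case by simp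
    qed
    then show "ennreal ((norm (P t \<omega> - x))\<^sup>2)
       \<le> liminf (\<lambda>n. indicator {\<omega>. Z t \<omega> \<le> ennreal (real (Suc n))} \<omega> * ennreal ((norm (P t \<omega> - x))\<^sup>2))"
      by (rule Liminf_bounded)
  qed
  also have "\<dots> \<le> liminf (\<lambda>n. f (real (Suc n)) t)"
    unfolding f_def
  proof (rule nn_integral_liminf)
    fix n
    have "(\<lambda>\<omega>. indicator {\<omega>. Z t \<omega> \<le> ennreal (real (Suc n))} \<omega> * ennreal ((norm (P t \<omega> - x))\<^sup>2))
        = (\<lambda>\<omega>. if Z t \<omega> \<le> ennreal (real (Suc n)) then ennreal ((norm (P t \<omega> - x))\<^sup>2) else 0)"
      by (auto simp: indicator_def)
    then show "(\<lambda>\<omega>. indicator {\<omega>. Z t \<omega> \<le> ennreal (real (Suc n))} \<omega> * ennreal ((norm (P t \<omega> - x))\<^sup>2)) \<in> borel_measurable M"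
      using Z_meas[OF tT] P_meas[OF tT] by simp
  qed
  also have "\<dots> \<le> ennreal (6 * a + 102 * C * \<tau>)"
    using f_bound[OF _ t] by (intro Liminf_le always_eventually allI) auto
  finally show ?thesis .
qed

end

section \<open>The graph norm and growth of the coefficients\<close>

lemma gen_tendsto: "h \<in> gen_dom S \<Longrightarrow> ((\<lambda>t. (S t h - h) /\<^sub>R t) \<longlongrightarrow> gen S h) (at_right 0)"
  unfolding gen_dom_def gen_def using tendsto_Lim[OF trivial_limit_at_right_real] by fastforce

lemma gen_lincomb:
  assumes "h \<in> gen_dom S" "k \<in> gen_dom S"
  shows "a *\<^sub>R h + b *\<^sub>R k \<in> gen_dom S"
    and "gen S (a *\<^sub>R h + b *\<^sub>R k) = a *\<^sub>R gen S h + b *\<^sub>R gen S k"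
proof -
  have "((\<lambda>t. a *\<^sub>R ((S t h - h) /\<^sub>R t) + b *\<^sub>R ((S t k - k) /\<^sub>R t)) \<longlongrightarrow> a *\<^sub>R gen S h + b *\<^sub>R gen S k) (at_right 0)"
    using assms by (intro tendsto_add tendsto_scaleR tendsto_const gen_tendsto)
  moreover have "(\<lambda>t. a *\<^sub>R ((S t h - h) /\<^sub>R t) + b *\<^sub>R ((S t k - k) /\<^sub>R t))
      = (\<lambda>t. (S t (a *\<^sub>R h + b *\<^sub>R k) - (a *\<^sub>R h + b *\<^sub>R k)) /\<^sub>R t)"
    by (simp add: fun_eq_iff blinfun.add_right blinfun.scaleR_right algebra_simps)
  ultimately have lim: "((\<lambda>t. (S t (a *\<^sub>R h + b *\<^sub>R k) - (a *\<^sub>R h + b *\<^sub>R k)) /\<^sub>R t)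
      \<longlongrightarrow> a *\<^sub>R gen S h + b *\<^sub>R gen S k) (at_right 0)" by simp
  then show "a *\<^sub>R h + b *\<^sub>R k \<in> gen_dom S" by (auto simp: gen_dom_def)
  show "gen S (a *\<^sub>R h + b *\<^sub>R k) = a *\<^sub>R gen S h + b *\<^sub>R gen S k"
    using tendsto_Lim[OF trivial_limit_at_right_real lim]
    unfolding gen_def[of S "a *\<^sub>R h + b *\<^sub>R k"] .
qed

lemma gen_diff:
  assumes "h \<in> gen_dom S" "k \<in> gen_dom S"
  shows "h - k \<in> gen_dom S" "gen S (h - k) = gen S h - gen S k"
  using gen_lincomb[OF assms, of 1 "-1"] by simp_all

text \<open>Outside \<open>gen_dom S\<close> both sides are junk, but the same junk; \<open>Metric_space\<close> demands symmetry of the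
  distance for all arguments.\<close>

lemma graph_norm_minus: "graph_norm S (- h) = graph_norm S h"
proof (cases "h \<in> gen_dom S")
  case True
  then show ?thesis using gen_lincomb(2)[of h S h "-1" 0] by (simp add: graph_norm_def)
next
  case False
  have "- h \<notin> gen_dom S" using False gen_lincomb(1)[of "- h" S "- h" "-1" 0] by auto
  then have "gen S (- h) = gen S h"
    using False by (simp add: gen_def gen_dom_def Lim_def t2_space_class.Lim_def)
  then show ?thesis by (simp add: graph_norm_def)
qed

text \<open>Seen as the product norm of a point of the graph, the graph norm inherits the triangle
  inequality.\<close>

lemma graph_norm_eq: "graph_norm S h = norm (h, gen S h)"
  by (simp add: graph_norm_def norm_Pair)

lemma norm_le_graph_norm: "norm h \<le> graph_norm S h"
  using norm_fst_le[of h "gen S h"] by (simp add: graph_norm_eq)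

lemma Metric_space_graph: "Metric_space (gen_dom S) (\<lambda>x y. graph_norm S (x - y))"
proof
  show "0 \<le> graph_norm S (x - y)" for x y by (simp add: graph_norm_eq)
next
  fix x y assume xy: "x \<in> gen_dom S" "y \<in> gen_dom S"
  show "graph_norm S (x - y) = 0 \<longleftrightarrow> x = y"
    using gen_diff[OF xy] by (auto simp: graph_norm_eq zero_prod_def)
next
  fix x y z assume xyz: "x \<in> gen_dom S" "y \<in> gen_dom S" "z \<in> gen_dom S"
  have "(x - z, gen S (x - z)) = (x - y, gen S (x - y)) + (y - z, gen S (y - z))"
    using xyz by (simp add: gen_diff)
  then show "graph_norm S (x - z) \<le> graph_norm S (x - y) + graph_norm S (y - z)"
    unfolding graph_norm_eq by (metis norm_triangle_ineq)
next
  show "graph_norm S (x - y) = graph_norm S (y - x)" for x y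
    using graph_norm_minus[of S "x - y"] by simp
qed

text \<open>The graph norm dominates the norm of the space, so a ball in the graph norm lies in the
  ball of the same radius for the norm in which the estimates are made.\<close>

lemma graph_ball_open:
  fixes S :: "real \<Rightarrow> 'h::{real_inner, banach} \<Rightarrow>\<^sub>L 'h"
  assumes "x0 \<in> gen_dom S" "0 < \<rho>"
  obtains U where "U \<subseteq> gen_dom S" "openin (graph_topology S) U" "x0 \<in> U" "\<And>x. x \<in> U \<Longrightarrow> norm (x0 - x) < \<rho>"
proof -
  interpret Metric_space "gen_dom S" "\<lambda>x y. graph_norm S (x - y)" by (rule Metric_space_graph)
  show thesis
  proof
    show "mball x0 \<rho> \<subseteq> gen_dom S" by (auto simp: mball_def)
    show "openin (graph_topology S) (mball x0 \<rho>)" unfolding graph_topology_def by (rule openin_mball)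
    have "graph_norm S 0 = 0"
      using gen_diff(2)[OF assms(1) assms(1)] by (simp add: graph_norm_def)
    then show "x0 \<in> mball x0 \<rho>" using assms by simp
    show "norm (x0 - x) < \<rho>" if "x \<in> mball x0 \<rho>" for x
      using that norm_le_graph_norm[of "x0 - x" S] by simp
  qed
qed

section \<open>Growth bounds with constants uniform near \<open>x0\<close>\<close>

text \<open>\<open>A\<close> is known to be linear on the span only, so it is replaced there by the
  explicit formula \<open>L\<close> in an orthogonal spanning set, which is bounded term by
  term.\<close>

lemma bounded_linear_on_span:
  fixes A :: "'h::real_inner \<Rightarrow> 'k::real_normed_vector"
  assumes "finite B"
    and lin: "\<And>x y a b. x \<in> span B \<Longrightarrow> y \<in> span B \<Longrightarrow> A (a *\<^sub>R x + b *\<^sub>R y) = a *\<^sub>R A x + b *\<^sub>R A y"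
  obtains c where "\<And>y. y \<in> span B \<Longrightarrow> norm (A y) \<le> c * norm y"
proof -
  obtain C where C: "finite C" "span C = span B" "pairwise orthogonal C"
    using basis_orthogonal[OF \<open>finite B\<close>] by blast
  define L where "L y = (\<Sum>c\<in>C. ((y \<bullet> c) / (c \<bullet> c)) *\<^sub>R A c)" for y
  have L_lin: "L (a *\<^sub>R x + b *\<^sub>R y) = a *\<^sub>R L x + b *\<^sub>R L y" for a b x y
    by (simp add: L_def inner_add_left add_divide_distrib scaleR_add_left sum.distrib scaleR_sum_right)
  have A0: "A 0 = 0" using lin[OF span_zero span_zero, of 0 0] by simp
  have L0: "L 0 = 0" by (simp add: L_def)
  have "y \<in> span B \<and> A y = L y" if "y \<in> span C" for y
    using that
  proof (induction rule: span_induct)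
    case base
    have "x + y \<in> span B \<and> A (x + y) = L (x + y)"
      if "x \<in> span B \<and> A x = L x" "y \<in> span B \<and> A y = L y" for x y
      using lin[of x y 1 1] L_lin[of 1 x 1 y] that by (simp add: span_add)
    moreover have "r *\<^sub>R x \<in> span B \<and> A (r *\<^sub>R x) = L (r *\<^sub>R x)" if "x \<in> span B \<and> A x = L x" for r x
      using lin[of x x r 0] L_lin[of r x 0 x] that by (simp add: span_scale)
    ultimately show ?case
      by (auto simp: subspace_def span_zero A0 L0)
  next
    case (step x)
    have "L x = (\<Sum>c\<in>C. if c = x then A x else 0)"
      unfolding L_def
    proof (rule sum.cong[OF refl])
      fix c assume "c \<in> C"
      then show "((x \<bullet> c) / (c \<bullet> c)) *\<^sub>R A c = (if c = x then A x else 0)"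
        \<comment> \<open>The set may contain 0; the coefficient is then \<open>0 / 0 = 0\<close>,
          in agreement with \<open>A 0 = 0\<close>.\<close>
        using C(3) step A0 by (cases "x = 0") (auto simp: pairwise_def orthogonal_def)
    qed
    then show ?case using C step span_base[of x C] by simp
  qed
  then have "norm (A y) \<le> (\<Sum>c\<in>C. norm c / (c \<bullet> c) * norm (A c)) * norm y" if "y \<in> span B" for y
  proof -
    have "A y = L y" using that \<open>\<And>y. y \<in> span C \<Longrightarrow> _\<close> C(2) by blast
    also have "norm (L y) \<le> (\<Sum>c\<in>C. norm (((y \<bullet> c) / (c \<bullet> c)) *\<^sub>R A c))"
      unfolding L_def by (rule norm_sum)
    also have "\<dots> \<le> (\<Sum>c\<in>C. (norm y * norm c) / (c \<bullet> c) * norm (A c))"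
      by (intro sum_mono) (auto intro!: mult_right_mono divide_right_mono Cauchy_Schwarz_ineq2)
    also have "\<dots> = (\<Sum>c\<in>C. norm c / (c \<bullet> c) * norm (A c)) * norm y"
      unfolding sum_distrib_right by (intro sum.cong) auto
    finally show ?thesis .
  qed
  then show thesis by (rule that)
qed

text \<open>Lipschitz continuity gives growth by comparison with the value at \<open>x0\<close>. For
  \<open>\<sigma>\<close> it is stated with \<open>hs_norm\<close>, so the series of the difference
  must first be shown to converge: this makes the norm nonnegative before squaring and identifies
  its square with \<open>hs2\<close>.\<close>

lemma coefficient_growth:
  fixes \<alpha> :: "'h::real_inner \<Rightarrow> 'h"
  assumes "coefficient_conditions Q g UNIV norm \<alpha> \<sigma>"
  obtains C where "0 \<le> C" "\<And>h. (norm (\<alpha> h))\<^sup>2 \<le> C * (1 + (norm (h - x0))\<^sup>2)"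
    "\<And>h. hs2 g (\<sigma> h) \<le> ennreal (C * (1 + (norm (h - x0))\<^sup>2))"
proof -
  from assms obtain L1 L2 where L1: "\<And>h k. norm (\<alpha> h - \<alpha> k) \<le> L1 * norm (h - k)"
    and L2: "\<And>h k. hs_norm g norm (\<lambda>u. \<sigma> h u - \<sigma> k u) \<le> L2 * norm (h - k)"
    by (auto simp: coefficient_conditions_def)
  have sum: "summable (\<lambda>j. (norm (\<sigma> h (g j)))\<^sup>2)" for h
    using assms by (auto simp: coefficient_conditions_def L20_def)
  have sumd: "summable (\<lambda>j. (norm (\<sigma> h (g j) - \<sigma> k (g j)))\<^sup>2)" for h k
  proof (rule summable_comparison_test')
    show "summable (\<lambda>j. 2 * (norm (\<sigma> h (g j)))\<^sup>2 + 2 * (norm (\<sigma> k (g j)))\<^sup>2)"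
      using sum by (intro summable_add summable_mult)
    show "norm ((norm (\<sigma> h (g j) - \<sigma> k (g j)))\<^sup>2) \<le> 2 * (norm (\<sigma> h (g j)))\<^sup>2 + 2 * (norm (\<sigma> k (g j)))\<^sup>2" for j
      using norm_power2_le_diff[of "\<sigma> h (g j) - \<sigma> k (g j)" "\<sigma> h (g j)"] by simp
  qed
  let ?a = "2 * (norm (\<alpha> x0))\<^sup>2 + 2 * L1\<^sup>2"
  let ?s = "2 * (hs_norm g norm (\<sigma> x0))\<^sup>2 + 2 * L2\<^sup>2"
  show thesis
  proof
    show "0 \<le> ?a + ?s" by simp
  next
    fix h
    have "(norm (\<alpha> h - \<alpha> x0))\<^sup>2 \<le> L1\<^sup>2 * (norm (h - x0))\<^sup>2"
      using power_mono[OF L1[of h x0], of 2] by (simp add: power_mult_distrib)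
    then have "(norm (\<alpha> h))\<^sup>2 \<le> 2 * (norm (\<alpha> x0))\<^sup>2 + 2 * (L1\<^sup>2 * (norm (h - x0))\<^sup>2)"
      using norm_power2_le_diff[of "\<alpha> h" "\<alpha> x0"] by linarith
    also have "\<dots> \<le> ?a * (1 + (norm (h - x0))\<^sup>2) + ?s * (1 + (norm (h - x0))\<^sup>2)"
      by (simp add: algebra_simps)
    finally show "(norm (\<alpha> h))\<^sup>2 \<le> (?a + ?s) * (1 + (norm (h - x0))\<^sup>2)"
      by (simp add: distrib_right)
    have "0 \<le> hs_norm g norm (\<lambda>u. \<sigma> h u - \<sigma> x0 u)"
      unfolding hs_norm_def by (intro real_sqrt_ge_zero suminf_nonneg sumd) simp
    then have "(hs_norm g norm (\<lambda>u. \<sigma> h u - \<sigma> x0 u))\<^sup>2 \<le> L2\<^sup>2 * (norm (h - x0))\<^sup>2"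
      using power_mono[OF L2[of h x0], of 2] by (simp add: power_mult_distrib)
    then have "hs2 g (\<lambda>u. \<sigma> h u - \<sigma> x0 u) \<le> ennreal (L2\<^sup>2 * (norm (h - x0))\<^sup>2)"
      using sumd by (subst hs2_eq_hs_norm[symmetric]) (auto intro: ennreal_leI)
    then have "hs2 g (\<sigma> h) \<le> 2 * ennreal ((hs_norm g norm (\<sigma> x0))\<^sup>2) + 2 * ennreal (L2\<^sup>2 * (norm (h - x0))\<^sup>2)"
      using hs2_eq_hs_norm[where \<phi> = "\<sigma> x0" and g = g, OF sum]
      by (intro order.trans[OF hs2_le_diff[of g "\<sigma> h" "\<sigma> x0"]] add_mono mult_left_mono) auto
    also have "\<dots> = ennreal (2 * (hs_norm g norm (\<sigma> x0))\<^sup>2 + 2 * (L2\<^sup>2 * (norm (h - x0))\<^sup>2))"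
      by (simp add: ennreal_mult)
    also have "\<dots> \<le> ennreal (?a * (1 + (norm (h - x0))\<^sup>2) + ?s * (1 + (norm (h - x0))\<^sup>2))"
      by (intro ennreal_leI) (simp add: algebra_simps)
    finally show "hs2 g (\<sigma> h) \<le> ennreal ((?a + ?s) * (1 + (norm (h - x0))\<^sup>2))"
      by (simp only: distrib_right)
  qed
qed

lemma hs2_blinfun_le: "hs2 g (\<lambda>u. blinfun_apply B (\<phi> u)) \<le> ennreal ((norm B)\<^sup>2) * hs2 g \<phi>"
proof -
  have "(norm (blinfun_apply B (\<phi> u)))\<^sup>2 \<le> (norm B)\<^sup>2 * (norm (\<phi> u))\<^sup>2" for u
    using power_mono[OF norm_blinfun[of B "\<phi> u"], of 2] by (simp add: power_mult_distrib)
  then have "hs2 g (\<lambda>u. blinfun_apply B (\<phi> u)) \<le> (\<Sum>j. ennreal ((norm B)\<^sup>2) * ennreal ((norm (\<phi> (g j)))\<^sup>2))"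
    unfolding hs2_def by (intro suminf_le) (auto simp: ennreal_mult[symmetric] intro!: ennreal_leI)
  then show ?thesis by (simp add: hs2_def ennreal_suminf_cmult)
qed

text \<open>Growth is measured from \<open>x0\<close>, whereas \<open>moment_bound\<close> measures
  it from the initial value \<open>x\<close>. The change of centre costs the factor 3 for every
  \<open>x\<close> in the unit ball around \<open>x0\<close>, so the constants stay uniform in
  \<open>x\<close>.\<close>

lemma norm_power2_shift:
  fixes h :: "'h::real_normed_vector"
  assumes "norm (x0 - x) \<le> 1"
  shows "1 + (norm (h - x0))\<^sup>2 \<le> 3 * (1 + (norm (h - x))\<^sup>2)"
proof -
  have arith: "1 + n \<le> 3 * (1 + m)" if "n \<le> 2 * m + 2 * q" "q \<le> 1" "0 \<le> m" for n m q :: real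
    using that by (simp add: distrib_left)
  show ?thesis
  proof (rule arith)
    show "(norm (h - x0))\<^sup>2 \<le> 2 * (norm (h - x))\<^sup>2 + 2 * (norm (x - x0))\<^sup>2"
      using norm_power2_le_diff[of "h - x0" "h - x"] by simp
    show "(norm (x - x0))\<^sup>2 \<le> 1"
      using assms by (simp add: norm_minus_commute power_le_one)
  qed simp
qed

section \<open>Comparison of the two solutions\<close>

theorem theorem6p6:
  fixes M :: "'w measure" and F :: "real \<Rightarrow> 'w measure" and T \<beta> \<epsilon> \<delta> :: real
    and S :: "real \<Rightarrow> 'h::{real_inner, banach, second_countable_topology} \<Rightarrow>\<^sub>L 'h"
    and Q :: "'u::{real_inner, banach, second_countable_topology} \<Rightarrow>\<^sub>L 'u"
    and e :: "nat \<Rightarrow> 'u" and lam :: "nat \<Rightarrow> real" and g :: "nat \<Rightarrow> 'u"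
    and W :: "real \<Rightarrow> 'w \<Rightarrow> 'u"
    and \<alpha> :: "'h \<Rightarrow> 'h" and \<sigma> :: "'h \<Rightarrow> 'u \<Rightarrow> 'h"
    and K :: "'h set" and X Y :: "'h \<Rightarrow> real \<Rightarrow> 'w \<Rightarrow> 'h" and x0 :: 'h
  assumes "T > 0" and "usual_filtration M F T"
    and "C0_semigroup S" and "\<beta> \<ge> 0" and "\<forall>t\<ge>0. norm (S t) \<le> exp (\<beta> * t)"
    and "covariance_op Q e lam" and "g = U0_basis e lam" and "Q_wiener M F T Q W"
    and "coefficient_conditions Q g UNIV norm \<alpha> \<sigma>"
    and "coefficient_conditions Q g (gen_dom S) (graph_norm S) \<alpha> \<sigma>"
    and "subspace K" and "\<exists>B. finite B \<and> K = span B" and "K \<subseteq> gen_dom S"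
    and "\<forall>x. mild_solution M F T Q g W S \<alpha> \<sigma> x (X x)"
    and "\<forall>x\<in>K. strong_solution_in K M F T Q g W (\<lambda>y. graph_proj S K (gen S y + \<alpha> y)) \<sigma> x (Y x)"
    and "\<epsilon> > 0"
    and "K \<subseteq> gen_dom2 S" and "gen S ` K \<subseteq> gen_adj_dom S"
    and "\<forall>h\<in>K. graph_dist S K (gen S h + \<alpha> h) \<le> \<epsilon>"
    and "\<forall>h\<in>K. \<forall>j. \<sigma> h (g j) \<in> K"
    and "x0 \<in> gen_dom S" and "\<delta> > 0"
  shows "\<exists>\<tau>\<in>{0<..T}. \<exists>U. U \<subseteq> gen_dom S \<and> openin (graph_topology S) U \<and> x0 \<in> U \<and>
    (\<forall>t\<in>{0..\<tau>}. \<forall>x\<in>K \<inter> U.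
       integrable M (\<lambda>\<omega>. (norm (X x t \<omega> - Y x t \<omega>))\<^sup>2) \<and>
       sqrt (LINT \<omega>|M. (norm (X x t \<omega> - Y x t \<omega>))\<^sup>2) \<le> \<delta>)"
proof -
  interpret wiener_setting M F T Q e lam g W
    using assms(2,6,7,8) by unfold_locales
  define E where "E = exp (\<beta> * T)"
  have E1: "1 \<le> E" using assms(1,4) by (simp add: E_def)
  have S_le: "norm (S t) \<le> E" if "t \<in> {0..T}" for t
  proof -
    have "norm (S t) \<le> exp (\<beta> * t)" using assms(5) that by auto
    also have "\<dots> \<le> E" using that assms(4) by (auto simp: E_def intro: mult_left_mono)
    finally show ?thesis .
  qed
  obtain C1 where C1: "0 \<le> C1" and \<alpha>_le: "\<And>h. (norm (\<alpha> h))\<^sup>2 \<le> C1 * (1 + (norm (h - x0))\<^sup>2)"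
    and \<sigma>_le: "\<And>h. hs2 g (\<sigma> h) \<le> ennreal (C1 * (1 + (norm (h - x0))\<^sup>2))"
    using coefficient_growth[OF assms(9), of x0] by blast
  obtain B where B: "finite B" "K = span B" using assms(12) by blast
  obtain c where c: "\<And>y. y \<in> K \<Longrightarrow> norm (gen S y) \<le> c * norm y"
  proof (rule bounded_linear_on_span[OF B(1), of "gen S"])
    show "gen S (a *\<^sub>R x + b *\<^sub>R y) = a *\<^sub>R gen S x + b *\<^sub>R gen S y"
      if "x \<in> span B" "y \<in> span B" for x y a b
      using that assms(13) B(2) by (intro gen_lincomb) auto
  qed (use B(2) that in blast)
  \<comment> \<open>\<open>graph_proj S K\<close> is a bounded operator on the whole space by its
    type, so the projected drift grows at most like \<open>gen S y + \<alpha> y\<close>.\<close>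
  define p where "p = norm (graph_proj S K)"
  \<comment> \<open>The summands cover the lower bound 1 in \<open>moment_bound\<close>, the
    coefficients of the mild equation behind the semigroup, and the drift of the projected equation;
    the diffusion of the latter is covered by the second summand since \<open>E\<close> is at least
    1. Each 3 pays for recentring from \<open>x0\<close> to \<open>x\<close>.\<close>
  define C where "C = 1 + 3 * (E\<^sup>2 * C1) + 3 * (p\<^sup>2 * (2 * C1 + 2 * (c\<^sup>2 * (2 + 2 * (norm x0)\<^sup>2))))"
  have C_ge: "1 \<le> C" "3 * (E\<^sup>2 * C1) \<le> C" "3 * C1 \<le> C"
    "3 * (p\<^sup>2 * (2 * C1 + 2 * (c\<^sup>2 * (2 + 2 * (norm x0)\<^sup>2)))) \<le> C"
  proof -
    have nn: "0 \<le> E\<^sup>2 * C1" "0 \<le> p\<^sup>2 * (2 * C1 + 2 * (c\<^sup>2 * (2 + 2 * (norm x0)\<^sup>2)))"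
      using C1 by simp_all
    moreover have "C1 \<le> E\<^sup>2 * C1"
      using mult_right_mono[of 1 "E\<^sup>2" C1] C1 E1 by (simp add: one_le_power)
    ultimately show "1 \<le> C" "3 * (E\<^sup>2 * C1) \<le> C" "3 * C1 \<le> C"
      "3 * (p\<^sup>2 * (2 * C1 + 2 * (c\<^sup>2 * (2 + 2 * (norm x0)\<^sup>2)))) \<le> C"
      unfolding C_def by linarith+
  qed
  have drift_le: "(norm (graph_proj S K (gen S y + \<alpha> y)))\<^sup>2
      \<le> p\<^sup>2 * (2 * C1 + 2 * (c\<^sup>2 * (2 + 2 * (norm x0)\<^sup>2))) * (1 + (norm (y - x0))\<^sup>2)" if "y \<in> K" for y
  proof -
    let ?n = "(norm (y - x0))\<^sup>2"
    have "(norm (gen S y))\<^sup>2 \<le> c\<^sup>2 * (norm y)\<^sup>2"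
      using power_mono[OF c[OF that], of 2] by (simp add: power_mult_distrib)
    also have "\<dots> \<le> c\<^sup>2 * ((2 + 2 * (norm x0)\<^sup>2) * (1 + ?n))"
    proof (rule mult_left_mono)
      have "(norm y)\<^sup>2 \<le> 2 * (norm x0)\<^sup>2 + 2 * ?n" by (rule norm_power2_le_diff)
      also have "\<dots> \<le> (2 + 2 * (norm x0)\<^sup>2) * (1 + ?n)" by (simp add: algebra_simps)
      finally show "(norm y)\<^sup>2 \<le> (2 + 2 * (norm x0)\<^sup>2) * (1 + ?n)" .
    qed simp
    finally have gen_le: "(norm (gen S y))\<^sup>2 \<le> c\<^sup>2 * ((2 + 2 * (norm x0)\<^sup>2) * (1 + ?n))" .
    have "(norm (gen S y + \<alpha> y))\<^sup>2 \<le> 2 * (norm (\<alpha> y))\<^sup>2 + 2 * (norm (gen S y))\<^sup>2"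
      using norm_power2_le_diff[of "gen S y + \<alpha> y" "\<alpha> y"] by simp
    also have "\<dots> \<le> 2 * (C1 * (1 + ?n)) + 2 * (c\<^sup>2 * ((2 + 2 * (norm x0)\<^sup>2) * (1 + ?n)))"
      using \<alpha>_le[of y] gen_le by linarith
    also have "\<dots> = (2 * C1 + 2 * (c\<^sup>2 * (2 + 2 * (norm x0)\<^sup>2))) * (1 + ?n)"
      by (simp add: algebra_simps)
    finally have 1: "(norm (gen S y + \<alpha> y))\<^sup>2 \<le> (2 * C1 + 2 * (c\<^sup>2 * (2 + 2 * (norm x0)\<^sup>2))) * (1 + ?n)" .
    have "(norm (graph_proj S K (gen S y + \<alpha> y)))\<^sup>2 \<le> p\<^sup>2 * (norm (gen S y + \<alpha> y))\<^sup>2"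
      using power_mono[OF norm_blinfun[of "graph_proj S K" "gen S y + \<alpha> y"], of 2]
      by (simp add: power_mult_distrib p_def)
    also have "\<dots> \<le> p\<^sup>2 * ((2 * C1 + 2 * (c\<^sup>2 * (2 + 2 * (norm x0)\<^sup>2))) * (1 + ?n))"
      using 1 by (rule mult_left_mono) simp
    finally show ?thesis by (simp only: mult.assoc)
  qed
  \<comment> \<open>The final bound is \<open>4 * (6 * a + 102 * C * \<tau>)\<close>. This
    \<open>a\<close> makes the first part half of the square of \<open>\<delta>\<close>, and the
    last entry of the minimum defining \<open>\<tau>\<close> limits the second part to the other
    half.\<close>
  define a where "a = \<delta>\<^sup>2 / 48"
  have a: "0 < a" using assms(22) by (simp add: a_def)
  \<comment> \<open>Passing from \<open>x0\<close> to \<open>x\<close> changes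
    \<open>S t x - x\<close> by at most \<open>(E + 1) * \<rho>\<close>; half of
    \<open>sqrt a\<close> is reserved for this and half for \<open>S t x0 - x0\<close>. The 1 is the
    radius in \<open>norm_power2_shift\<close>.\<close>
  define \<rho> where "\<rho> = min 1 (sqrt a / 2 / (E + 1))"
  have \<rho>: "0 < \<rho>" "\<rho> \<le> 1" "(E + 1) * \<rho> \<le> sqrt a / 2"
  proof -
    show "0 < \<rho>" "\<rho> \<le> 1" using a E1 by (auto simp: \<rho>_def)
    have "(E + 1) * \<rho> \<le> (E + 1) * (sqrt a / 2 / (E + 1))"
      using E1 by (intro mult_left_mono) (auto simp: \<rho>_def)
    also have "\<dots> = sqrt a / 2" using E1 nonzero_mult_div_cancel_left[of "E + 1" "sqrt a / 2"]
      unfolding times_divide_eq_right[symmetric] by linarith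
    finally show "(E + 1) * \<rho> \<le> sqrt a / 2" .
  qed
  have S0: "S 0 = id_blinfun" and "((\<lambda>t. S t x0) \<longlongrightarrow> x0) (at_right 0)"
    using assms(3) by (auto simp: C0_semigroup_def)
  then have "eventually (\<lambda>t. dist (S t x0) x0 < sqrt a / 2) (at_right 0)"
    using a by (intro tendstoD) auto
  then obtain \<tau>0 where \<tau>0: "0 < \<tau>0" "\<And>t. 0 < t \<Longrightarrow> t < \<tau>0 \<Longrightarrow> dist (S t x0) x0 < sqrt a / 2"
    by (auto simp: eventually_at_right_field)
  \<comment> \<open>None of the entries depends on \<open>x\<close>. Halving \<open>\<tau>0\<close>
    secures the strict inequality under which it was obtained.\<close>
  define \<tau> where "\<tau> = Min {T, \<tau>0 / 2, 1 / (102 * C), \<delta>\<^sup>2 / (816 * C)}"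
  have \<tau>: "0 < \<tau>" "\<tau> \<le> T" "\<tau> < \<tau>0" "102 * C * \<tau> \<le> 1" "816 * C * \<tau> \<le> \<delta>\<^sup>2"
  proof -
    show "0 < \<tau>" using assms(1,22) \<tau>0 C_ge(1) by (simp add: \<tau>_def)
    have le: "\<tau> \<le> T" "\<tau> \<le> \<tau>0 / 2" "\<tau> \<le> 1 / (102 * C)" "\<tau> \<le> \<delta>\<^sup>2 / (816 * C)"
      by (simp_all add: \<tau>_def)
    show "\<tau> \<le> T" "\<tau> < \<tau>0" using le(1,2) \<tau>0(1) by auto
    show "102 * C * \<tau> \<le> 1" "816 * C * \<tau> \<le> \<delta>\<^sup>2"
      using le(3,4) C_ge(1) by (simp_all add: field_simps)
  qed
  have S_x0: "norm (S t x0 - x0) \<le> sqrt a / 2" if "t \<in> {0..\<tau>}" for t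
    \<comment> \<open>A limit from the right says nothing at \<open>t = 0\<close>, where
      \<open>S 0\<close> is the identity.\<close>
    using \<tau>0(2)[of t] that \<tau>(3) S0 a by (cases "t = 0") (auto simp: dist_norm)
  obtain U where U: "U \<subseteq> gen_dom S" "openin (graph_topology S) U" "x0 \<in> U"
    "\<And>x. x \<in> U \<Longrightarrow> norm (x0 - x) < \<rho>"
    using graph_ball_open[OF assms(21) \<rho>(1)] by blast
  have bound: "integrable M (\<lambda>\<omega>. (norm (X x t \<omega> - Y x t \<omega>))\<^sup>2) \<and>
       sqrt (LINT \<omega>|M. (norm (X x t \<omega> - Y x t \<omega>))\<^sup>2) \<le> \<delta>"
    if t: "t \<in> {0..\<tau>}" and x: "x \<in> K \<inter> U" for t x
  proof -
    have near: "norm (x0 - x) \<le> 1" "norm (x0 - x) \<le> \<rho>" using U(4)[of x] x \<rho>(2) by auto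
    note shift = norm_power2_shift[OF near(1)]
    have growth: "D * (1 + (norm (h - x0))\<^sup>2) \<le> C * (1 + (norm (h - x))\<^sup>2)" if "0 \<le> D" "3 * D \<le> C" for D and h :: 'h
    proof -
      have "D * (1 + (norm (h - x0))\<^sup>2) \<le> D * (3 * (1 + (norm (h - x))\<^sup>2))"
        using shift that(1) by (rule mult_left_mono)
      also have "\<dots> = (3 * D) * (1 + (norm (h - x))\<^sup>2)" by simp
      also have "\<dots> \<le> C * (1 + (norm (h - x))\<^sup>2)"
        using that(2) by (rule mult_right_mono) simp
      finally show ?thesis .
    qed
    have mX: "mild_solution M F T Q g W S \<alpha> \<sigma> x (X x)" using assms(14) by blast
    have sY: "strong_solution_in K M F T Q g W (\<lambda>y. graph_proj S K (gen S y + \<alpha> y)) \<sigma> x (Y x)"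
      using assms(15) x by blast
    have adapted: "cont_adapted M F T (X x)" "cont_adapted M F T (Y x)"
      using mX sY by (auto simp: mild_solution_def strong_solution_in_def)
    have tT: "t \<in> {0..T}" using t \<tau>(2) by auto
    have [measurable]: "X x t \<in> borel_measurable M" "Y x t \<in> borel_measurable M"
      using adapted tT by (auto simp: cont_adapted_def intro!: measurable_from_subalg[OF subalg[OF tT]])
    have "(\<integral>\<^sup>+\<omega>. ennreal ((norm (X x t \<omega> - x))\<^sup>2) \<partial>M) \<le> ennreal (6 * a + 102 * C * \<tau>)"
    proof (rule moment_bound[OF adapted(1) less_imp_le[OF \<tau>(1)] \<tau>(2) C_ge(1) \<tau>(4) less_imp_le[OF a] _ t])
      fix t assume t: "t \<in> {0..\<tau>}"
      then obtain I where I: "has_stoch_integral M F Q g W (\<lambda>s \<omega> u. S (t - s) (\<sigma> (X x s \<omega>) u)) t I"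
        and ae: "AE \<omega> in M. X x t \<omega> = S t x + (LINT s:{0..t}|lborel. S (t - s) (\<alpha> (X x s \<omega>))) + I \<omega>"
        using mX \<tau>(2) unfolding mild_solution_def by fastforce
      have r: "(norm (S t x - x))\<^sup>2 \<le> a"
      proof -
        have eq: "S t x - x = (S t x0 - x0) + (S t (x - x0) - (x - x0))"
          by (simp add: blinfun.diff_right)
        have "norm (S t x - x) \<le> norm (S t x0 - x0) + (norm (S t (x - x0)) + norm (x - x0))"
          unfolding eq using norm_triangle_ineq[of "S t x0 - x0" "S t (x - x0) - (x - x0)"]
            norm_triangle_ineq4[of "S t (x - x0)" "x - x0"] by linarith
        also have "\<dots> \<le> sqrt a / 2 + (E * \<rho> + \<rho>)"
        proof (intro add_mono S_x0 t)
          have "norm (S t (x - x0)) \<le> norm (S t) * norm (x - x0)" by (rule norm_blinfun)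
          also have "\<dots> \<le> E * \<rho>"
            using S_le[of t] t \<tau>(2) near(2) E1 by (intro mult_mono) (auto simp: norm_minus_commute)
          finally show "norm (S t (x - x0)) \<le> E * \<rho>" .
          show "norm (x - x0) \<le> \<rho>" using near(2) by (simp add: norm_minus_commute)
        qed
        also have "\<dots> \<le> sqrt a" using \<rho>(3) by (simp add: algebra_simps)
        finally show ?thesis using a power_mono[of "norm (S t x - x)" "sqrt a" 2] by simp
      qed
      have v: "(norm (S (t - s) (\<alpha> (X x s \<omega>))))\<^sup>2 \<le> C * (1 + (norm (X x s \<omega> - x))\<^sup>2)"
        and \<phi>: "hs2 g (\<lambda>u. S (t - s) (\<sigma> (X x s \<omega>) u)) \<le> ennreal (C * (1 + (norm (X x s \<omega> - x))\<^sup>2))"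
        if "s \<in> {0..t}" for s \<omega>
      proof -
        have "t - s \<in> {0..T}" using that t \<tau>(2) by auto
        then have E2: "(norm (S (t - s)))\<^sup>2 \<le> E\<^sup>2" using S_le by (intro power_mono) auto
        let ?n = "1 + (norm (X x s \<omega> - x0))\<^sup>2"
        have gr: "E\<^sup>2 * C1 * ?n \<le> C * (1 + (norm (X x s \<omega> - x))\<^sup>2)"
          using C1 C_ge(2) by (intro growth) auto
        have "(norm (S (t - s) (\<alpha> (X x s \<omega>))))\<^sup>2 \<le> (norm (S (t - s)))\<^sup>2 * (norm (\<alpha> (X x s \<omega>)))\<^sup>2"
          using power_mono[OF norm_blinfun[of "S (t - s)" "\<alpha> (X x s \<omega>)"], of 2] by (simp add: power_mult_distrib)
        also have "\<dots> \<le> E\<^sup>2 * (C1 * ?n)"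
          using E2 \<alpha>_le by (intro mult_mono) auto
        finally show "(norm (S (t - s) (\<alpha> (X x s \<omega>))))\<^sup>2 \<le> C * (1 + (norm (X x s \<omega> - x))\<^sup>2)"
          using gr by simp
        have "hs2 g (\<lambda>u. S (t - s) (\<sigma> (X x s \<omega>) u)) \<le> ennreal ((norm (S (t - s)))\<^sup>2) * hs2 g (\<sigma> (X x s \<omega>))"
          by (rule hs2_blinfun_le)
        also have "\<dots> \<le> ennreal (E\<^sup>2) * ennreal (C1 * ?n)"
          using E2 \<sigma>_le by (intro mult_mono ennreal_leI) auto
        also have "\<dots> = ennreal (E\<^sup>2 * C1 * ?n)"
          using C1 by (simp add: ennreal_mult mult.assoc)
        also have "\<dots> \<le> ennreal (C * (1 + (norm (X x s \<omega> - x))\<^sup>2))"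
          using gr by (rule ennreal_leI)
        finally show "hs2 g (\<lambda>u. S (t - s) (\<sigma> (X x s \<omega>) u)) \<le> ennreal (C * (1 + (norm (X x s \<omega> - x))\<^sup>2))" .
      qed
      show "\<exists>\<phi> I r v. has_stoch_integral M F Q g W \<phi> t I \<and> (norm r)\<^sup>2 \<le> a \<and>
          (\<forall>s\<in>{0..t}. \<forall>\<omega>\<in>space M. (norm (v s \<omega>))\<^sup>2 \<le> C * (1 + (norm (X x s \<omega> - x))\<^sup>2) \<and>
             hs2 g (\<phi> s \<omega>) \<le> ennreal (C * (1 + (norm (X x s \<omega> - x))\<^sup>2))) \<and>
          (AE \<omega> in M. X x t \<omega> = x + r + (LINT s:{0..t}|lborel. v s \<omega>) + I \<omega>)"
        using I r v \<phi> ae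
        by (intro exI[of _ "\<lambda>s \<omega> u. S (t - s) (\<sigma> (X x s \<omega>) u)"] exI[of _ I] exI[of _ "S t x - x"]
            exI[of _ "\<lambda>s \<omega>. S (t - s) (\<alpha> (X x s \<omega>))"]) simp
    qed
    moreover have "(\<integral>\<^sup>+\<omega>. ennreal ((norm (Y x t \<omega> - x))\<^sup>2) \<partial>M) \<le> ennreal (6 * a + 102 * C * \<tau>)"
    proof (rule moment_bound[OF adapted(2) less_imp_le[OF \<tau>(1)] \<tau>(2) C_ge(1) \<tau>(4) less_imp_le[OF a] _ t])
      fix t assume t: "t \<in> {0..\<tau>}"
      then obtain I where I: "has_stoch_integral M F Q g W (\<lambda>s \<omega>. \<sigma> (Y x s \<omega>)) t I"
        and ae: "AE \<omega> in M. set_integrable lborel {0..t} (\<lambda>s. graph_proj S K (gen S (Y x s \<omega>) + \<alpha> (Y x s \<omega>))) \<and>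
          Y x t \<omega> = x + (LINT s:{0..t}|lborel. graph_proj S K (gen S (Y x s \<omega>) + \<alpha> (Y x s \<omega>))) + I \<omega>"
        using sY \<tau>(2) unfolding strong_solution_in_def by fastforce
      have ae': "AE \<omega> in M. Y x t \<omega> = x + (LINT s:{0..t}|lborel. graph_proj S K (gen S (Y x s \<omega>) + \<alpha> (Y x s \<omega>))) + I \<omega>"
        using ae by eventually_elim simp
      have v: "(norm (graph_proj S K (gen S (Y x s \<omega>) + \<alpha> (Y x s \<omega>))))\<^sup>2 \<le> C * (1 + (norm (Y x s \<omega> - x))\<^sup>2)"
        and \<phi>: "hs2 g (\<sigma> (Y x s \<omega>)) \<le> ennreal (C * (1 + (norm (Y x s \<omega> - x))\<^sup>2))"
        if "s \<in> {0..t}" "\<omega> \<in> space M" for s \<omega>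
      proof -
        have "Y x s \<omega> \<in> K" using sY that t \<tau>(2) by (auto simp: strong_solution_in_def)
        from drift_le[OF this] show "(norm (graph_proj S K (gen S (Y x s \<omega>) + \<alpha> (Y x s \<omega>))))\<^sup>2
            \<le> C * (1 + (norm (Y x s \<omega> - x))\<^sup>2)"
          by (rule order.trans[OF _ growth]) (use C1 C_ge(4) in auto)
        show "hs2 g (\<sigma> (Y x s \<omega>)) \<le> ennreal (C * (1 + (norm (Y x s \<omega> - x))\<^sup>2))"
          by (rule order.trans[OF \<sigma>_le ennreal_leI[OF growth[OF C1 C_ge(3)]]])
      qed
      show "\<exists>\<phi> I r v. has_stoch_integral M F Q g W \<phi> t I \<and> (norm r)\<^sup>2 \<le> a \<and>
          (\<forall>s\<in>{0..t}. \<forall>\<omega>\<in>space M. (norm (v s \<omega>))\<^sup>2 \<le> C * (1 + (norm (Y x s \<omega> - x))\<^sup>2) \<and>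
             hs2 g (\<phi> s \<omega>) \<le> ennreal (C * (1 + (norm (Y x s \<omega> - x))\<^sup>2))) \<and>
          (AE \<omega> in M. Y x t \<omega> = x + r + (LINT s:{0..t}|lborel. v s \<omega>) + I \<omega>)"
        using I v \<phi> ae' a
        by (intro exI[of _ "\<lambda>s \<omega>. \<sigma> (Y x s \<omega>)"] exI[of _ I] exI[of _ 0]
            exI[of _ "\<lambda>s \<omega>. graph_proj S K (gen S (Y x s \<omega>) + \<alpha> (Y x s \<omega>))"]) simp
    qed
    ultimately have *: "2 * (\<integral>\<^sup>+\<omega>. ennreal ((norm (X x t \<omega> - x))\<^sup>2) \<partial>M) + 2 * (\<integral>\<^sup>+\<omega>. ennreal ((norm (Y x t \<omega> - x))\<^sup>2) \<partial>M)
        \<le> 2 * ennreal (6 * a + 102 * C * \<tau>) + 2 * ennreal (6 * a + 102 * C * \<tau>)"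
      by (intro add_mono mult_left_mono) auto
    have "(\<integral>\<^sup>+\<omega>. ennreal ((norm (X x t \<omega> - Y x t \<omega>))\<^sup>2) \<partial>M)
        \<le> (\<integral>\<^sup>+\<omega>. 2 * ennreal ((norm (X x t \<omega> - x))\<^sup>2) + 2 * ennreal ((norm (Y x t \<omega> - x))\<^sup>2) \<partial>M)"
    proof (rule nn_integral_mono)
      fix \<omega>
      have "(norm (X x t \<omega> - Y x t \<omega>))\<^sup>2 \<le> 2 * (norm (X x t \<omega> - x))\<^sup>2 + 2 * (norm (Y x t \<omega> - x))\<^sup>2"
        using norm_power2_le_diff[of "X x t \<omega> - Y x t \<omega>" "X x t \<omega> - x"] by (simp add: norm_minus_commute)
      then have "ennreal ((norm (X x t \<omega> - Y x t \<omega>))\<^sup>2) \<le> ennreal (2 * (norm (X x t \<omega> - x))\<^sup>2 + 2 * (norm (Y x t \<omega> - x))\<^sup>2)"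
        by (rule ennreal_leI)
      then show "ennreal ((norm (X x t \<omega> - Y x t \<omega>))\<^sup>2) \<le> 2 * ennreal ((norm (X x t \<omega> - x))\<^sup>2) + 2 * ennreal ((norm (Y x t \<omega> - x))\<^sup>2)"
        by (simp add: ennreal_mult)
    qed
    also have "\<dots> = 2 * (\<integral>\<^sup>+\<omega>. ennreal ((norm (X x t \<omega> - x))\<^sup>2) \<partial>M) + 2 * (\<integral>\<^sup>+\<omega>. ennreal ((norm (Y x t \<omega> - x))\<^sup>2) \<partial>M)"
      by (simp add: nn_integral_add nn_integral_cmult)
    also note *
    also have "2 * ennreal (6 * a + 102 * C * \<tau>) + 2 * ennreal (6 * a + 102 * C * \<tau>) = ennreal (4 * (6 * a + 102 * C * \<tau>))"
      by (simp only: distrib_right[symmetric] ennreal_mult'[OF zero_le_numeral]) simp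
    also have "\<dots> \<le> ennreal (\<delta>\<^sup>2)"
      using \<tau>(5) by (intro ennreal_leI) (simp add: a_def algebra_simps)
    finally have le: "(\<integral>\<^sup>+\<omega>. ennreal ((norm (X x t \<omega> - Y x t \<omega>))\<^sup>2) \<partial>M) \<le> ennreal (\<delta>\<^sup>2)" .
    \<comment> \<open>The bound in \<open>ennreal\<close> yields integrability, so the Bochner
      integral below is a genuine value and not the default 0.\<close>
    have int: "integrable M (\<lambda>\<omega>. (norm (X x t \<omega> - Y x t \<omega>))\<^sup>2)"
      using le by (intro integrableI_bounded) (auto intro: le_less_trans)
    moreover have "(LINT \<omega>|M. (norm (X x t \<omega> - Y x t \<omega>))\<^sup>2) \<le> \<delta>\<^sup>2"
      using le nn_integral_eq_integral[OF int] by simp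
    ultimately show ?thesis
      using assms(22) real_le_lsqrt by auto
  qed
  show ?thesis
    using \<tau>(1,2) U(1-3) bound by (intro bexI[of _ \<tau>] exI[of _ U]) auto
qed

end
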